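(* Let $m\in\mathbb Z$ with $|m|>1$ and $\xi\in\mathbb Z_m$. Then $\overline{BS}(m,\xi)$ is a strongly Powers group. In particular it is C*-simple.
   Context: For $p,q\in\mathbb Z\setminus\{0\}$, $BS(p,q)=\langle a,b\mid ab^pa^{-1}=b^q\rangle$, marked by $(a,b)$. $\mathcal G_2$ is the space of normal subgroups of $\mathbb F(a,b)$ with the ultrametric $d(N_1,N_2)=e^{-\lambda}$, $\lambda$ the minimal word length of an element of $N_1\triangle N_2$. $\mathbb Z_m$ is the ring of $m$-adic integers. $\overline{BS}(m,\xi)$ is the limit in $\mathcal G_2$ of $BS(m,\xi_n)$ for any sequence of integers $(\xi_n)$ with $|\xi_n|\to\infty$, $\xi_n\to\xi$ in $\mathbb Z_m$ (exists, independent of the sequence). A group $G$ is a Powers group if for every finite subset $F\subset G\setminus\{1\}$ and every integer $N\ge1$ there exist a partition $G=D\sqcup E$ and elements $g_1,\dots,g_N\in G$ such that $fD\cap D=\emptyset$ for all $f\in F$ and $g_jE\cap g_kE=\emptyset$ for all $j\ne k$. A group is strongly Powers if each of its subnormal subgroups is a Powers group. A group is C*-simple if it is infinite and its reduced C*-algebra (the operator-norm closure of $\mathbb C[G]$ acting on $\ell^2(G)$ by the left regular representation) is simple. *)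

theory Defs
  imports "HOL-Algebra.Coset" "HOL-Analysis.Infinite_Sum"
begin

text \<open>A letter is (g, e): g = False means generator a, g = True means b;
  e = True means the inverse of that generator.\<close>
type_synonym letter = "bool \<times> bool"

definition inv_letter :: "letter \<Rightarrow> letter" where
  "inv_letter x = (fst x, \<not> snd x)"

definition la :: letter where "la = (False, False)"
definition la_inv :: letter where "la_inv = (False, True)"
definition lb :: letter where "lb = (True, False)"
definition lb_inv :: letter where "lb_inv = (True, True)"

fun red_cons :: "letter \<Rightarrow> letter list \<Rightarrow> letter list" where
  "red_cons x [] = [x]"
| "red_cons x (y # ys) = (if y = inv_letter x then ys else x # y # ys)"

definition reduce :: "letter list \<Rightarrow> letter list" where
  "reduce w = foldr red_cons w []"

definition reduced :: "letter list \<Rightarrow> bool" where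
  "reduced w \<longleftrightarrow> (\<forall>i. Suc i < length w \<longrightarrow> w ! Suc i \<noteq> inv_letter (w ! i))"

definition F2 :: "letter list monoid" where
  "F2 = \<lparr>carrier = {w. reduced w}, monoid.mult = (\<lambda>u v. reduce (u @ v)), one = []\<rparr>"

section \<open>Baumslag-Solitar groups, as normal subgroups of F2 (marked by (a,b))\<close>

definition bpow :: "int \<Rightarrow> letter list" where
  "bpow k = (if k \<ge> 0 then replicate (nat k) lb else replicate (nat (- k)) lb_inv)"

definition bs_relator :: "int \<Rightarrow> int \<Rightarrow> letter list" where
  "bs_relator p q = reduce ([la] @ bpow p @ [la_inv] @ bpow (- q))"

text \<open>Kernel of the marking F2 -> BS(p,q): normal closure of a b^p a^-1 b^-q.\<close>
definition BS_ker :: "int \<Rightarrow> int \<Rightarrow> letter list set" where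
  "BS_ker p q = \<Inter>{N. N \<lhd> F2 \<and> bs_relator p q \<in> N}"

definition dG2 :: "letter list set \<Rightarrow> letter list set \<Rightarrow> real" where
  "dG2 N1 N2 = (if N1 = N2 then 0
     else exp (- real (LEAST l. \<exists>w \<in> (N1 - N2) \<union> (N2 - N1). length w = l)))"

definition G2_converges :: "(nat \<Rightarrow> letter list set) \<Rightarrow> letter list set \<Rightarrow> bool" where
  "G2_converges Ns N \<longleftrightarrow> N \<lhd> F2 \<and> (\<lambda>n. dG2 (Ns n) N) \<longlonglongrightarrow> 0"

text \<open>Z_m as the inverse limit of Z / |m|^k Z: compatible sequences of residues.\<close>
definition madic :: "int \<Rightarrow> (nat \<Rightarrow> int) set" where
  "madic m = {\<xi>. \<forall>k. 0 \<le> \<xi> k \<and> \<xi> k < \<bar>m\<bar> ^ k \<and> \<xi> (Suc k) mod \<bar>m\<bar> ^ k = \<xi> k}"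

definition madic_converges :: "int \<Rightarrow> (nat \<Rightarrow> int) \<Rightarrow> (nat \<Rightarrow> int) \<Rightarrow> bool" where
  "madic_converges m xs \<xi> \<longleftrightarrow> (\<forall>k. \<forall>\<^sub>F n in sequentially. xs n mod \<bar>m\<bar> ^ k = \<xi> k)"

definition BSbar :: "int \<Rightarrow> (nat \<Rightarrow> int) \<Rightarrow> letter list set" where
  "BSbar m \<xi> = (THE N. \<forall>xs. filterlim (\<lambda>n. \<bar>xs n\<bar>) at_top sequentially
        \<and> madic_converges m xs \<xi> \<longrightarrow> G2_converges (\<lambda>n. BS_ker m (xs n)) N)"

definition powers_group :: "('a, 'b) monoid_scheme \<Rightarrow> bool" where
  "powers_group G \<longleftrightarrow>
    (\<forall>F (N::nat). finite F \<and> F \<subseteq> carrier G - {\<one>\<^bsub>G\<^esub>} \<and> N \<ge> 1 \<longrightarrow>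
      (\<exists>D E (g :: nat \<Rightarrow> 'a).
         D \<union> E = carrier G \<and> D \<inter> E = {} \<and>
         (\<forall>f\<in>F. (f <#\<^bsub>G\<^esub> D) \<inter> D = {}) \<and>
         (\<forall>j\<in>{1..N}. g j \<in> carrier G) \<and>
         (\<forall>j\<in>{1..N}. \<forall>k\<in>{1..N}. j \<noteq> k \<longrightarrow> (g j <#\<^bsub>G\<^esub> E) \<inter> (g k <#\<^bsub>G\<^esub> E) = {})))"

inductive subnormal :: "('a, 'b) monoid_scheme \<Rightarrow> 'a set \<Rightarrow> bool" for G where
  subnormal_top: "subnormal G (carrier G)"
| subnormal_step: "subnormal G K \<Longrightarrow> H \<lhd> G\<lparr>carrier := K\<rparr> \<Longrightarrow> subnormal G H"

definition strongly_powers :: "('a, 'b) monoid_scheme \<Rightarrow> bool" where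
  "strongly_powers G \<longleftrightarrow> (\<forall>H. subnormal G H \<longrightarrow> powers_group (G\<lparr>carrier := H\<rparr>))"

definition l2 :: "('a, 'b) monoid_scheme \<Rightarrow> ('a \<Rightarrow> complex) set" where
  "l2 G = {f. (\<forall>x. x \<notin> carrier G \<longrightarrow> f x = 0) \<and> (\<lambda>x. (cmod (f x))\<^sup>2) summable_on carrier G}"

definition l2norm :: "('a, 'b) monoid_scheme \<Rightarrow> ('a \<Rightarrow> complex) \<Rightarrow> real" where
  "l2norm G f = sqrt (\<Sum>\<^sub>\<infinity>x\<in>carrier G. (cmod (f x))\<^sup>2)"

type_synonym 'a op = "('a \<Rightarrow> complex) \<Rightarrow> ('a \<Rightarrow> complex)"

definition bop :: "('a, 'b) monoid_scheme \<Rightarrow> 'a op set" where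
  "bop G = {T. (\<forall>f\<in>l2 G. T f \<in> l2 G) \<and> (\<forall>f. f \<notin> l2 G \<longrightarrow> T f = (\<lambda>_. 0)) \<and>
     (\<forall>f\<in>l2 G. \<forall>h\<in>l2 G. T (\<lambda>x. f x + h x) = (\<lambda>x. T f x + T h x)) \<and>
     (\<forall>f\<in>l2 G. \<forall>c. T (\<lambda>x. c * f x) = (\<lambda>x. c * T f x)) \<and>
     (\<exists>C. \<forall>f\<in>l2 G. l2norm G (T f) \<le> C * l2norm G f)}"

definition opnorm :: "('a, 'b) monoid_scheme \<Rightarrow> 'a op \<Rightarrow> real" where
  "opnorm G T = Sup {l2norm G (T f) | f. f \<in> l2 G \<and> l2norm G f \<le> 1}"

definition lreg :: "('a, 'b) monoid_scheme \<Rightarrow> 'a \<Rightarrow> 'a op" where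
  "lreg G g = (\<lambda>f. if f \<in> l2 G
      then (\<lambda>x. if x \<in> carrier G then f (inv\<^bsub>G\<^esub> g \<otimes>\<^bsub>G\<^esub> x) else 0)
      else (\<lambda>_. 0))"

definition group_alg :: "('a, 'b) monoid_scheme \<Rightarrow> 'a op set" where
  "group_alg G = {T. \<exists>S c. finite S \<and> S \<subseteq> carrier G \<and>
      T = (\<lambda>f x. \<Sum>g\<in>S. c g * lreg G g f x)}"

definition op_diff :: "'a op \<Rightarrow> 'a op \<Rightarrow> 'a op" where
  "op_diff T S = (\<lambda>f x. T f x - S f x)"

definition Cred :: "('a, 'b) monoid_scheme \<Rightarrow> 'a op set" where
  "Cred G = {T \<in> bop G. \<forall>\<epsilon>>0. \<exists>S\<in>group_alg G. opnorm G (op_diff T S) < \<epsilon>}"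

definition closed_ideal :: "('a, 'b) monoid_scheme \<Rightarrow> 'a op set \<Rightarrow> 'a op set \<Rightarrow> bool" where
  "closed_ideal G A I \<longleftrightarrow> I \<subseteq> A \<and> (\<lambda>f x. 0) \<in> I \<and>
     (\<forall>T\<in>I. \<forall>S\<in>I. (\<lambda>f x. T f x + S f x) \<in> I) \<and>
     (\<forall>T\<in>I. \<forall>c. (\<lambda>f x. c * T f x) \<in> I) \<and>
     (\<forall>T\<in>I. \<forall>S\<in>A. T \<circ> S \<in> I \<and> S \<circ> T \<in> I) \<and>
     (\<forall>T\<in>A. (\<forall>\<epsilon>>0. \<exists>S\<in>I. opnorm G (op_diff T S) < \<epsilon>) \<longrightarrow> T \<in> I)"

definition cstar_simple :: "('a, 'b) monoid_scheme \<Rightarrow> bool" where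
  "cstar_simple G \<longleftrightarrow> infinite (carrier G) \<and>
     (\<forall>I. closed_ideal G (Cred G) I \<longrightarrow> I = {(\<lambda>f x. 0)} \<or> I = Cred G)"

end

theory Submission
  imports Defs "HOL-Analysis.L2_Norm" "HOL-Computational_Algebra.Polynomial"
begin

text \<open>
  Let \<open>E\<close> be the free abelian group on \<open>e\<^sub>0, e\<^sub>1, \<dots>\<close>. As \<open>q \<rightarrow> \<xi>\<close> and \<open>\<bar>q\<bar> \<rightarrow> \<infinity>\<close>, the elements
  \<open>b, a b\<^bsup>m\<^esup> a\<^sup>-\<^sup>1 = b\<^bsup>q\<^esup>, a b\<^bsup>q - r\<^esup> a\<^sup>-\<^sup>1, \<dots>\<close> of \<open>BS(m, q)\<close> (\<open>r\<close> the residue of \<open>\<xi>\<close> modulo \<open>m\<close>) become independent,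
  and Britton's reduction in \<open>BS(m, q)\<close> of a fixed word eventually agrees with the reduction in an HNN extension of \<open>E\<close>
  which conjugates a subgroup of index \<open>\<bar>m\<bar>\<close> onto the span of \<open>e\<^sub>1, e\<^sub>2, \<dots>\<close>. This HNN extension is the limit.

  It acts on its normal forms, and the cylinders (normal forms with a given prefix) behave like basic open
  sets of an extremely proximal action: every nontrivial element displaces a smaller cylinder, and every
  complement of a cylinder can be moved into that cylinder. The second property passes to nontrivial normal
  subgroups by conjugation, hence to subnormal ones, and both together give the Powers property.
  For C*-simplicity, an element of a nonzero ideal is normalised to have coefficient \<open>1\<close> at the identity and
  averaged over the elements provided by the Powers property, which brings it close to the identity operator.\<close>

text \<open>The limit is given by a \<open>THE\<close> and has no presentation, so it is identified
  as the kernel of an action. For BS(m, q) two facts replace Britton's lemma. A word in the kernel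
  fixes every normal form, because the relator does. A word fixing a single normal form lies in the
  kernel, because evaluating normal forms in any quotient of \<open>F2\<close> that kills the
  relator is equivariant. Membership in \<open>BS_ker\<close> thus becomes a finite computation on
  one normal form, which stabilises along the sequence. Freeness of the limit action comes from the
  same two facts, and it is what makes nontrivial elements displace cylinders. As the modulus q
  grows, one of the two associated subgroups acquires infinite index in the limit. This gives
  infinitely many disjoint cylinders and a free choice of letters when a prefix is extended. The
  other has index |m| > 1, so b lies outside both, which drives the compression. Finite normal forms
  stand in for boundary points: a cylinder contains all normal forms with a given prefix, whatever
  their tail in the base.\<close>

section \<open>Extremely proximal actions and the Powers property\<close>

text \<open>Members of \<open>\<B>\<close> play the role of basic open sets of \<open>\<Omega>\<close>.\<close>
locale proximal_action = group G for G (structure) +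
  fixes \<Omega> :: "'o set" and act :: "'a \<Rightarrow> 'o \<Rightarrow> 'o" and \<B> :: "'o set set"
  assumes act_closed: "\<lbrakk>g \<in> carrier G; \<omega> \<in> \<Omega>\<rbrakk> \<Longrightarrow> act g \<omega> \<in> \<Omega>"
    and act_one: "\<omega> \<in> \<Omega> \<Longrightarrow> act \<one> \<omega> = \<omega>"
    and act_mult: "\<lbrakk>g \<in> carrier G; h \<in> carrier G; \<omega> \<in> \<Omega>\<rbrakk> \<Longrightarrow> act (g \<otimes> h) \<omega> = act g (act h \<omega>)"
    and basic_subset: "X \<in> \<B> \<Longrightarrow> X \<subseteq> \<Omega>"
    and basic_nonempty: "X \<in> \<B> \<Longrightarrow> X \<noteq> {}"
    and basic_Int: "\<lbrakk>X \<in> \<B>; Y \<in> \<B>\<rbrakk> \<Longrightarrow> X \<inter> Y = {} \<or> (\<exists>Z\<in>\<B>. Z \<subseteq> X \<inter> Y)"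
    and basic_displace: "\<lbrakk>g \<in> carrier G; g \<noteq> \<one>; X \<in> \<B>\<rbrakk> \<Longrightarrow> \<exists>Y\<in>\<B>. Y \<subseteq> X \<and> act g ` Y \<inter> Y = {}"
    and basic_disjoint: "\<exists>V :: nat \<Rightarrow> 'o set. range V \<subseteq> \<B> \<and> disjoint_family V"
    and basic_compress: "X \<in> \<B> \<Longrightarrow> \<exists>g\<in>carrier G. act g ` (\<Omega> - X) \<subseteq> X"
begin

definition compressing :: "'a set \<Rightarrow> bool" where
  "compressing H \<longleftrightarrow> (\<forall>X\<in>\<B>. \<exists>h\<in>H. act h ` (\<Omega> - X) \<subseteq> X)"

lemma act_inv: "\<lbrakk>g \<in> carrier G; \<omega> \<in> \<Omega>\<rbrakk> \<Longrightarrow> act g (act (inv g) \<omega>) = \<omega>"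
  by (metis act_mult act_one inv_closed r_inv)

text \<open>If \<open>X\<close> and \<open>Y\<close> meet, compressing into a basic subset of the
  intersection is enough. If they are disjoint, the complement of \<open>X\<close> goes into
  \<open>X\<close>, hence into the complement of \<open>Y\<close>, and from there into
  \<open>Y\<close>.\<close>

lemma compressing_extremely_proximal:
  assumes H: "subgroup H G" and c: "compressing H" and X: "X \<in> \<B>" and Y: "Y \<in> \<B>"
  shows "\<exists>h\<in>H. act h ` (\<Omega> - X) \<subseteq> Y"
proof (cases "X \<inter> Y = {}")
  case False
  then obtain Z where Z: "Z \<in> \<B>" "Z \<subseteq> X \<inter> Y" using basic_Int X Y by blast
  then obtain h where "h \<in> H" "act h ` (\<Omega> - Z) \<subseteq> Z" using c unfolding compressing_def by blast
  then show ?thesis using Z by blast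
next
  case True
  obtain h where h: "h \<in> H" "act h ` (\<Omega> - X) \<subseteq> X" using c X unfolding compressing_def by blast
  obtain k where k: "k \<in> H" "act k ` (\<Omega> - Y) \<subseteq> Y" using c Y unfolding compressing_def by blast
  have carr: "h \<in> carrier G" "k \<in> carrier G" using h k H by (auto simp: subgroup.mem_carrier)
  have "act (k \<otimes> h) ` (\<Omega> - X) \<subseteq> Y"
  proof
    fix z assume "z \<in> act (k \<otimes> h) ` (\<Omega> - X)"
    then obtain \<omega> where w: "\<omega> \<in> \<Omega> - X" "z = act k (act h \<omega>)" using carr act_mult by auto
    then have "act h \<omega> \<in> \<Omega> - Y" using h True basic_subset[OF X] by blast
    then show "z \<in> Y" using k w by blast
  qed
  then show ?thesis using h k H by (meson subgroup.m_closed)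
qed

text \<open>If \<open>n\<close> displaces \<open>W\<close> and \<open>h\<close> compresses the complement of \<open>W\<close> into \<open>X\<close>, then the
  conjugate of \<open>n\<close> by \<open>h\<close> compresses the complement of \<open>X\<close> into \<open>X\<close>.\<close>
lemma compressing_normal:
  assumes K: "subgroup K G" and c: "compressing K"
    and N: "N \<subseteq> K" "\<And>h n. \<lbrakk>h \<in> K; n \<in> N\<rbrakk> \<Longrightarrow> h \<otimes> n \<otimes> inv h \<in> N"
    and n: "n \<in> N" "n \<noteq> \<one>"
  shows "compressing N"
  unfolding compressing_def
proof
  fix X assume X: "X \<in> \<B>"
  have nG: "n \<in> carrier G" using n N K by (meson subgroup.mem_carrier subsetD)
  obtain W where W: "W \<in> \<B>" "act n ` W \<inter> W = {}" using basic_displace[OF nG n(2) X] by blast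
  obtain h where h: "h \<in> K" "act h ` (\<Omega> - W) \<subseteq> X"
    using compressing_extremely_proximal[OF K c W(1) X] by blast
  have hG: "h \<in> carrier G" using h K by (meson subgroup.mem_carrier)
  have "act (h \<otimes> n \<otimes> inv h) ` (\<Omega> - X) \<subseteq> X"
  proof
    fix z assume "z \<in> act (h \<otimes> n \<otimes> inv h) ` (\<Omega> - X)"
    then obtain \<omega> where w: "\<omega> \<in> \<Omega>" "\<omega> \<notin> X" "z = act h (act n (act (inv h) \<omega>))"
      using hG nG by (auto simp: act_mult act_closed)
    have "act (inv h) \<omega> \<in> W"
    proof (rule ccontr)
      assume "act (inv h) \<omega> \<notin> W"
      then have "act h (act (inv h) \<omega>) \<in> X" using h(2) act_closed hG w(1) by blast
      then show False using w(2) act_inv[OF hG w(1)] by simp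
    qed
    then have "act n (act (inv h) \<omega>) \<in> \<Omega> - W"
      using W(2) act_closed[OF nG] basic_subset[OF W(1)] by blast
    then show "z \<in> X" using h(2) w(3) by blast
  qed
  then show "\<exists>h\<in>N. act h ` (\<Omega> - X) \<subseteq> X" using N(2)[OF h(1) n(1)] by blast
qed

lemma finite_displace:
  assumes "finite F" "F \<subseteq> carrier G - {\<one>}" "X \<in> \<B>"
  shows "\<exists>Y\<in>\<B>. Y \<subseteq> X \<and> (\<forall>f\<in>F. act f ` Y \<inter> Y = {})"
  using assms
proof (induction F arbitrary: X rule: finite_induct)
  case empty
  then show ?case by blast
next
  case (insert f F)
  then obtain Y where "Y \<in> \<B>" "Y \<subseteq> X" "\<forall>f\<in>F. act f ` Y \<inter> Y = {}" by blast
  moreover obtain Z where "Z \<in> \<B>" "Z \<subseteq> Y" "act f ` Z \<inter> Z = {}"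
    using basic_displace[of f Y] insert.prems calculation(1) by auto
  ultimately show ?case by (intro bexI[of _ Z]) blast+
qed

text \<open>The orbit map of a base point pulls back the partition of the space into
  \<open>U\<close> and its complement. \<open>F\<close> displaces \<open>U\<close>, hence
  \<open>D\<close>; elements compressing the complement of \<open>U\<close> into disjoint sets
  \<open>V j\<close> separate the translates of \<open>E\<close>.\<close>

lemma compressing_imp_powers_group:
  assumes H: "subgroup H G" and c: "compressing H"
  shows "powers_group (G\<lparr>carrier := H\<rparr>)"
  unfolding powers_group_def
proof (intro allI impI)
  fix F and N :: nat
  assume "finite F \<and> F \<subseteq> carrier (G\<lparr>carrier := H\<rparr>) - {\<one>\<^bsub>G\<lparr>carrier := H\<rparr>\<^esub>} \<and> 1 \<le> N"
  then have F: "finite F" "F \<subseteq> H - {\<one>}" by auto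
  have HG: "H \<subseteq> carrier G" using H by (rule subgroup.subset)
  obtain V :: "nat \<Rightarrow> 'o set" where V: "range V \<subseteq> \<B>" "disjoint_family V" using basic_disjoint by blast
  obtain U where U: "U \<in> \<B>" "\<forall>f\<in>F. act f ` U \<inter> U = {}"
    using finite_displace[of F "V 0"] F HG V(1) by blast
  have "\<forall>j. \<exists>h. h \<in> H \<and> act h ` (\<Omega> - U) \<subseteq> V j"
    using compressing_extremely_proximal[OF H c U(1)] V(1) by (meson range_subsetD)
  then obtain g where g: "\<And>j. g j \<in> H" "\<And>j. act (g j) ` (\<Omega> - U) \<subseteq> V j"
    using choice[of "\<lambda>j h. h \<in> H \<and> act h ` (\<Omega> - U) \<subseteq> V j"] by blast
  obtain o0 where o0: "o0 \<in> \<Omega>" using basic_nonempty basic_subset U by blast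
  define D where "D = {h\<in>H. act h o0 \<in> U}"
  define E where "E = {h\<in>H. act h o0 \<notin> U}"
  have "(f <# D) \<inter> D = {}" if "f \<in> F" for f
  proof -
    have False if "d \<in> D" "f \<otimes> d \<in> D" for d
    proof -
      have "act f (act d o0) \<in> U" "act d o0 \<in> U"
        using that \<open>f \<in> F\<close> F HG o0 act_mult[of f d o0] by (auto simp: D_def subset_iff)
      then show False using U(2) \<open>f \<in> F\<close> by blast
    qed
    then show ?thesis unfolding l_coset_def by blast
  qed
  moreover have "(g j <# E) \<inter> (g k <# E) = {}" if "j \<noteq> k" for j k
  proof -
    have *: "act x o0 \<in> V j" if x: "x \<in> g j <# E" for x j
    proof -
      obtain h where h: "h \<in> H" "act h o0 \<notin> U" "x = g j \<otimes> h"
        using x by (auto simp: l_coset_def E_def)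
      then have "act h o0 \<in> \<Omega> - U" using act_closed HG o0 by blast
      moreover have "act x o0 = act (g j) (act h o0)"
        using h g(1) HG o0 by (simp add: act_mult subset_iff)
      ultimately show ?thesis using g(2)[of j] by auto
    qed
    show ?thesis using * V(2) \<open>j \<noteq> k\<close> unfolding disjoint_family_on_def by blast
  qed
  ultimately show "\<exists>D E (g :: nat \<Rightarrow> 'a). D \<union> E = carrier (G\<lparr>carrier := H\<rparr>) \<and> D \<inter> E = {} \<and>
      (\<forall>f\<in>F. (f <#\<^bsub>G\<lparr>carrier := H\<rparr>\<^esub> D) \<inter> D = {}) \<and> (\<forall>j\<in>{1..N}. g j \<in> carrier (G\<lparr>carrier := H\<rparr>)) \<and>
      (\<forall>j\<in>{1..N}. \<forall>k\<in>{1..N}. j \<noteq> k \<longrightarrow> (g j <#\<^bsub>G\<lparr>carrier := H\<rparr>\<^esub> E) \<inter> (g k <#\<^bsub>G\<lparr>carrier := H\<rparr>\<^esub> E) = {})"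
    using g(1) by (intro exI[of _ D] exI[of _ E] exI[of _ g]) (auto simp: D_def E_def l_coset_def)
qed

lemma compressing_carrier: "compressing (carrier G)"
  using basic_compress by (simp add: compressing_def)

text \<open>Compression descends along the subnormal chain by \<open>compressing_normal\<close>,
  which needs a nontrivial element; the descent can stop only at the trivial group.\<close>

lemma subnormal_trivial_or_compressing:
  assumes "subnormal G H"
  shows "subgroup H G \<and> (H = {\<one>} \<or> compressing H)"
  using assms
proof induction
  case subnormal_top
  then show ?case using compressing_carrier subgroup_self by blast
next
  case (subnormal_step K H)
  interpret K: group "G\<lparr>carrier := K\<rparr>" using subnormal_step.IH subgroup_imp_group by blast
  have KG: "subgroup K G" using subnormal_step by blast
  interpret N: normal H "G\<lparr>carrier := K\<rparr>" by fact
  have HK: "H \<subseteq> K" using N.subset by simp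
  have HG: "subgroup H G" using KG N.subgroup_axioms incl_subgroup by blast
  have conj: "h \<otimes> n \<otimes> inv h \<in> H" if "h \<in> K" "n \<in> H" for h n
    using N.inv_op_closed2[of h n] that m_inv_consistent[OF KG] by simp
  have "\<one> \<in> H" using HG subgroup.one_closed by blast
  then consider "H = {\<one>}" | n where "n \<in> H" "n \<noteq> \<one>" by blast
  then show ?case
  proof cases
    case 2
    then have "compressing K" using subnormal_step.IH HK by blast
    then have "compressing H" using compressing_normal[OF KG _ HK conj 2] by blast
    then show ?thesis using HG by blast
  qed (use HG in blast)
qed

text \<open>There is no nontrivial element, so \<open>F\<close> is empty, and an empty
  \<open>E\<close> has disjoint translates.\<close>

lemma powers_group_trivial: "powers_group (G\<lparr>carrier := {\<one>}\<rparr>)"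
  unfolding powers_group_def
  by (intro allI impI exI[of _ "{\<one>}"] exI[of _ "{}"] exI[of _ "\<lambda>_. \<one>"]) (auto simp: l_coset_def)

theorem strongly_powers: "strongly_powers G"
  unfolding strongly_powers_def
  using subnormal_trivial_or_compressing compressing_imp_powers_group powers_group_trivial by blast

lemma powers_group: "powers_group G"
  using compressing_imp_powers_group[OF subgroup_self compressing_carrier] by simp

text \<open>One point outside \<open>V 0\<close> is carried into each of the disjoint sets
  \<open>V j\<close>, so the elements doing this are distinct.\<close>

lemma infinite_carrier: "infinite (carrier G)"
proof
  assume fin: "finite (carrier G)"
  obtain V :: "nat \<Rightarrow> 'o set" where V: "range V \<subseteq> \<B>" "disjoint_family V" using basic_disjoint by blast
  have "\<forall>j. \<exists>h. h \<in> carrier G \<and> act h ` (\<Omega> - V 0) \<subseteq> V j"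
    using compressing_extremely_proximal[OF subgroup_self compressing_carrier] V(1)
    by (meson range_subsetD)
  then obtain h where h: "\<And>j. h j \<in> carrier G \<and> act (h j) ` (\<Omega> - V 0) \<subseteq> V j"
    using choice[of "\<lambda>j h. h \<in> carrier G \<and> act h ` (\<Omega> - V 0) \<subseteq> V j"] by auto
  obtain \<omega> where w: "\<omega> \<in> V 1" using basic_nonempty[of "V 1"] V(1) by blast
  have "V 0 \<inter> V 1 = {}" using V(2) by (auto simp: disjoint_family_on_def)
  then have w': "\<omega> \<in> \<Omega> - V 0" using w V(1) basic_subset[of "V 1"] by blast
  have "inj h"
  proof (rule injI)
    fix j k assume "h j = h k"
    then have "act (h j) \<omega> \<in> V j \<inter> V k" using h[of j] h[of k] w' by auto
    then show "j = k" using disjoint_family_onD[OF V(2), of j k] by auto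
  qed
  moreover have "range h \<subseteq> carrier G" using h by blast
  ultimately show False using fin by (meson finite_imageD finite_subset infinite_UNIV_nat)
qed

end

section \<open>Square-summable functions\<close>

text \<open>Reduces membership and norm bounds to finite partial sums, where the inequalities for
  \<open>L2_set\<close> apply.\<close>

lemma l2_bound:
  assumes "\<And>x. x \<notin> carrier G \<Longrightarrow> f x = 0" "0 \<le> C"
    and "\<And>A. \<lbrakk>finite A; A \<subseteq> carrier G\<rbrakk> \<Longrightarrow> (\<Sum>x\<in>A. (cmod (f x))\<^sup>2) \<le> C\<^sup>2"
  shows "f \<in> l2 G" "l2norm G f \<le> C"
proof -
  have s: "(\<lambda>x. (cmod (f x))\<^sup>2) summable_on carrier G"
    by (rule nonneg_bdd_above_summable_on) (auto intro!: bdd_aboveI2[where M="C\<^sup>2"] assms(3))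
  then show "f \<in> l2 G" using assms(1) by (simp add: l2_def)
  have "(\<Sum>\<^sub>\<infinity>x\<in>carrier G. (cmod (f x))\<^sup>2) \<le> C\<^sup>2"
    by (rule infsum_le_finite_sums[OF s]) (use assms(3) in auto)
  then show "l2norm G f \<le> C" unfolding l2norm_def using assms(2) by (simp add: real_le_lsqrt)
qed

lemma l2norm_nonneg: "0 \<le> l2norm G f"
  by (simp add: l2norm_def infsum_nonneg)

lemma l2_outside: "\<lbrakk>f \<in> l2 G; x \<notin> carrier G\<rbrakk> \<Longrightarrow> f x = 0"
  by (simp add: l2_def)

lemma l2norm_square: "(l2norm G f)\<^sup>2 = (\<Sum>\<^sub>\<infinity>x\<in>carrier G. (cmod (f x))\<^sup>2)"
  by (simp add: l2norm_def infsum_nonneg)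

lemma finite_sum_le_l2norm:
  assumes "f \<in> l2 G" "finite A" "A \<subseteq> carrier G"
  shows "(\<Sum>x\<in>A. (cmod (f x))\<^sup>2) \<le> (l2norm G f)\<^sup>2"
  unfolding l2norm_square using assms by (intro finite_sum_le_infsum) (auto simp: l2_def)

lemma L2_set_le_l2norm:
  assumes "f \<in> l2 G" "finite A" "A \<subseteq> carrier G"
  shows "L2_set (\<lambda>x. cmod (f x)) A \<le> l2norm G f"
  unfolding L2_set_def using finite_sum_le_l2norm[OF assms] l2norm_nonneg
  by (meson real_le_lsqrt)

lemma cmod_le_l2norm:
  assumes "f \<in> l2 G"
  shows "cmod (f x) \<le> l2norm G f"
proof (cases "x \<in> carrier G")
  case True
  then show ?thesis using L2_set_le_l2norm[OF assms, of "{x}"] by (simp add: L2_set_def)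
qed (use assms l2norm_nonneg in \<open>simp add: l2_outside\<close>)

lemma l2_add:
  assumes "f \<in> l2 G" "h \<in> l2 G"
  shows "(\<lambda>x. f x + h x) \<in> l2 G" "l2norm G (\<lambda>x. f x + h x) \<le> l2norm G f + l2norm G h"
proof -
  have *: "(\<Sum>x\<in>A. (cmod (f x + h x))\<^sup>2) \<le> (l2norm G f + l2norm G h)\<^sup>2"
    if A: "finite A" "A \<subseteq> carrier G" for A
  proof -
    have "L2_set (\<lambda>x. cmod (f x + h x)) A \<le> L2_set (\<lambda>x. cmod (f x) + cmod (h x)) A"
      by (rule L2_set_mono) (auto intro: norm_triangle_ineq)
    also have "\<dots> \<le> L2_set (\<lambda>x. cmod (f x)) A + L2_set (\<lambda>x. cmod (h x)) A"
      by (rule L2_set_triangle_ineq)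
    also have "\<dots> \<le> l2norm G f + l2norm G h"
      using L2_set_le_l2norm assms A by (metis add_mono)
    finally show ?thesis unfolding L2_set_def by (rule sqrt_le_D)
  qed
  have out: "f x + h x = 0" if "x \<notin> carrier G" for x
    using that assms by (simp add: l2_outside)
  have nn: "0 \<le> l2norm G f + l2norm G h" by (simp add: l2norm_nonneg)
  show "(\<lambda>x. f x + h x) \<in> l2 G" "l2norm G (\<lambda>x. f x + h x) \<le> l2norm G f + l2norm G h"
    using l2_bound[of G "\<lambda>x. f x + h x", OF out nn *] by auto
qed

lemma l2_scale:
  assumes "f \<in> l2 G"
  shows "(\<lambda>x. c * f x) \<in> l2 G" "l2norm G (\<lambda>x. c * f x) = cmod c * l2norm G f"
proof -
  have eq: "(\<lambda>x. (cmod (c * f x))\<^sup>2) = (\<lambda>x. (cmod c)\<^sup>2 * (cmod (f x))\<^sup>2)"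
    by (simp add: norm_mult power_mult_distrib)
  show "(\<lambda>x. c * f x) \<in> l2 G"
    using assms unfolding l2_def by (auto simp: eq intro: summable_on_cmult_right)
  show "l2norm G (\<lambda>x. c * f x) = cmod c * l2norm G f"
    unfolding l2norm_def eq infsum_cmult_right' by (simp add: real_sqrt_mult)
qed

lemma l2_zero: "(\<lambda>_. 0) \<in> l2 G" "l2norm G (\<lambda>_. 0) = 0"
  by (simp_all add: l2_def l2norm_def)

lemma l2_diff:
  assumes "f \<in> l2 G" "h \<in> l2 G"
  shows "(\<lambda>x. f x - h x) \<in> l2 G" "l2norm G (\<lambda>x. f x - h x) \<le> l2norm G f + l2norm G h"
  using l2_add[OF assms(1) l2_scale(1)[OF assms(2), of "-1"]] l2_scale(2)[OF assms(2), of "-1"]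
  by simp_all

lemma l2_sum:
  assumes "finite J" "\<And>j. j \<in> J \<Longrightarrow> f j \<in> l2 G"
  shows "(\<lambda>x. \<Sum>j\<in>J. f j x) \<in> l2 G \<and> l2norm G (\<lambda>x. \<Sum>j\<in>J. f j x) \<le> (\<Sum>j\<in>J. l2norm G (f j))"
  using assms
proof (induction J rule: finite_induct)
  case empty
  then show ?case by (simp add: l2_zero)
next
  case (insert j J)
  then have "(\<lambda>x. \<Sum>j\<in>J. f j x) \<in> l2 G" "l2norm G (\<lambda>x. \<Sum>j\<in>J. f j x) \<le> (\<Sum>j\<in>J. l2norm G (f j))"
    by auto
  with insert l2_add[of "f j" G "\<lambda>x. \<Sum>j\<in>J. f j x"] show ?case by auto
qed

definition restr :: "'a set \<Rightarrow> ('a \<Rightarrow> complex) \<Rightarrow> 'a \<Rightarrow> complex" where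
  "restr A f x = (if x \<in> A then f x else 0)"

lemma l2_restr:
  assumes "f \<in> l2 G"
  shows "restr A f \<in> l2 G" "l2norm G (restr A f) \<le> l2norm G f"
proof -
  have *: "(\<Sum>x\<in>B. (cmod (restr A f x))\<^sup>2) \<le> (l2norm G f)\<^sup>2" if B: "finite B" "B \<subseteq> carrier G" for B
  proof -
    have "(\<Sum>x\<in>B. (cmod (restr A f x))\<^sup>2) \<le> (\<Sum>x\<in>B. (cmod (f x))\<^sup>2)"
      by (rule sum_mono) (simp add: restr_def)
    then show ?thesis using finite_sum_le_l2norm[OF assms B] by linarith
  qed
  have out: "restr A f x = 0" if "x \<notin> carrier G" for x
    using that assms by (simp add: restr_def l2_outside)
  show "restr A f \<in> l2 G" "l2norm G (restr A f) \<le> l2norm G f"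
    using l2_bound[of G "restr A f", OF out l2norm_nonneg *] by auto
qed

text \<open>Bessel's inequality: restrictions to disjoint sets are orthogonal components of
  \<open>f\<close>.\<close>

lemma disjoint_restr_norm_le:
  assumes f: "f \<in> l2 G" and J: "finite J" and disj: "disjoint_family_on A J"
  shows "(\<Sum>j\<in>J. (l2norm G (restr (A j) f))\<^sup>2) \<le> (l2norm G f)\<^sup>2"
proof -
  have s: "(\<lambda>x. (cmod (restr (A j) f x))\<^sup>2) summable_on carrier G" for j
    using l2_restr(1)[OF f] by (simp add: l2_def)
  have le: "(\<Sum>j\<in>J. (cmod (restr (A j) f x))\<^sup>2) \<le> (cmod (f x))\<^sup>2" for x
  proof (cases "\<exists>j\<in>J. x \<in> A j")
    case True
    then obtain j where j: "j \<in> J" "x \<in> A j" by blast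
    have "(\<Sum>i\<in>J. (cmod (restr (A i) f x))\<^sup>2) = (\<Sum>i\<in>{j}. (cmod (restr (A i) f x))\<^sup>2)"
      by (rule sum.mono_neutral_right)
        (use J j disjoint_family_onD[OF disj] in \<open>auto simp: restr_def\<close>)
    then show ?thesis using j by (simp add: restr_def)
  qed (auto simp: restr_def intro!: sum_nonpos)
  have hs: "((\<lambda>x. \<Sum>j\<in>J. (cmod (restr (A j) f x))\<^sup>2) has_sum (\<Sum>j\<in>J. (l2norm G (restr (A j) f))\<^sup>2)) (carrier G)"
    using J by (induction J rule: finite_induct) (auto simp: l2norm_square s intro!: has_sum_add)
  have "((\<lambda>x. (cmod (f x))\<^sup>2) has_sum (l2norm G f)\<^sup>2) (carrier G)"
    using f by (auto simp: l2norm_square l2_def)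
  then show ?thesis using has_sum_mono[OF hs] le by blast
qed

text \<open>Pythagoras for disjoint supports: squares of norms add up. For equal bounds this costs a
  factor \<open>sqrt (card J)\<close>, where the triangle inequality would cost
  \<open>card J\<close>.\<close>

lemma sum_disjoint_restr_norm_le:
  assumes h: "\<And>j. j \<in> J \<Longrightarrow> h j \<in> l2 G" and J: "finite J" and disj: "disjoint_family_on A J"
  shows "(l2norm G (\<lambda>x. \<Sum>j\<in>J. restr (A j) (h j) x))\<^sup>2 \<le> (\<Sum>j\<in>J. (l2norm G (h j))\<^sup>2)"
proof -
  let ?f = "\<lambda>x. \<Sum>j\<in>J. restr (A j) (h j) x"
  let ?C = "sqrt (\<Sum>j\<in>J. (l2norm G (h j))\<^sup>2)"
  have nn: "0 \<le> (\<Sum>j\<in>J. (l2norm G (h j))\<^sup>2)" by (rule sum_nonneg) simp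
  have le: "(cmod (?f x))\<^sup>2 \<le> (\<Sum>j\<in>J. (cmod (h j x))\<^sup>2)" for x
  proof (cases "\<exists>j\<in>J. x \<in> A j")
    case True
    then obtain j where j: "j \<in> J" "x \<in> A j" by blast
    have "?f x = (\<Sum>i\<in>{j}. restr (A i) (h i) x)"
      by (rule sum.mono_neutral_right)
        (use J j disjoint_family_onD[OF disj] in \<open>auto simp: restr_def\<close>)
    then have "?f x = h j x" using j by (simp add: restr_def)
    then show ?thesis using member_le_sum[of j J "\<lambda>j. (cmod (h j x))\<^sup>2"] j J by simp
  next
    case False
    then have "?f x = 0" by (auto simp: restr_def intro!: sum.neutral)
    then show ?thesis by (simp add: sum_nonneg)
  qed
  have *: "(\<Sum>x\<in>B. (cmod (?f x))\<^sup>2) \<le> ?C\<^sup>2" if B: "finite B" "B \<subseteq> carrier G" for B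
  proof -
    have "(\<Sum>x\<in>B. (cmod (?f x))\<^sup>2) \<le> (\<Sum>x\<in>B. \<Sum>j\<in>J. (cmod (h j x))\<^sup>2)"
      by (rule sum_mono) (rule le)
    also have "\<dots> = (\<Sum>j\<in>J. \<Sum>x\<in>B. (cmod (h j x))\<^sup>2)" by (rule sum.swap)
    also have "\<dots> \<le> (\<Sum>j\<in>J. (l2norm G (h j))\<^sup>2)"
      by (rule sum_mono) (rule finite_sum_le_l2norm[OF h B])
    finally show ?thesis using nn by simp
  qed
  have out: "?f x = 0" if "x \<notin> carrier G" for x
    using that l2_outside[OF h] by (auto simp: restr_def intro!: sum.neutral)
  have "l2norm G ?f \<le> ?C"
    by (rule l2_bound(2)[OF out _ *]) (use nn in auto)
  then show ?thesis using nn l2norm_nonneg by (metis power_mono real_sqrt_pow2)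
qed

lemma l2_finite_approx:
  assumes f: "f \<in> l2 G" and e: "\<epsilon> > 0"
  shows "\<exists>A. finite A \<and> A \<subseteq> carrier G \<and> l2norm G (\<lambda>x. f x - restr A f x) < \<epsilon>"
proof -
  let ?q = "\<lambda>x. (cmod (f x))\<^sup>2"
  have s: "?q summable_on carrier G" using f by (simp add: l2_def)
  have "\<epsilon>\<^sup>2 / 2 > 0" using e by simp
  from infsum_finite_approximation[OF s this]
  obtain A where A: "finite A" "A \<subseteq> carrier G" "dist (sum ?q A) (infsum ?q (carrier G)) \<le> \<epsilon>\<^sup>2 / 2"
    by blast
  have "(l2norm G (\<lambda>x. f x - restr A f x))\<^sup>2 = infsum ?q (carrier G - A)"
    unfolding l2norm_square by (rule infsum_cong_neutral) (auto simp: restr_def)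
  also have "\<dots> = infsum ?q (carrier G) - sum ?q A"
    using infsum_Diff[OF s _ A(2)] A by simp
  also have "\<dots> \<le> \<epsilon>\<^sup>2 / 2" using A(3) unfolding dist_real_def by linarith
  also have "\<dots> < \<epsilon>\<^sup>2" using e by simp
  finally show ?thesis using A(1,2) e power_less_imp_less_base by (metis less_eq_real_def)
qed

section \<open>Bounded operators and the reduced C*-algebra\<close>

lemma opnorm_le:
  assumes "\<And>f. f \<in> l2 G \<Longrightarrow> l2norm G (T f) \<le> C * l2norm G f" "0 \<le> C"
  shows "opnorm G T \<le> C"
  unfolding opnorm_def
proof (rule cSup_least)
  show "{l2norm G (T f) |f. f \<in> l2 G \<and> l2norm G f \<le> 1} \<noteq> {}"
    using l2_zero[of G] by (metis (mono_tags, lifting) empty_iff mem_Collect_eq zero_le_one)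
  fix y assume "y \<in> {l2norm G (T f) |f. f \<in> l2 G \<and> l2norm G f \<le> 1}"
  then obtain f where "y = l2norm G (T f)" "f \<in> l2 G" "l2norm G f \<le> 1" by blast
  then show "y \<le> C" using assms(1)[of f] mult_left_mono[of "l2norm G f" 1 C] assms(2) by linarith
qed

lemma bop_closed: "\<lbrakk>T \<in> bop G; f \<in> l2 G\<rbrakk> \<Longrightarrow> T f \<in> l2 G" by (simp add: bop_def)
lemma bop_outside: "\<lbrakk>T \<in> bop G; f \<notin> l2 G\<rbrakk> \<Longrightarrow> T f = (\<lambda>_. 0)" by (simp add: bop_def)
lemma bop_add: "\<lbrakk>T \<in> bop G; f \<in> l2 G; h \<in> l2 G\<rbrakk> \<Longrightarrow> T (\<lambda>x. f x + h x) = (\<lambda>x. T f x + T h x)"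
  by (simp add: bop_def)
lemma bop_scale: "\<lbrakk>T \<in> bop G; f \<in> l2 G\<rbrakk> \<Longrightarrow> T (\<lambda>x. c * f x) = (\<lambda>x. c * T f x)"
  by (simp add: bop_def)
lemma bop_zero: "T \<in> bop G \<Longrightarrow> T (\<lambda>_. 0) = (\<lambda>_. 0)"
  using bop_scale[of T G "\<lambda>_. 0" 0] l2_zero(1) by force

lemma bop_bounded:
  assumes "T \<in> bop G"
  obtains C where "0 \<le> C" "\<And>f. f \<in> l2 G \<Longrightarrow> l2norm G (T f) \<le> C * l2norm G f"
proof -
  obtain C where C: "\<forall>f\<in>l2 G. l2norm G (T f) \<le> C * l2norm G f"
    using assms unfolding bop_def by blast
  have "l2norm G (T f) \<le> max C 0 * l2norm G f" if "f \<in> l2 G" for f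
    using C that l2norm_nonneg[of G f] mult_right_mono[of C "max C 0" "l2norm G f"] by force
  then show ?thesis using that[of "max C 0"] by simp
qed

lemma bop_diff:
  assumes "T \<in> bop G" "f \<in> l2 G" "h \<in> l2 G"
  shows "T (\<lambda>x. f x - h x) = (\<lambda>x. T f x - T h x)"
  using bop_add[OF assms(1,2) l2_scale(1)[OF assms(3), of "-1"]] bop_scale[OF assms(1,3), of "-1"]
  by simp

text \<open>Rescale \<open>f\<close> to norm 1. Boundedness, part of \<open>bop\<close>, is what
  makes the real supremum in \<open>opnorm\<close> an upper bound.\<close>

lemma l2norm_le_opnorm:
  assumes T: "T \<in> bop G" and f: "f \<in> l2 G"
  shows "l2norm G (T f) \<le> opnorm G T * l2norm G f"
proof (cases "l2norm G f = 0")
  case True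
  then have "f = (\<lambda>_. 0)" using cmod_le_l2norm[OF f] by (auto simp: fun_eq_iff)
  then show ?thesis using bop_zero[OF T] l2_zero(2)[of G] by simp
next
  case False
  then have pos: "l2norm G f > 0" using l2norm_nonneg[of G f] by simp
  define c where "c = complex_of_real (1 / l2norm G f)"
  have c: "cmod c = 1 / l2norm G f" using pos by (simp add: c_def norm_divide)
  obtain C where C: "0 \<le> C" "\<And>f. f \<in> l2 G \<Longrightarrow> l2norm G (T f) \<le> C * l2norm G f"
    using bop_bounded[OF T] by blast
  have "l2norm G (T (\<lambda>x. c * f x)) \<le> opnorm G T"
    unfolding opnorm_def
  proof (rule cSup_upper)
    show "l2norm G (T (\<lambda>x. c * f x)) \<in> {l2norm G (T f) |f. f \<in> l2 G \<and> l2norm G f \<le> 1}"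
      using l2_scale[OF f, of c] c pos by force
    show "bdd_above {l2norm G (T f) |f. f \<in> l2 G \<and> l2norm G f \<le> 1}"
    proof (rule bdd_aboveI[of _ C])
      fix y assume "y \<in> {l2norm G (T f) |f. f \<in> l2 G \<and> l2norm G f \<le> 1}"
      then obtain f where "y = l2norm G (T f)" "f \<in> l2 G" "l2norm G f \<le> 1" by blast
      then show "y \<le> C" using C(2)[of f] mult_left_mono[of "l2norm G f" 1 C] C(1) by linarith
    qed
  qed
  then have "(1 / l2norm G f) * l2norm G (T f) \<le> opnorm G T"
    using bop_scale[OF T f] l2_scale(2)[OF bop_closed[OF T f]] c by simp
  then show ?thesis using pos by (simp add: field_simps)
qed

lemma bop_scale_op:
  assumes "T \<in> bop G"
  shows "(\<lambda>f x. c * T f x) \<in> bop G"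
proof -
  obtain C where C: "0 \<le> C" "\<And>f. f \<in> l2 G \<Longrightarrow> l2norm G (T f) \<le> C * l2norm G f"
    using bop_bounded[OF assms] by blast
  have "l2norm G (\<lambda>x. c * T f x) \<le> (cmod c * C) * l2norm G f" if "f \<in> l2 G" for f
    using C(2)[OF that] l2_scale(2)[OF bop_closed[OF assms that]]
    by (simp add: mult_left_mono mult.assoc)
  then show ?thesis
    unfolding bop_def using assms
    by (safe; (auto simp: bop_closed bop_outside bop_add bop_scale l2_scale(1) algebra_simps fun_eq_iff; fail)?) blast
qed

lemma bop_add_op:
  assumes "T \<in> bop G" "S \<in> bop G"
  shows "(\<lambda>f x. T f x + S f x) \<in> bop G"
proof -
  obtain C where C: "\<And>f. f \<in> l2 G \<Longrightarrow> l2norm G (T f) \<le> C * l2norm G f"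
    using bop_bounded[OF assms(1)] by blast
  obtain C' where C': "\<And>f. f \<in> l2 G \<Longrightarrow> l2norm G (S f) \<le> C' * l2norm G f"
    using bop_bounded[OF assms(2)] by blast
  have "l2norm G (\<lambda>x. T f x + S f x) \<le> (C + C') * l2norm G f" if "f \<in> l2 G" for f
    using C[OF that] C'[OF that] l2_add(2)[OF assms[THEN bop_closed[OF _ that]]]
    by (simp add: algebra_simps)
  then show ?thesis
    unfolding bop_def using assms
    by (safe; (auto simp: bop_closed bop_outside bop_add bop_scale l2_add(1) algebra_simps fun_eq_iff; fail)?) blast
qed

lemma bop_zero_op: "(\<lambda>f x. 0) \<in> bop G"
  unfolding bop_def by (auto simp: l2_zero intro!: exI[of _ 0])

lemma bop_sum_op:
  assumes "finite J" "\<And>j. j \<in> J \<Longrightarrow> T j \<in> bop G"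
  shows "(\<lambda>f x. \<Sum>j\<in>J. T j f x) \<in> bop G"
  using assms by (induction J rule: finite_induct) (auto simp: bop_zero_op bop_add_op)

lemma bop_op_diff:
  assumes "T \<in> bop G" "S \<in> bop G"
  shows "op_diff T S \<in> bop G"
  using bop_add_op[OF assms(1) bop_scale_op[OF assms(2), of "-1"]] by (simp add: op_diff_def)

lemma bop_comp:
  assumes "T \<in> bop G" "S \<in> bop G"
  shows "T \<circ> S \<in> bop G"
proof -
  obtain C where C: "0 \<le> C" "\<And>f. f \<in> l2 G \<Longrightarrow> l2norm G (T f) \<le> C * l2norm G f"
    using bop_bounded[OF assms(1)] by blast
  obtain C' where C': "\<And>f. f \<in> l2 G \<Longrightarrow> l2norm G (S f) \<le> C' * l2norm G f"
    using bop_bounded[OF assms(2)] by blast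
  have "l2norm G (T (S f)) \<le> (C * C') * l2norm G f" if "f \<in> l2 G" for f
    using C(2)[OF bop_closed[OF assms(2) that]] mult_left_mono[OF C'[OF that] C(1)]
    by (simp add: mult.assoc)
  then have "\<exists>C. \<forall>f\<in>l2 G. l2norm G ((T \<circ> S) f) \<le> C * l2norm G f" by (metis comp_apply)
  then show ?thesis
    unfolding bop_def using assms
    by (simp add: bop_closed bop_outside bop_add bop_scale bop_zero)
qed

definition delta :: "'a \<Rightarrow> 'a \<Rightarrow> complex" where
  "delta g x = (if x = g then 1 else 0)"

lemma l2_delta:
  assumes "g \<in> carrier G"
  shows "delta g \<in> l2 G" "l2norm G (delta g) \<le> 1"
proof -
  have *: "(\<Sum>x\<in>A. (cmod (delta g x))\<^sup>2) \<le> 1\<^sup>2" if "finite A" for A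
  proof -
    have "(\<Sum>x\<in>A. (cmod (delta g x))\<^sup>2) = (\<Sum>x\<in>A. if x = g then 1 else 0)"
      by (rule sum.cong) (auto simp: delta_def)
    then show ?thesis using that by simp
  qed
  have out: "delta g x = 0" if "x \<notin> carrier G" for x using that assms by (auto simp: delta_def)
  show "delta g \<in> l2 G" "l2norm G (delta g) \<le> 1"
    using l2_bound[of G "delta g" 1, OF out _ *] by auto
qed

text \<open>Finitely supported functions are combinations of point masses and are dense, so point
  masses determine a bounded operator.\<close>

lemma bop_eq_zero:
  assumes T: "T \<in> bop G" and z: "\<And>g. g \<in> carrier G \<Longrightarrow> T (delta g) = (\<lambda>_. 0)"
  shows "T = (\<lambda>f x. 0)"
proof
  fix f
  show "T f = (\<lambda>_. 0)"
  proof (cases "f \<in> l2 G")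
    case True
    obtain C where C: "0 \<le> C" "\<And>f. f \<in> l2 G \<Longrightarrow> l2norm G (T f) \<le> C * l2norm G f"
      using bop_bounded[OF T] by blast
    have fin: "T (restr A f) = (\<lambda>_. 0)" if "finite A" "A \<subseteq> carrier G" for A
      using that
    proof (induction A rule: finite_induct)
      case empty
      have "restr {} f = (\<lambda>_. 0)" by (auto simp: restr_def)
      then show ?case using bop_zero[OF T] by simp
    next
      case (insert a A)
      have "restr (insert a A) f = (\<lambda>x. f a * delta a x + restr A f x)"
        using insert.hyps by (auto simp: restr_def delta_def)
      then show ?case
        using insert z l2_delta(1)[of a G] l2_restr(1)[OF True]
        by (simp add: bop_add[OF T] l2_scale bop_scale[OF T])
    qed
    have small: "l2norm G (T f) \<le> e" if "e > 0" for e
    proof -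
      \<comment> \<open>\<open>C + 1\<close> keeps the divisor positive when \<open>C\<close> is
        0.\<close>
      have e': "e / (C + 1) > 0" using that C(1) by simp
      obtain A where A: "finite A" "A \<subseteq> carrier G" "l2norm G (\<lambda>x. f x - restr A f x) < e / (C + 1)"
        using l2_finite_approx[OF True e'] by blast
      have "T (\<lambda>x. f x - restr A f x) = T f"
        using bop_diff[OF T True l2_restr(1)[OF True]] fin[OF A(1,2)] by simp
      then have "l2norm G (T f) \<le> C * l2norm G (\<lambda>x. f x - restr A f x)"
        using C(2)[OF l2_diff(1)[OF True l2_restr(1)[OF True]]] by metis
      also have "\<dots> \<le> C * (e / (C + 1))" using A(3) C(1) by (intro mult_left_mono) auto
      also have "\<dots> \<le> e" using C(1) that by (simp add: field_simps)
      finally show ?thesis .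
    qed
    have "l2norm G (T f) \<le> 0" by (rule field_le_epsilon) (use small in simp)
    then have "cmod (T f x) \<le> 0" for x
      using cmod_le_l2norm[OF bop_closed[OF T True], of x] by linarith
    then show ?thesis by (auto simp: fun_eq_iff)
  qed (simp add: bop_outside[OF T])
qed

section \<open>The left regular representation, matrix entries and averaging\<close>

context group
begin

lemma lreg_apply:
  "\<lbrakk>f \<in> l2 G; x \<in> carrier G\<rbrakk> \<Longrightarrow> lreg G g f x = f (inv g \<otimes> x)"
  by (simp add: lreg_def)

lemma lreg_l2:
  assumes g: "g \<in> carrier G" and f: "f \<in> l2 G"
  shows "lreg G g f \<in> l2 G" "l2norm G (lreg G g f) = l2norm G f"
proof -
  have bij: "bij_betw (\<lambda>x. inv g \<otimes> x) (carrier G) (carrier G)"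
    by (rule bij_betw_byWitness[where f' = "\<lambda>x. g \<otimes> x"])
      (use g in \<open>auto simp: m_assoc[symmetric]\<close>)
  have cong: "(cmod (lreg G g f x))\<^sup>2 = (cmod (f (inv g \<otimes> x)))\<^sup>2" if "x \<in> carrier G" for x
    using that f by (simp add: lreg_apply)
  have "(\<lambda>x. (cmod (f (inv g \<otimes> x)))\<^sup>2) summable_on carrier G"
    using summable_on_reindex_bij_betw[OF bij, of "\<lambda>x. (cmod (f x))\<^sup>2"] f by (simp add: l2_def)
  then have "(\<lambda>x. (cmod (lreg G g f x))\<^sup>2) summable_on carrier G"
    using summable_on_cong[of "carrier G", OF cong] by simp
  then show "lreg G g f \<in> l2 G" using f by (simp add: l2_def lreg_def)
  show "l2norm G (lreg G g f) = l2norm G f"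
    unfolding l2norm_def
    using infsum_reindex_bij_betw[OF bij, of "\<lambda>x. (cmod (f x))\<^sup>2"] 
      infsum_cong[of "carrier G" "\<lambda>x. (cmod (lreg G g f x))\<^sup>2", OF cong] by simp
qed

lemma lreg_mult:
  assumes "g \<in> carrier G" "h \<in> carrier G" "f \<in> l2 G"
  shows "lreg G g (lreg G h f) = lreg G (g \<otimes> h) f"
proof
  fix x
  show "lreg G g (lreg G h f) x = lreg G (g \<otimes> h) f x"
    using assms lreg_l2(1)[of h f] by (cases "x \<in> carrier G")
      (auto simp: lreg_def inv_mult_group m_assoc)
qed

lemma lreg_one: "f \<in> l2 G \<Longrightarrow> lreg G \<one> f = f"
  by (auto simp: lreg_def l2_outside)

lemma lreg_bop:
  assumes "g \<in> carrier G"
  shows "lreg G g \<in> bop G"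
proof -
  have "\<exists>C. \<forall>f\<in>l2 G. l2norm G (lreg G g f) \<le> C * l2norm G f"
    using lreg_l2(2)[OF assms] by (intro exI[of _ 1]) simp
  then show ?thesis
    unfolding bop_def using lreg_l2(1)[OF assms] by (auto simp: lreg_def l2_add l2_scale)
qed

lemma group_alg_bop: "T \<in> group_alg G \<Longrightarrow> T \<in> bop G"
  unfolding group_alg_def by (auto intro!: bop_sum_op bop_scale_op lreg_bop)

lemma lreg_Cred:
  assumes "g \<in> carrier G"
  shows "lreg G g \<in> Cred G"
proof -
  have "lreg G g \<in> group_alg G"
    unfolding group_alg_def using assms
    by (auto intro!: exI[of _ "{g}"] exI[of _ "\<lambda>_. 1"])
  moreover have "opnorm G (op_diff (lreg G g) (lreg G g)) \<le> 0"
    by (rule opnorm_le) (auto simp: op_diff_def l2_zero(2))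
  ultimately show ?thesis unfolding Cred_def using lreg_bop[OF assms]
    by (auto intro!: bexI[of _ "lreg G g"])
qed

text \<open>Left translations commute with right translations, so the matrix entry at
  \<open>h\<close>, \<open>g\<close> depends only on \<open>h \<otimes> inv g\<close>.\<close>

lemma group_alg_delta:
  assumes "S \<in> group_alg G" "g \<in> carrier G" "h \<in> carrier G"
  shows "S (delta g) h = S (delta \<one>) (h \<otimes> inv g)"
proof -
  have "lreg G s (delta g) h = lreg G s (delta \<one>) (h \<otimes> inv g)" if s: "s \<in> carrier G" for s
  proof -
    have "inv s \<otimes> h = g \<longleftrightarrow> inv s \<otimes> (h \<otimes> inv g) = \<one>"
      using assms(2,3) s by (metis inv_closed inv_solve_right m_assoc m_closed l_one one_closed)
    then show ?thesis using assms(2,3) s by (simp add: lreg_apply l2_delta(1) delta_def)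
  qed
  then show ?thesis using assms(1) unfolding group_alg_def
    by (auto intro!: sum.cong)
qed

text \<open>Matrix entries are continuous in the operator norm, so the symmetry of the group algebra
  passes to its closure. It moves a nonzero entry into the column of the identity.\<close>

lemma Cred_delta:
  assumes T: "T \<in> Cred G" and g: "g \<in> carrier G" and h: "h \<in> carrier G"
  shows "T (delta g) h = T (delta \<one>) (h \<otimes> inv g)"
proof -
  have "cmod (T (delta g) h - T (delta \<one>) (h \<otimes> inv g)) \<le> 0 + e" if e: "e > 0" for e
  proof -
    obtain S where S: "S \<in> group_alg G" "opnorm G (op_diff T S) < e / 2"
      using T half_gt_zero[OF e] unfolding Cred_def by blast
    have D: "op_diff T S \<in> bop G"
      using bop_op_diff[OF _ group_alg_bop[OF S(1)]] T by (simp add: Cred_def)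
    have *: "cmod (T (delta k) x - S (delta k) x) \<le> e / 2" if k: "k \<in> carrier G" for k x
    proof -
      have "cmod (op_diff T S (delta k) x) \<le> l2norm G (op_diff T S (delta k))"
        by (rule cmod_le_l2norm) (rule bop_closed[OF D l2_delta(1)[OF k]])
      also have "\<dots> \<le> opnorm G (op_diff T S) * l2norm G (delta k)"
        by (rule l2norm_le_opnorm[OF D l2_delta(1)[OF k]])
      also have "\<dots> \<le> e / 2 * 1"
        using S(2) l2_delta(2)[OF k] l2norm_nonneg[of G "delta k"] e
        by (intro mult_mono) auto
      finally show ?thesis by (simp add: op_diff_def)
    qed
    have "cmod (T (delta g) h - T (delta \<one>) (h \<otimes> inv g))
        = cmod ((T (delta g) h - S (delta g) h) - (T (delta \<one>) (h \<otimes> inv g) - S (delta \<one>) (h \<otimes> inv g)))"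
      using group_alg_delta[OF S(1) g h] by simp
    also have "\<dots> \<le> e / 2 + e / 2"
      using norm_triangle_le_diff[OF add_mono[OF *[OF g, of h] *[OF one_closed, of "h \<otimes> inv g"]]] .
    finally show ?thesis by simp
  qed
  then have "cmod (T (delta g) h - T (delta \<one>) (h \<otimes> inv g)) \<le> 0" by (rule field_le_epsilon)
  then show ?thesis by simp
qed

text \<open>The summand \<open>K j h\<close> is the restriction of \<open>K j h\<close> to \<open>g j E\<close> plus a part which only depends
  on the restriction of \<open>h\<close> to \<open>g j E\<close>; orthogonality of the sets \<open>g j E\<close> then gains a factor
  \<open>sqrt (card J)\<close> in both parts.\<close>
lemma powers_average_estimate:
  fixes c :: "'a \<Rightarrow> complex" and g :: "nat \<Rightarrow> 'a"
  assumes F: "finite F" "F \<subseteq> carrier G"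
    and DE: "D \<union> E = carrier G"
    and FD: "\<And>s. s \<in> F \<Longrightarrow> (s <# D) \<inter> D = {}"
    and J: "finite J" and g: "\<And>j. j \<in> J \<Longrightarrow> g j \<in> carrier G"
    and gE: "disjoint_family_on (\<lambda>j. g j <# E) J"
    and f: "f \<in> l2 G"
    and X: "X = (\<lambda>h x. \<Sum>s\<in>F. c s * lreg G s h x)"
    and C: "C = (\<Sum>s\<in>F. cmod (c s))"
  shows "l2norm G (\<lambda>x. \<Sum>j\<in>J. lreg G (g j) (X (lreg G (inv (g j)) f)) x)
    \<le> 2 * C * sqrt (card J) * l2norm G f"
proof -
  define A where "A j = g j <# E" for j
  define K where "K j = lreg G (g j) \<circ> (X \<circ> lreg G (inv (g j)))" for j
  have Xb: "X \<in> bop G" unfolding X using F by (auto intro!: bop_sum_op bop_scale_op lreg_bop)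
  have C0: "0 \<le> C" unfolding C by (simp add: sum_nonneg)
  have Xn: "l2norm G (X h) \<le> C * l2norm G h" if h: "h \<in> l2 G" for h
  proof -
    have l2: "(\<lambda>x. c s * lreg G s h x) \<in> l2 G" if "s \<in> F" for s
      using that F h by (auto intro!: l2_scale lreg_l2)
    have "l2norm G (X h) \<le> (\<Sum>s\<in>F. l2norm G (\<lambda>x. c s * lreg G s h x))"
      unfolding X using l2_sum[of F "\<lambda>s x. c s * lreg G s h x" G] F(1) l2 by blast
    also have "\<dots> = (\<Sum>s\<in>F. cmod (c s) * l2norm G h)"
      using F h by (intro sum.cong refl) (auto simp: l2_scale(2) lreg_l2 subset_iff)
    finally show ?thesis by (simp add: C sum_distrib_right)
  qed
  have Kb: "K j \<in> bop G" if "j \<in> J" for j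
    unfolding K_def using g[OF that] by (intro bop_comp lreg_bop Xb) auto
  have Kn: "l2norm G (K j h) \<le> C * l2norm G h" if "j \<in> J" "h \<in> l2 G" for j h
  proof -
    have i: "lreg G (inv (g j)) h \<in> l2 G" "l2norm G (lreg G (inv (g j)) h) = l2norm G h"
      using lreg_l2[of "inv (g j)" h] g that by auto
    show ?thesis
      using Xn[OF i(1)] lreg_l2(2)[OF g[OF that(1)] bop_closed[OF Xb i(1)]] i(2) by (simp add: K_def)
  qed
  \<comment> \<open>Write \<open>x = g j \<otimes> y\<close> with \<open>y\<close> in
    \<open>D\<close>. No \<open>s\<close> in \<open>F\<close> maps a point of \<open>D\<close> into
    \<open>D\<close>, so every \<open>inv s \<otimes> y\<close> lies in \<open>E\<close>, and
    \<open>K j f x\<close> reads \<open>f\<close> on \<open>A j\<close> only.\<close>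
  have loc: "K j f x = K j (restr (A j) f) x" if j: "j \<in> J" and x: "x \<in> carrier G" "x \<notin> A j" for j x
  proof -
    define y where "y = inv (g j) \<otimes> x"
    have y: "y \<in> carrier G" "g j \<otimes> y = x" using g[OF j] x by (auto simp: y_def m_assoc[symmetric])
    have "y \<notin> E" using x(2) y unfolding A_def l_coset_def by blast
    then have yD: "y \<in> D" using y DE by blast
    have ev: "K j h x = (\<Sum>s\<in>F. c s * h (g j \<otimes> (inv s \<otimes> y)))" if h: "h \<in> l2 G" for h
    proof -
      have i: "lreg G (inv (g j)) h \<in> l2 G" using lreg_l2(1)[of "inv (g j)" h] g[OF j] h by simp
      have "K j h x = X (lreg G (inv (g j)) h) y"
        using bop_closed[OF Xb i] x by (simp add: K_def lreg_apply y_def)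
      also have "\<dots> = (\<Sum>s\<in>F. c s * h (g j \<otimes> (inv s \<otimes> y)))"
        unfolding X using F i h y g[OF j] by (intro sum.cong refl) (auto simp: lreg_apply subset_iff)
      finally show ?thesis .
    qed
    have "g j \<otimes> (inv s \<otimes> y) \<in> A j" if s: "s \<in> F" for s
    proof -
      have sG: "s \<in> carrier G" using s F by blast
      have "inv s \<otimes> y \<notin> D"
      proof
        assume "inv s \<otimes> y \<in> D"
        then have "s \<otimes> (inv s \<otimes> y) \<in> s <# D" unfolding l_coset_def by blast
        then show False using FD[OF s] yD sG y(1) by (auto simp: m_assoc[symmetric])
      qed
      then have "inv s \<otimes> y \<in> E" using DE sG y(1) by (metis UnE inv_closed m_closed)
      then show ?thesis unfolding A_def l_coset_def by blast
    qed
    then show ?thesis unfolding ev[OF f] ev[OF l2_restr(1)[OF f]] by (simp add: restr_def)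
  qed
  have split: "(\<Sum>j\<in>J. K j f x)
      = (\<Sum>j\<in>J. restr (A j) (K j f) x) + (\<Sum>j\<in>J. restr (- A j) (K j (restr (A j) f)) x)" for x
  proof -
    have "K j f x = restr (A j) (K j f) x + restr (- A j) (K j (restr (A j) f)) x" if j: "j \<in> J" for j
      using loc[OF j, of x] l2_outside[OF bop_closed[OF Kb[OF j] f], of x]
        l2_outside[OF bop_closed[OF Kb[OF j] l2_restr(1)[OF f]], of x]
      by (cases "x \<in> carrier G") (auto simp: restr_def)
    then show ?thesis by (simp add: sum.distrib[symmetric])
  qed
  have m1: "(\<lambda>x. \<Sum>j\<in>J. restr (A j) (K j f) x) \<in> l2 G"
    using l2_sum[OF J, of "\<lambda>j. restr (A j) (K j f)" G] Kb f by (simp add: l2_restr bop_closed)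
  have m2: "(\<lambda>x. \<Sum>j\<in>J. restr (- A j) (K j (restr (A j) f)) x) \<in> l2 G"
    "l2norm G (\<lambda>x. \<Sum>j\<in>J. restr (- A j) (K j (restr (A j) f)) x)
      \<le> (\<Sum>j\<in>J. l2norm G (restr (- A j) (K j (restr (A j) f))))"
    using l2_sum[OF J, of "\<lambda>j. restr (- A j) (K j (restr (A j) f))" G] Kb f
    by (simp_all add: l2_restr bop_closed)
  have disj: "disjoint_family_on A J" using gE by (simp add: A_def[abs_def])
  have "(l2norm G (\<lambda>x. \<Sum>j\<in>J. restr (A j) (K j f) x))\<^sup>2 \<le> (\<Sum>j\<in>J. (l2norm G (K j f))\<^sup>2)"
    by (rule sum_disjoint_restr_norm_le[OF _ J disj]) (use Kb f bop_closed in blast)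
  also have "\<dots> \<le> (\<Sum>j\<in>J. (C * l2norm G f)\<^sup>2)"
    by (rule sum_mono) (use Kn[OF _ f] l2norm_nonneg in \<open>auto intro: power_mono\<close>)
  also have "\<dots> = (C * sqrt (card J) * l2norm G f)\<^sup>2" by (simp add: power_mult_distrib)
  finally have n1: "l2norm G (\<lambda>x. \<Sum>j\<in>J. restr (A j) (K j f) x) \<le> C * sqrt (card J) * l2norm G f"
    by (rule power2_le_imp_le) (simp add: C0 l2norm_nonneg)
  have "(\<Sum>j\<in>J. l2norm G (restr (- A j) (K j (restr (A j) f)))) \<le> (\<Sum>j\<in>J. C * l2norm G (restr (A j) f))"
  proof (rule sum_mono)
    fix j assume j: "j \<in> J"
    have r: "restr (A j) f \<in> l2 G" by (rule l2_restr(1)[OF f])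
    show "l2norm G (restr (- A j) (K j (restr (A j) f))) \<le> C * l2norm G (restr (A j) f)"
      using l2_restr(2)[OF bop_closed[OF Kb[OF j] r]] Kn[OF j r] by (rule order_trans)
  qed
  \<comment> \<open>The factors 1 give the sum the shape of the Cauchy-Schwarz inequality
    \<open>L2_set_mult_ineq\<close>, whence the factor \<open>sqrt (card J)\<close>.\<close>
  also have "\<dots> = C * (\<Sum>j\<in>J. \<bar>1\<bar> * \<bar>l2norm G (restr (A j) f)\<bar>)"
    by (simp add: sum_distrib_left l2norm_nonneg)
  also have "\<dots> \<le> C * (sqrt (card J) * l2norm G f)"
  proof (rule mult_left_mono[OF _ C0])
    have "L2_set (\<lambda>j. l2norm G (restr (A j) f)) J \<le> l2norm G f"
      unfolding L2_set_def using disjoint_restr_norm_le[OF f J disj] l2norm_nonneg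
      by (meson real_le_lsqrt)
    moreover have "(\<Sum>j\<in>J. \<bar>1\<bar> * \<bar>l2norm G (restr (A j) f)\<bar>)
        \<le> L2_set (\<lambda>_. 1) J * L2_set (\<lambda>j. l2norm G (restr (A j) f)) J"
      by (rule L2_set_mult_ineq)
    moreover have "L2_set (\<lambda>_. 1) J = sqrt (card J)" by (simp add: L2_set_constant)
    ultimately show "(\<Sum>j\<in>J. \<bar>1\<bar> * \<bar>l2norm G (restr (A j) f)\<bar>) \<le> sqrt (card J) * l2norm G f"
      by (metis (no_types, lifting) L2_set_nonneg mult_left_mono order_trans)
  qed
  finally have n2: "(\<Sum>j\<in>J. l2norm G (restr (- A j) (K j (restr (A j) f)))) \<le> C * sqrt (card J) * l2norm G f"
    by (simp add: mult.assoc)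
  have "l2norm G (\<lambda>x. \<Sum>j\<in>J. K j f x) \<le> 2 * C * sqrt (card J) * l2norm G f"
    unfolding split using l2_add(2)[OF m1 m2(1)] m2(2) n1 n2 by linarith
  then show ?thesis by (simp add: K_def)
qed

end

section \<open>Closed ideals and simplicity\<close>

context group
begin

lemma Cred_bop: "T \<in> Cred G \<Longrightarrow> T \<in> bop G"
  by (simp add: Cred_def)

lemma closed_ideal_sum:
  assumes I: "closed_ideal G (Cred G) I" and J: "finite J" "\<And>j. j \<in> J \<Longrightarrow> T j \<in> I"
  shows "(\<lambda>f x. \<Sum>j\<in>J. T j f x) \<in> I"
  using J I by (induction J rule: finite_induct) (simp_all add: closed_ideal_def)

text \<open>With \<open>S = 1 - Z\<close>, the operators \<open>P n = 1 - S ^ n\<close> lie in the ideal and converge to \<open>1\<close>.\<close>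
lemma closed_ideal_near_one:
  assumes I: "closed_ideal G (Cred G) I" and Z: "Z \<in> I"
    and r: "0 \<le> r" "r < 1" "\<And>f. f \<in> l2 G \<Longrightarrow> l2norm G (\<lambda>x. f x - Z f x) \<le> r * l2norm G f"
  shows "I = Cred G"
proof -
  have IC: "I \<subseteq> Cred G" and I0: "(\<lambda>f x. 0) \<in> I"
    and Iadd: "\<And>T S. \<lbrakk>T \<in> I; S \<in> I\<rbrakk> \<Longrightarrow> (\<lambda>f x. T f x + S f x) \<in> I"
    and Iscale: "\<And>T c. T \<in> I \<Longrightarrow> (\<lambda>f x. c * T f x) \<in> I"
    and Imult: "\<And>T S. \<lbrakk>T \<in> I; S \<in> Cred G\<rbrakk> \<Longrightarrow> T \<circ> S \<in> I \<and> S \<circ> T \<in> I"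
    and Icl: "\<And>T. \<lbrakk>T \<in> Cred G; \<forall>\<epsilon>>0. \<exists>S\<in>I. opnorm G (op_diff T S) < \<epsilon>\<rbrakk> \<Longrightarrow> T \<in> I"
    using I unfolding closed_ideal_def by blast+
  \<comment> \<open>This encodes 1 - P (n + 1) = (1 - P n)(1 - Z) without mentioning the identity,
    so that each \<open>P n\<close> visibly stays in the ideal.\<close>
  define P where "P n = rec_nat (\<lambda>f x. 0) (\<lambda>_ Q f x. Q f x + (Z f x + (- 1) * (Q \<circ> Z) f x)) n" for n :: nat
  have P0: "P 0 = (\<lambda>f x. 0)"
    and PS: "P (Suc n) = (\<lambda>f x. P n f x + (Z f x + (- 1) * (P n \<circ> Z) f x))" for n
    by (simp_all add: P_def)
  have PI: "P n \<in> I" for n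
  proof (induction n)
    case 0
    then show ?case using I0 by (simp add: P0)
  next
    case (Suc n)
    then have "P n \<circ> Z \<in> I" using Imult Z IC by blast
    then show ?case unfolding PS by (intro Iadd Suc Z Iscale)
  qed
  have Pn: "l2norm G (\<lambda>x. f x - P n f x) \<le> r ^ n * l2norm G f" if "f \<in> l2 G" for n f
    using that
  proof (induction n arbitrary: f)
    case 0
    then show ?case by (simp add: P0)
  next
    case (Suc n)
    have Zf: "Z f \<in> l2 G" using bop_closed[OF Cred_bop Suc.prems] Z IC by blast
    have Pb: "P n \<in> bop G" using PI IC Cred_bop by blast
    let ?h = "\<lambda>x. f x - Z f x"
    have "(\<lambda>x. f x - P (Suc n) f x) = (\<lambda>x. ?h x - P n ?h x)"
      unfolding PS bop_diff[OF Pb Suc.prems Zf] by (simp add: fun_eq_iff)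
    then have "l2norm G (\<lambda>x. f x - P (Suc n) f x) \<le> r ^ n * l2norm G ?h"
      using Suc.IH[OF l2_diff(1)[OF Suc.prems Zf]] by simp
    also have "\<dots> \<le> r ^ n * (r * l2norm G f)" using r Suc.prems by (intro mult_left_mono) auto
    finally show ?case by (simp add: mult_ac)
  qed
  have "lreg G \<one> \<in> I"
  proof (rule Icl[OF lreg_Cred[OF one_closed]], intro allI impI)
    fix \<epsilon> :: real assume "\<epsilon> > 0"
    then obtain n where n: "r ^ n < \<epsilon>" using r(2) real_arch_pow_inv by blast
    have "opnorm G (op_diff (lreg G \<one>) (P n)) \<le> r ^ n"
      by (rule opnorm_le) (use Pn r in \<open>simp_all add: op_diff_def lreg_one\<close>)
    then show "\<exists>S\<in>I. opnorm G (op_diff (lreg G \<one>) S) < \<epsilon>" 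
      using PI[of n] n by (intro bexI[of _ "P n"]) linarith+
  qed
  \<comment> \<open>On arguments outside \<open>l2 G\<close> both sides are zero, since
    \<open>lreg\<close> and all operators in \<open>bop\<close> return the zero function
    there.\<close>
  moreover have "T \<circ> lreg G \<one> = T" if "T \<in> Cred G" for T
  proof
    fix f
    show "(T \<circ> lreg G \<one>) f = T f"
      using bop_zero[OF Cred_bop[OF that]] bop_outside[OF Cred_bop[OF that]]
      by (cases "f \<in> l2 G") (simp_all add: lreg_one, simp add: lreg_def)
  qed
  ultimately have "T \<in> I" if "T \<in> Cred G" for T using Imult[of "lreg G \<one>" T] that by simp
  then show ?thesis using IC by blast
qed

text \<open>After multiplying a nonzero element of the ideal by a group element, its coefficient at \<open>\<one>\<close>
  is nonzero; averaging over the elements given by the Powers property then makes the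
  remaining coefficients negligible.\<close>
theorem powers_imp_cstar_simple:
  assumes pow: "powers_group G" and inf: "infinite (carrier G)"
  shows "cstar_simple G"
  unfolding cstar_simple_def
proof (intro conjI allI impI inf)
  fix I assume I: "closed_ideal G (Cred G) I"
  have IC: "I \<subseteq> Cred G" and I0: "(\<lambda>f x. 0) \<in> I"
    and Iscale: "\<And>T c. T \<in> I \<Longrightarrow> (\<lambda>f x. c * T f x) \<in> I"
    and Imult: "\<And>T S. \<lbrakk>T \<in> I; S \<in> Cred G\<rbrakk> \<Longrightarrow> T \<circ> S \<in> I \<and> S \<circ> T \<in> I"
    using I unfolding closed_ideal_def by blast+
  show "I = {\<lambda>f x. 0} \<or> I = Cred G"
  proof (cases "I = {\<lambda>f x. 0}")
    case False
    then obtain T where T: "T \<in> I" "T \<noteq> (\<lambda>f x. 0)" using I0 by blast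
    have TC: "T \<in> Cred G" using T IC by blast
    then obtain g where g: "g \<in> carrier G" "T (delta g) \<noteq> (\<lambda>_. 0)"
      using bop_eq_zero[OF Cred_bop] T by blast
    then obtain h where h: "T (delta g) h \<noteq> 0" by auto
    have hG: "h \<in> carrier G"
      using h l2_outside[OF bop_closed[OF Cred_bop[OF TC] l2_delta(1)[OF g(1)]]] by blast
    define k where "k = h \<otimes> inv g"
    have kG: "k \<in> carrier G" using hG g by (simp add: k_def)
    have k: "T (delta \<one>) k \<noteq> 0" using Cred_delta[OF TC g(1) hG] h by (simp add: k_def)
    define Y where "Y = (\<lambda>f x. (1 / T (delta \<one>) k) * (lreg G (inv k) \<circ> T) f x)"
    have YI: "Y \<in> I" unfolding Y_def using Iscale Imult[OF T(1) lreg_Cred[of "inv k"]] kG by blast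
    have Yb: "Y \<in> bop G" using YI IC Cred_bop by blast
    have Y1: "Y (delta \<one>) \<one> = 1"
      using k kG bop_closed[OF Cred_bop[OF TC] l2_delta(1)[OF one_closed]]
      by (simp add: Y_def lreg_apply)
    \<comment> \<open>The budget is three errors of 1/4: the distance of \<open>Y\<close> from
      \<open>S\<close>, the deviation of the identity coefficient \<open>c1\<close> from 1, and the
      average of the remaining part \<open>X\<close>. Their sum 3/4 is below 1.\<close>
    have "\<forall>\<epsilon>>0. \<exists>S\<in>group_alg G. opnorm G (op_diff Y S) < \<epsilon>" using YI IC by (auto simp: Cred_def)
    then obtain S where S: "S \<in> group_alg G" "opnorm G (op_diff Y S) < 1 / 4"
      by (metis zero_less_divide_1_iff zero_less_numeral)
    then obtain A c where A: "finite A" "A \<subseteq> carrier G" and SA: "S = (\<lambda>f x. \<Sum>s\<in>A. c s * lreg G s f x)"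
      unfolding group_alg_def by blast
    define F where "F = A - {\<one>}"
    define c1 where "c1 = (if \<one> \<in> A then c \<one> else 0)"
    define X where "X = (\<lambda>f x. \<Sum>s\<in>F. c s * lreg G s f x)"
    define C where "C = (\<Sum>s\<in>F. cmod (c s))"
    have F: "finite F" "F \<subseteq> carrier G - {\<one>}" using A by (auto simp: F_def)
    have SX: "S f x = c1 * f x + X f x" if "f \<in> l2 G" for f x
      using A(1) lreg_one[OF that] sum.remove[of A \<one> "\<lambda>s. c s * lreg G s f x"]
      by (cases "\<one> \<in> A") (auto simp: SA X_def c1_def F_def)
    have Sb: "S \<in> bop G" by (rule group_alg_bop[OF S(1)])
    have Xb: "X \<in> bop G" unfolding X_def using F by (auto intro!: bop_sum_op bop_scale_op lreg_bop)
    have Db: "op_diff Y S \<in> bop G" by (rule bop_op_diff[OF Yb Sb])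
    have Dn: "l2norm G (op_diff Y S f) \<le> 1 / 4 * l2norm G f" if "f \<in> l2 G" for f
      using l2norm_le_opnorm[OF Db that] mult_right_mono[OF less_imp_le[OF S(2)] l2norm_nonneg[of G f]]
      by linarith
    have X1: "X (delta \<one>) \<one> = 0"
      unfolding X_def
    proof (rule sum.neutral, rule ballI)
      fix s assume "s \<in> F"
      then have "s \<in> carrier G" "s \<noteq> \<one>" using F by auto
      then show "c s * lreg G s (delta \<one>) \<one> = 0"
        by (simp add: lreg_apply l2_delta(1) delta_def inv_eq_1_iff)
    qed
    have c1: "cmod (1 - c1) \<le> 1 / 4"
    proof -
      have d: "delta \<one> \<in> l2 G" by (rule l2_delta(1)[OF one_closed])
      have "op_diff Y S (delta \<one>) \<one> = 1 - c1"
        by (simp add: op_diff_def Y1 SX[OF d] X1) (simp add: delta_def)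
      then have "cmod (1 - c1) \<le> l2norm G (op_diff Y S (delta \<one>))"
        using cmod_le_l2norm[OF bop_closed[OF Db d], of \<one>] by simp
      also have "\<dots> \<le> 1 / 4 * l2norm G (delta \<one>)" by (rule Dn[OF d])
      finally show ?thesis using l2_delta(2)[OF one_closed] by linarith
    qed
    \<comment> \<open>A square \<open>N\<close> of side \<open>n\<close> turns the bound into
      \<open>2 * C / n\<close>, so \<open>n \<ge> 8 * C\<close> is enough.\<close>
    obtain N :: nat where N: "N \<ge> 1" "2 * C * sqrt N / N \<le> 1 / 4"
    proof -
      obtain n :: nat where n: "real n \<ge> max 1 (8 * C)" using real_arch_simple by blast
      have n1: "n \<ge> 1" "8 * C \<le> real n" using n by auto
      have s: "sqrt (real (n\<^sup>2)) = real n" by simp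
      have "2 * C * sqrt (real (n\<^sup>2)) / real (n\<^sup>2) = 2 * C / n"
        unfolding s using n1 by (simp add: power2_eq_square)
      also have "\<dots> \<le> 1 / 4" using n1 by (simp add: field_simps)
      finally show thesis using n1 by (intro that[of "n\<^sup>2"]) auto
    qed
    have "finite F \<and> F \<subseteq> carrier G - {\<one>} \<and> 1 \<le> N" using F N(1) by simp
    from pow[unfolded powers_group_def, THEN spec[of _ F], THEN spec[of _ N], THEN mp, OF this]
    obtain D E and g :: "nat \<Rightarrow> 'a" where "D \<union> E = carrier G \<and> D \<inter> E = {} \<and>
      (\<forall>f\<in>F. (f <# D) \<inter> D = {}) \<and> (\<forall>j\<in>{1..N}. g j \<in> carrier G) \<and>
      (\<forall>j\<in>{1..N}. \<forall>k\<in>{1..N}. j \<noteq> k \<longrightarrow> (g j <# E) \<inter> (g k <# E) = {})"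
      by (elim exE)
    then have DE: "D \<union> E = carrier G" "\<forall>f\<in>F. (f <# D) \<inter> D = {}"
      and gG: "\<forall>j\<in>{1..N}. g j \<in> carrier G"
      and gE: "\<forall>j\<in>{1..N}. \<forall>k\<in>{1..N}. j \<noteq> k \<longrightarrow> (g j <# E) \<inter> (g k <# E) = {}"
      by simp_all
    define J where "J = {1..N}"
    have J: "finite J" "card J = N" by (auto simp: J_def)
    have gJ: "g j \<in> carrier G" if "j \<in> J" for j using gG that by (simp add: J_def)
    have dis: "disjoint_family_on (\<lambda>j. g j <# E) J" using gE by (simp add: J_def disjoint_family_on_def)
    have avg: "l2norm G (\<lambda>x. \<Sum>j\<in>J. lreg G (g j) (X (lreg G (inv (g j)) f)) x)
        \<le> 2 * C * sqrt N * l2norm G f" if "f \<in> l2 G" for f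
      using powers_average_estimate[OF F(1) _ DE(1) _ J(1) gJ dis that X_def C_def] DE(2) F(2) J(2)
      by (auto simp: subset_iff)
    define Z where "Z = (\<lambda>f x. (1 / of_nat N) * (\<Sum>j\<in>J. (lreg G (g j) \<circ> (Y \<circ> lreg G (inv (g j)))) f x))"
    have ZI: "Z \<in> I"
      unfolding Z_def
    proof (intro Iscale closed_ideal_sum[OF I J(1)])
      fix j assume "j \<in> J"
      then have "lreg G (g j) \<in> Cred G" "lreg G (inv (g j)) \<in> Cred G" using gJ lreg_Cred by auto
      then show "lreg G (g j) \<circ> (Y \<circ> lreg G (inv (g j))) \<in> I" using Imult YI by blast
    qed
    have Zn: "l2norm G (\<lambda>x. f x - Z f x) \<le> 3 / 4 * l2norm G f" if f: "f \<in> l2 G" for f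
    proof -
      define u where "u j = lreg G (inv (g j)) f" for j
      have u: "u j \<in> l2 G" "l2norm G (u j) = l2norm G f" if "j \<in> J" for j
        using lreg_l2[of "inv (g j)" f] gJ that f by (auto simp: u_def)
      have lu: "lreg G (g j) (u j) = f" if "j \<in> J" for j
        using lreg_mult[of "g j" "inv (g j)" f] gJ[OF that] f by (simp add: u_def lreg_one)
      define d where "d j = lreg G (g j) (op_diff Y S (u j))" for j
      define e where "e j = lreg G (g j) (X (u j))" for j
      \<comment> \<open>Conjugation leaves the scalar part alone, so \<open>c1 * f x\<close> is
        common to all summands; only \<open>d j\<close> and \<open>e j\<close> vary with
        \<open>j\<close>.\<close>
      have decomp: "lreg G (g j) (Y (u j)) x = d j x + (c1 * f x + e j x)" if j: "j \<in> J" for j x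
      proof -
        have l: "op_diff Y S (u j) \<in> l2 G" "X (u j) \<in> l2 G" "(\<lambda>x. c1 * u j x) \<in> l2 G"
          using u[OF j] by (auto intro: bop_closed[OF Db] bop_closed[OF Xb] l2_scale)
        have b: "lreg G (g j) \<in> bop G" by (rule lreg_bop[OF gJ[OF j]])
        have "Y (u j) = (\<lambda>x. op_diff Y S (u j) x + (c1 * u j x + X (u j) x))"
          using SX[OF u(1)[OF j]] by (simp add: op_diff_def)
        then have "lreg G (g j) (Y (u j)) = (\<lambda>x. d j x + (c1 * lreg G (g j) (u j) x + e j x))"
          using bop_add[OF b l(1) l2_add(1)[OF l(3,2)]] bop_add[OF b l(3,2)] bop_scale[OF b u(1)[OF j]]
          by (simp add: d_def e_def)
        then show ?thesis using lu[OF j] by simp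
      qed
      have Npos: "(of_nat N :: complex) \<noteq> 0" using N(1) by simp
      have "Z f x = (1 / of_nat N) * (\<Sum>j\<in>J. d j x) + c1 * f x + (1 / of_nat N) * (\<Sum>j\<in>J. e j x)" for x
      proof -
        have "(\<Sum>j\<in>J. (lreg G (g j) \<circ> (Y \<circ> lreg G (inv (g j)))) f x)
            = (\<Sum>j\<in>J. d j x + (c1 * f x + e j x))"
          by (rule sum.cong) (use decomp in \<open>auto simp: u_def\<close>)
        also have "\<dots> = (\<Sum>j\<in>J. d j x) + of_nat N * (c1 * f x) + (\<Sum>j\<in>J. e j x)"
          using J(2) by (simp add: sum.distrib)
        finally show ?thesis unfolding Z_def using Npos by (simp add: field_simps)
      qed
      then have eq: "(\<lambda>x. f x - Z f x) = (\<lambda>x. ((1 - c1) * f x - (1 / of_nat N) * (\<Sum>j\<in>J. d j x))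
          - (1 / of_nat N) * (\<Sum>j\<in>J. e j x))"
        by (auto simp: algebra_simps)
      have dj: "d j \<in> l2 G" "l2norm G (d j) \<le> 1 / 4 * l2norm G f" if j: "j \<in> J" for j
        using lreg_l2[OF gJ[OF j] bop_closed[OF Db u(1)[OF j]]] Dn[OF u(1)[OF j]] u(2)[OF j]
        by (auto simp: d_def)
      have ej: "e j \<in> l2 G" if j: "j \<in> J" for j
        using lreg_l2(1)[OF gJ[OF j] bop_closed[OF Xb u(1)[OF j]]] by (simp add: e_def)
      have sd: "(\<lambda>x. \<Sum>j\<in>J. d j x) \<in> l2 G" "l2norm G (\<lambda>x. \<Sum>j\<in>J. d j x) \<le> N * (1 / 4 * l2norm G f)"
        using l2_sum[of J d G, OF J(1) dj(1)]
          sum_mono[of J "\<lambda>j. l2norm G (d j)" "\<lambda>_. 1 / 4 * l2norm G f", OF dj(2)] J(2)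
        by auto
      have se: "(\<lambda>x. \<Sum>j\<in>J. e j x) \<in> l2 G" using l2_sum[of J e G, OF J(1) ej] by blast
      have "l2norm G (\<lambda>x. \<Sum>j\<in>J. e j x) \<le> 2 * C * sqrt N * l2norm G f"
        using avg[OF f] by (simp add: e_def u_def)
      then have "l2norm G (\<lambda>x. (1 / of_nat N) * (\<Sum>j\<in>J. e j x)) \<le> 1 / N * (2 * C * sqrt N * l2norm G f)"
        unfolding l2_scale(2)[OF se] by (simp add: norm_divide divide_right_mono)
      also have "\<dots> = 2 * C * sqrt N / N * l2norm G f" by simp
      also have "\<dots> \<le> 1 / 4 * l2norm G f" by (rule mult_right_mono[OF N(2) l2norm_nonneg])
      finally have n3: "l2norm G (\<lambda>x. (1 / of_nat N) * (\<Sum>j\<in>J. e j x)) \<le> 1 / 4 * l2norm G f" .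
      have n2: "l2norm G (\<lambda>x. (1 / of_nat N) * (\<Sum>j\<in>J. d j x)) \<le> 1 / 4 * l2norm G f"
        unfolding l2_scale(2)[OF sd(1)] using sd(2) N(1) by (simp add: norm_divide field_simps)
      have n1: "l2norm G (\<lambda>x. (1 - c1) * f x) \<le> 1 / 4 * l2norm G f"
        unfolding l2_scale(2)[OF f] using c1 l2norm_nonneg by (rule mult_right_mono)
      have m: "(\<lambda>x. (1 - c1) * f x) \<in> l2 G" "(\<lambda>x. (1 / of_nat N) * (\<Sum>j\<in>J. d j x)) \<in> l2 G"
        "(\<lambda>x. (1 / of_nat N) * (\<Sum>j\<in>J. e j x)) \<in> l2 G"
        by (rule l2_scale(1), fact)+
      show ?thesis
        unfolding eq using l2_diff[OF m(1,2)] l2_diff(2)[OF l2_diff(1)[OF m(1,2)] m(3)] n1 n2 n3 by linarith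
    qed
    have "I = Cred G" by (rule closed_ideal_near_one[OF I ZI _ _ Zn]) auto
    then show ?thesis by blast
  qed simp
qed

end

section \<open>The free group of rank two\<close>

lemma inv_letter_inv_letter [simp]: "inv_letter (inv_letter x) = x"
  by (simp add: inv_letter_def)

lemma reduced_Nil [simp]: "reduced []"
  by (simp add: reduced_def)

lemma reduced_singleton [simp]: "reduced [x]"
  by (simp add: reduced_def)

lemma reduced_Cons_Cons [simp]: "reduced (x # y # w) \<longleftrightarrow> y \<noteq> inv_letter x \<and> reduced (y # w)"
  unfolding reduced_def by (auto simp: nth_Cons split: nat.splits)

lemma reduced_tl: "reduced (x # w) \<Longrightarrow> reduced w"
  by (cases w) auto

lemma reduced_red_cons: "reduced w \<Longrightarrow> reduced (red_cons x w)"
  by (cases w) (auto dest: reduced_tl)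

lemma reduced_foldr: "reduced v \<Longrightarrow> reduced (foldr red_cons u v)"
  by (induction u) (auto simp: reduced_red_cons)

lemma reduced_reduce [simp]: "reduced (reduce w)"
  by (simp add: reduce_def reduced_foldr)

lemma reduce_reduced: "reduced w \<Longrightarrow> reduce w = w"
proof (induction w)
  case (Cons x w)
  then have "foldr red_cons w [] = w" using reduced_tl by (auto simp: reduce_def)
  with Cons.prems show ?case by (cases w) (auto simp: reduce_def)
qed (simp add: reduce_def)

lemma reduce_append: "reduce (u @ v) = foldr red_cons u (reduce v)"
  by (simp add: reduce_def)

text \<open>Letters act on reduced words by mutually inverse bijections. Hence the action of a word
  depends only on its reduction (\<open>foldr_reduce\<close>), which yields associativity in
  \<open>F2\<close>.\<close>

lemma red_cons_cancel: "reduced w \<Longrightarrow> red_cons x (red_cons (inv_letter x) w) = w"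
  by (cases w rule: remdups_adj.cases) auto

lemma foldr_red_cons: "reduced v \<Longrightarrow> foldr red_cons (red_cons x u) v = red_cons x (foldr red_cons u v)"
  by (cases u) (auto simp: red_cons_cancel reduced_foldr)

lemma foldr_reduce: "reduced v \<Longrightarrow> foldr red_cons (reduce u) v = foldr red_cons u v"
  by (induction u) (auto simp: reduce_def foldr_red_cons)

lemma reduce_reduce_append: "reduce (reduce u @ v) = reduce (u @ v)"
  by (simp add: reduce_append foldr_reduce)

lemma reduce_append_reduce: "reduce (u @ reduce v) = reduce (u @ v)"
  by (simp add: reduce_append reduce_reduced)

lemma foldr_inverse: "reduced w \<Longrightarrow> foldr red_cons (rev (map inv_letter w)) w = []"
  by (induction w) (auto dest: reduced_tl)

lemma carrier_F2: "carrier F2 = {w. reduced w}"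
  and mult_F2: "u \<otimes>\<^bsub>F2\<^esub> v = reduce (u @ v)"
  and one_F2: "\<one>\<^bsub>F2\<^esub> = []"
  by (simp_all add: F2_def)

lemma group_F2: "group F2"
proof (rule groupI)
  fix x assume "x \<in> carrier F2"
  then have "reduce (rev (map inv_letter x)) \<otimes>\<^bsub>F2\<^esub> x = \<one>\<^bsub>F2\<^esub>"
    by (simp add: carrier_F2 mult_F2 one_F2 reduce_reduce_append)
      (simp add: reduce_append reduce_reduced foldr_inverse)
  then show "\<exists>y\<in>carrier F2. y \<otimes>\<^bsub>F2\<^esub> x = \<one>\<^bsub>F2\<^esub>"
    by (intro bexI[of _ "reduce (rev (map inv_letter x))"]) (simp_all add: carrier_F2)
qed (auto simp: carrier_F2 mult_F2 one_F2 reduce_reduce_append reduce_append_reduce reduce_reduced)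

interpretation F2: group F2 by (rule group_F2)

section \<open>Actions of the free group\<close>

text \<open>The universal property of the free group: maps for the letters that cancel in inverse
  pairs amount to an action of \<open>F2\<close>.\<close>

locale letter_action =
  fixes \<Omega> :: "'o set" and lact :: "letter \<Rightarrow> 'o \<Rightarrow> 'o"
  assumes lact_closed: "\<omega> \<in> \<Omega> \<Longrightarrow> lact x \<omega> \<in> \<Omega>"
    and lact_cancel: "\<omega> \<in> \<Omega> \<Longrightarrow> lact x (lact (inv_letter x) \<omega>) = \<omega>"
begin

definition wact :: "letter list \<Rightarrow> 'o \<Rightarrow> 'o" where
  "wact w = foldr lact w"

lemma wact_simps [simp]: "wact [] \<omega> = \<omega>" "wact (x # w) \<omega> = lact x (wact w \<omega>)"
  "wact (u @ v) \<omega> = wact u (wact v \<omega>)"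
  by (simp_all add: wact_def)

lemma wact_closed: "\<omega> \<in> \<Omega> \<Longrightarrow> wact w \<omega> \<in> \<Omega>"
  by (induction w) (auto simp: lact_closed)

lemma wact_red_cons: "\<omega> \<in> \<Omega> \<Longrightarrow> wact (red_cons x w) \<omega> = lact x (wact w \<omega>)"
  by (cases w) (auto simp: lact_cancel wact_closed)

lemma wact_reduce: "\<omega> \<in> \<Omega> \<Longrightarrow> wact (reduce w) \<omega> = wact w \<omega>"
  by (induction w) (auto simp: reduce_def wact_red_cons)

lemma wact_mult: "\<omega> \<in> \<Omega> \<Longrightarrow> wact (u \<otimes>\<^bsub>F2\<^esub> v) \<omega> = wact u (wact v \<omega>)"
  by (simp add: mult_F2 wact_reduce)

lemma wact_inv:
  assumes "w \<in> carrier F2" "\<omega> \<in> \<Omega>"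
  shows "wact (inv\<^bsub>F2\<^esub> w) (wact w \<omega>) = \<omega>" "wact w (wact (inv\<^bsub>F2\<^esub> w) \<omega>) = \<omega>"
  using wact_mult[OF assms(2), of "inv\<^bsub>F2\<^esub> w" w] wact_mult[OF assms(2), of w "inv\<^bsub>F2\<^esub> w"] assms
  by (simp_all add: one_F2)

definition act_ker :: "letter list set" where
  "act_ker = {w \<in> carrier F2. \<forall>\<omega>\<in>\<Omega>. wact w \<omega> = \<omega>}"

lemma normal_act_ker: "act_ker \<lhd> F2"
proof -
  have "subgroup act_ker F2"
  proof
    fix w assume w: "w \<in> act_ker"
    then have "wact (inv\<^bsub>F2\<^esub> w) \<omega> = \<omega>" if "\<omega> \<in> \<Omega>" for \<omega>
      using wact_inv(1)[of w \<omega>] that by (simp add: act_ker_def)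
    then show "inv\<^bsub>F2\<^esub> w \<in> act_ker" using w by (simp add: act_ker_def)
  qed (auto simp: act_ker_def wact_mult, simp_all add: one_F2)
  moreover have "x \<otimes>\<^bsub>F2\<^esub> w \<otimes>\<^bsub>F2\<^esub> inv\<^bsub>F2\<^esub> x \<in> act_ker" if "x \<in> carrier F2" "w \<in> act_ker" for x w
    using that by (auto simp: act_ker_def wact_mult wact_closed wact_inv)
  ultimately show ?thesis by (simp add: F2.normal_inv_iff)
qed

text \<open>Representatives of one coset differ by an element of \<open>act_ker\<close>, so the
  choice does not matter on the carrier of the action.\<close>

definition quot_act :: "letter list set \<Rightarrow> 'o \<Rightarrow> 'o" where
  "quot_act C = wact (SOME w. w \<in> C)"

lemma quot_act_coset:
  assumes "w \<in> carrier F2" "\<omega> \<in> \<Omega>"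
  shows "quot_act (act_ker #>\<^bsub>F2\<^esub> w) \<omega> = wact w \<omega>"
proof -
  let ?v = "SOME v. v \<in> act_ker #>\<^bsub>F2\<^esub> w"
  have "?v \<in> act_ker #>\<^bsub>F2\<^esub> w"
    using normal_imp_subgroup[OF normal_act_ker] assms(1) F2.rcos_self by (metis someI_ex)
  then obtain k where "k \<in> act_ker" "?v = k \<otimes>\<^bsub>F2\<^esub> w" unfolding r_coset_def by blast
  then show ?thesis
    using assms by (simp add: quot_act_def wact_mult) (simp add: act_ker_def wact_closed)
qed

end

lemma (in normal) coset_eq_one_iff: "x \<in> carrier G \<Longrightarrow> H #> x = H \<longleftrightarrow> x \<in> H"
  using coset_join1 coset_join2 subset is_subgroup rcos_self by blast

lemma (in group) int_pow_conj:
  assumes "x \<in> carrier G" "y \<in> carrier G" "z \<in> carrier G" "y \<otimes> x = x \<otimes> z"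
  shows "y [^] (k::int) \<otimes> x = x \<otimes> z [^] k"
proof -
  have nat: "y [^] n \<otimes> x = x \<otimes> z [^] n" for n :: nat
  proof (induction n)
    case (Suc n)
    have "y [^] Suc n \<otimes> x = y [^] n \<otimes> (x \<otimes> z)" using assms by (simp add: m_assoc)
    also have "\<dots> = x \<otimes> z [^] n \<otimes> z" using assms Suc by (simp add: m_assoc[symmetric])
    finally show ?case using assms by (simp add: m_assoc)
  qed (use assms in simp)
  show ?thesis
  proof (cases k rule: int_cases2)
    case (nonneg n)
    then show ?thesis using nat by (simp add: int_pow_int)
  next
    case (nonpos n)
    have "x = inv (y [^] n) \<otimes> (x \<otimes> z [^] n)"
      using assms nat[of n] by (simp add: m_assoc[symmetric] flip: nat)
    then have "x \<otimes> inv (z [^] n) = inv (y [^] n) \<otimes> x"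
      using assms by (metis inv_closed inv_solve_right m_assoc m_closed nat_pow_closed)
    then show ?thesis using nonpos assms by (simp add: int_pow_neg_int)
  qed
qed

section \<open>Normal forms of HNN extensions with abelian base\<close>

text \<open>
  The base is the abelian group \<open>'e\<close> (written additively), \<open>\<iota> s\<close> is the power \<open>s\<close> of a distinguished
  element \<open>b\<close>. The subgroup \<open>{x. \<rho> e x = 0}\<close> is associated to \<open>{x. \<rho> (\<not> e) x = 0}\<close> by \<open>\<theta> e\<close>, and
  \<open>\<rho> e x\<close> is the exponent of the power of \<open>b\<close> chosen to represent the coset of \<open>x\<close>. With \<open>a\<close> the
  stable letter, \<open>x a = a (\<theta> True x)\<close> and \<open>x a\<^sup>-\<^sup>1 = a\<^sup>-\<^sup>1 (\<theta> False x)\<close>.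
  A normal form \<open>([(s\<^sub>1, e\<^sub>1), \<dots>, (s\<^sub>k, e\<^sub>k)], t)\<close> stands for \<open>b\<^bsup>s\<^sub>1\<^esup> a\<^bsup>\<plusminus>1\<^esup> \<dots> b\<^bsup>s\<^sub>k\<^esup> a\<^bsup>\<plusminus>1\<^esup> t\<close>,
  the exponent of \<open>a\<close> being \<open>1\<close> at \<open>i\<close> iff \<open>e\<^sub>i\<close> holds.\<close>

definition cancels :: "bool \<Rightarrow> (int \<times> bool) list \<Rightarrow> bool" where
  "cancels e l \<longleftrightarrow> l \<noteq> [] \<and> hd l = (0, \<not> e)"

text \<open>Left multiplication by the stable letter, a if \<open>e\<close> holds and its inverse
  otherwise. The exponent 0 represents the associated subgroup itself, so a cancellation can occur
  only against a leading letter \<open>(0, \<not> e)\<close>.\<close>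

definition stab :: "bool \<Rightarrow> (int \<times> bool) list \<Rightarrow> (int \<times> bool) list" where
  "stab e l = (if cancels e l then tl l else (0, e) # l)"

lemma cancels_simps [simp]: "\<not> cancels e []" "cancels e (c # l) \<longleftrightarrow> c = (0, \<not> e)"
  by (simp_all add: cancels_def)

locale hnn =
  fixes \<iota> :: "int \<Rightarrow> 'e::ab_group_add" and \<rho> :: "bool \<Rightarrow> 'e \<Rightarrow> int" and \<theta> :: "bool \<Rightarrow> 'e \<Rightarrow> 'e"
  assumes iota_add: "\<iota> (s + t) = \<iota> s + \<iota> t"
    and rho_add: "\<rho> e x = 0 \<Longrightarrow> \<rho> e (x + y) = \<rho> e y"
    and rho_rep: "\<rho> e (x - \<iota> (\<rho> e x)) = 0"
    and rho_zero: "\<rho> e 0 = 0"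
    and theta_add: "\<lbrakk>\<rho> e x = 0; \<rho> e y = 0\<rbrakk> \<Longrightarrow> \<theta> e (x + y) = \<theta> e x + \<theta> e y"
    and theta_mem: "\<rho> e x = 0 \<Longrightarrow> \<rho> (\<not> e) (\<theta> e x) = 0"
    and theta_theta: "\<rho> e x = 0 \<Longrightarrow> \<theta> (\<not> e) (\<theta> e x) = x"
begin

lemma iota_zero: "\<iota> 0 = 0"
  using iota_add[of 0 0] by simp

lemma theta_zero [simp]: "\<theta> e 0 = 0"
  using theta_add[of e 0 0] rho_zero by simp

lemma rho_shift: "\<rho> e (x + \<iota> (\<rho> e z)) = \<rho> e (x + z)"
proof -
  have "\<rho> e ((z - \<iota> (\<rho> e z)) + (x + \<iota> (\<rho> e z))) = \<rho> e (x + \<iota> (\<rho> e z))"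
    by (rule rho_add[OF rho_rep])
  then show ?thesis by (simp add: algebra_simps)
qed

lemma rho_iota_rho: "\<rho> e (\<iota> (\<rho> e z)) = \<rho> e z"
  using rho_shift[of e 0 z] by simp

text \<open>The base element that emerges on the right when \<open>x\<close> is pushed past the
  letter \<open>c\<close>: the product of \<open>x\<close> and the power of b in \<open>c\<close> is
  split into a representative and an element of the associated subgroup, and \<open>\<theta>\<close>
  moves the latter across the stable letter.\<close>

definition nxt :: "int \<times> bool \<Rightarrow> 'e \<Rightarrow> 'e" where
  "nxt c x = \<theta> (snd c) (x + \<iota> (fst c) - \<iota> (\<rho> (snd c) (x + \<iota> (fst c))))"

text \<open>Multiplying \<open>l\<close> by \<open>x\<close> from the left gives the letters \<open>shift l x\<close> followed by the base
  element \<open>carry l x\<close>.\<close>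
primrec shift :: "(int \<times> bool) list \<Rightarrow> 'e \<Rightarrow> (int \<times> bool) list" where
  "shift [] x = []"
| "shift (c # l) x = (\<rho> (snd c) (x + \<iota> (fst c)), snd c) # shift l (nxt c x)"

primrec carry :: "(int \<times> bool) list \<Rightarrow> 'e \<Rightarrow> 'e" where
  "carry [] x = x"
| "carry (c # l) x = carry l (nxt c x)"

text \<open>Reducedness in Britton's sense, with each exponent being the chosen representative of
  its coset.\<close>

primrec valid :: "(int \<times> bool) list \<Rightarrow> bool" where
  "valid [] = True"
| "valid (c # l) \<longleftrightarrow> \<rho> (snd c) (\<iota> (fst c)) = fst c \<and> \<not> cancels (snd c) l \<and> valid l"

lemma shift_append: "shift (l @ l') x = shift l x @ shift l' (carry l x)"
  and carry_append: "carry (l @ l') x = carry l' (carry l x)"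
  by (induction l arbitrary: x) simp_all

lemma length_shift [simp]: "length (shift l x) = length l"
  by (induction l arbitrary: x) simp_all

lemma rho_nxt: "\<rho> (\<not> snd c) (nxt c x) = 0"
  unfolding nxt_def by (rule theta_mem[OF rho_rep])

text \<open>Push \<open>y\<close> first, which changes the exponent of the letter, then push
  \<open>x\<close> past the changed letter. Iterated, this makes \<open>shift\<close> an action of
  the base and \<open>carry\<close> a cocycle over it.\<close>

lemma nxt_add: "nxt c (x + y) = nxt (\<rho> (snd c) (y + \<iota> (fst c)), snd c) x + nxt c y"
proof -
  define e where "e = snd c"
  define z where "z = y + \<iota> (fst c)"
  have r: "\<rho> e (x + \<iota> (\<rho> e z)) = \<rho> e (x + z)" by (rule rho_shift)
  have eq: "(x + \<iota> (\<rho> e z) - \<iota> (\<rho> e (x + \<iota> (\<rho> e z)))) + (z - \<iota> (\<rho> e z)) = x + z - \<iota> (\<rho> e (x + z))"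
    unfolding r by (simp add: algebra_simps)
  have "nxt c (x + y) = \<theta> e (x + z - \<iota> (\<rho> e (x + z)))"
    by (simp add: nxt_def e_def z_def add.assoc)
  also have "\<dots> = \<theta> e (x + \<iota> (\<rho> e z) - \<iota> (\<rho> e (x + \<iota> (\<rho> e z)))) + \<theta> e (z - \<iota> (\<rho> e z))"
    unfolding eq[symmetric] by (rule theta_add[OF rho_rep rho_rep])
  also have "\<dots> = nxt (\<rho> e z, e) x + nxt c y"
    by (simp add: nxt_def e_def z_def)
  finally show ?thesis by (simp add: e_def z_def)
qed

lemma shift_add: "shift l (x + y) = shift (shift l y) x"
  and carry_add: "carry l (x + y) = carry (shift l y) x + carry l y"
  by (induction l arbitrary: x y) (simp_all add: nxt_add rho_shift add.assoc)

lemma nxt_zero: "\<rho> (snd c) (\<iota> (fst c)) = fst c \<Longrightarrow> nxt c 0 = 0"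
  by (simp add: nxt_def)

lemma shift_zero: "valid l \<Longrightarrow> shift l 0 = l"
  and carry_zero: "valid l \<Longrightarrow> carry l 0 = 0"
  by (induction l) (simp_all add: nxt_zero)

text \<open>An element of the associated subgroup does not change the representative of a coset, so
  it cannot create a leading exponent 0 where cancellation threatens. By \<open>rho_nxt\<close>,
  what has been pushed past a letter is such an element.\<close>

lemma not_cancels_shift:
  assumes "\<rho> (\<not> e) x = 0" "\<not> cancels e l" "valid l"
  shows "\<not> cancels e (shift l x)"
proof (cases l)
  case (Cons c l')
  obtain s e' where c: "c = (s, e')" by (cases c)
  show ?thesis
  proof (cases "e' = (\<not> e)")
    case True
    then have "\<rho> e' (x + \<iota> s) = s" using rho_add[OF assms(1)] assms(3) by (simp add: Cons c)
    then show ?thesis using assms(2) by (simp add: Cons c)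
  qed (simp add: Cons c)
qed simp

lemma valid_shift: "valid l \<Longrightarrow> valid (shift l x)"
proof (induction l arbitrary: x)
  case (Cons c l)
  then show ?case using not_cancels_shift[OF rho_nxt] by (simp add: rho_iota_rho)
qed simp

lemma valid_appendD: "valid (l @ l') \<Longrightarrow> valid l'"
  by (induction l) auto

lemma valid_append_Cons:
  assumes "valid l" "fst c \<noteq> 0" "valid (c # l')"
  shows "valid (l @ c # l')"
  using assms(1)
proof (induction l)
  case Nil
  then show ?case using assms by simp
next
  case (Cons d l)
  then show ?case using assms(2) by (cases l) auto
qed

lemma valid_stab: "valid l \<Longrightarrow> valid (stab e l)"
  by (cases l) (auto simp: stab_def rho_zero iota_zero)

lemma stab_stab: "valid l \<Longrightarrow> stab (\<not> e) (stab e l) = l"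
  by (cases l) (auto simp: stab_def)

text \<open>The HNN relation on normal forms: a base element of the associated subgroup passes the
  stable letter at the price of \<open>\<theta>\<close>.\<close>

lemma stab_shift:
  assumes l: "valid l" and x: "\<rho> (\<not> e) x = 0"
  shows "stab e (shift l x) = shift (stab e l) (\<theta> (\<not> e) x) \<and> carry l x = carry (stab e l) (\<theta> (\<not> e) x)"
proof (cases "cancels e l")
  case True
  then obtain l' where l': "l = (0, \<not> e) # l'" unfolding cancels_def by (metis list.collapse)
  show ?thesis using x by (simp add: l' stab_def nxt_def iota_zero)
next
  case False
  then have n: "\<not> cancels e (shift l x)" using not_cancels_shift x l by blast
  have m: "\<rho> e (\<theta> (\<not> e) x) = 0" "\<theta> e (\<theta> (\<not> e) x) = x" using theta_mem[OF x] theta_theta[OF x] by simp_all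
  then have "nxt (0, e) (\<theta> (\<not> e) x) = x" by (simp add: nxt_def iota_zero)
  then show ?thesis using False n m by (simp add: stab_def iota_zero)
qed

definition nforms :: "((int \<times> bool) list \<times> 'e) set" where
  "nforms = {\<omega>. valid (fst \<omega>)}"

definition bact :: "'e \<Rightarrow> (int \<times> bool) list \<times> 'e \<Rightarrow> (int \<times> bool) list \<times> 'e" where
  "bact x \<omega> = (shift (fst \<omega>) x, carry (fst \<omega>) x + snd \<omega>)"

text \<open>The sign conventions are opposite, hence the negation: in a letter of \<open>F2\<close>,
  \<open>True\<close> marks the inverse, while in a normal form it marks exponent 1.\<close>

definition lact :: "letter \<Rightarrow> (int \<times> bool) list \<times> 'e \<Rightarrow> (int \<times> bool) list \<times> 'e" where
  "lact g \<omega> = (if fst g then bact (\<iota> (if snd g then - 1 else 1)) \<omega>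
     else (stab (\<not> snd g) (fst \<omega>), snd \<omega>))"

lemma bact_add: "bact (x + y) \<omega> = bact x (bact y \<omega>)"
  by (simp add: bact_def shift_add carry_add add.assoc)

lemma bact_zero: "\<omega> \<in> nforms \<Longrightarrow> bact 0 \<omega> = \<omega>"
  by (simp add: bact_def nforms_def shift_zero carry_zero)

lemma bact_closed: "\<omega> \<in> nforms \<Longrightarrow> bact x \<omega> \<in> nforms"
  by (simp add: bact_def nforms_def valid_shift)

sublocale letter_action nforms lact
proof
  fix \<omega> x assume w: "\<omega> \<in> nforms"
  show "lact x \<omega> \<in> nforms"
    using w bact_closed by (auto simp: lact_def) (simp add: nforms_def valid_stab)
  have "bact (\<iota> s) (bact (\<iota> (- s)) \<omega>) = \<omega>" for s
    using w bact_zero iota_add[of s "- s"] by (simp add: iota_zero flip: bact_add)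
  from this[of 1] this[of "- 1"] show "lact x (lact (inv_letter x) \<omega>) = \<omega>"
    using w stab_stab[of "fst \<omega>" "snd x"] stab_stab[of "fst \<omega>" "\<not> snd x"]
    by (auto simp: lact_def inv_letter_def nforms_def)
qed

lemma lact_b: "lact (True, i) \<omega> = bact (\<iota> (if i then - 1 else 1)) \<omega>"
  and lact_a: "lact (False, i) \<omega> = (stab (\<not> i) (fst \<omega>), snd \<omega>)"
  by (simp_all add: lact_def)

lemma wact_replicate_b:
  assumes "\<omega> \<in> nforms"
  shows "wact (replicate n (True, i)) \<omega> = bact (\<iota> (if i then - int n else int n)) \<omega>"
proof (induction n)
  case 0
  then show ?case using assms by (simp add: bact_zero iota_zero)
next
  case (Suc n)
  then show ?case
    by (cases i) (simp_all add: lact_b algebra_simps flip: bact_add iota_add)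
qed

lemma wact_bpow: "\<omega> \<in> nforms \<Longrightarrow> wact (bpow k) \<omega> = bact (\<iota> k) \<omega>"
  by (simp add: bpow_def lb_def lb_inv_def wact_replicate_b)

lemma relator_act_ker:
  assumes "\<rho> False (\<iota> p) = 0" "\<theta> False (\<iota> p) = \<iota> q"
  shows "bs_relator p q \<in> act_ker"
proof -
  have "wact (bs_relator p q) \<omega> = \<omega>" if w: "\<omega> \<in> nforms" for \<omega>
  proof -
    let ?u = "bact (\<iota> (- q)) \<omega>"
    let ?v = "(stab False (fst ?u), snd ?u)"
    have u: "?u \<in> nforms" using w by (rule bact_closed)
    have v: "?v \<in> nforms" using u by (simp add: nforms_def valid_stab)
    have st: "stab True (fst ?v) = fst ?u" using u stab_stab[of "fst ?u" False] by (simp add: nforms_def)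
    have "wact (bs_relator p q) \<omega> = lact la (bact (\<iota> p) (lact la_inv ?u))"
      using w v by (simp add: bs_relator_def wact_reduce wact_bpow lact_a la_def la_inv_def)
    also have "\<dots> = bact (\<iota> q) ?u"
      using stab_shift[of "fst ?v" True "\<iota> p"] v assms st
      by (simp add: lact_a la_def la_inv_def bact_def nforms_def)
    also have "\<dots> = \<omega>" using w bact_zero iota_add[of q "- q"] by (simp add: iota_zero flip: bact_add)
    finally show ?thesis .
  qed
  then show ?thesis by (simp add: act_ker_def carrier_F2 bs_relator_def)
qed

end

section \<open>Baumslag-Solitar groups as HNN extensions of the integers\<close>

text \<open>Representatives modulo \<open>q\<close> are centred at \<open>0\<close>, so that a fixed integer becomes its own
  representative once \<open>\<bar>q\<bar>\<close> is large.\<close>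
definition rho_int :: "int \<Rightarrow> int \<Rightarrow> bool \<Rightarrow> int \<Rightarrow> int" where
  "rho_int m q e x = (if e then (x + \<bar>q\<bar> div 2) mod \<bar>q\<bar> - \<bar>q\<bar> div 2 else x mod m)"

text \<open>On the associated subgroups the divisions are exact: \<open>q * k\<close> corresponds to
  \<open>m * k\<close>, the k-th power of the defining relation.\<close>

definition theta_int :: "int \<Rightarrow> int \<Rightarrow> bool \<Rightarrow> int \<Rightarrow> int" where
  "theta_int m q e x = (if e then (x div q) * m else (x div m) * q)"

lemma rho_int_True_eq_0_iff:
  assumes "q \<noteq> 0"
  shows "rho_int m q True x = 0 \<longleftrightarrow> q dvd x"
proof -
  have "\<bar>q\<bar> div 2 = (\<bar>q\<bar> div 2) mod \<bar>q\<bar>" using assms by (intro mod_pos_pos_trivial[symmetric]) auto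
  then have "rho_int m q True x = 0 \<longleftrightarrow> (x + \<bar>q\<bar> div 2) mod \<bar>q\<bar> = (\<bar>q\<bar> div 2) mod \<bar>q\<bar>"
    by (simp add: rho_int_def)
  also have "\<dots> \<longleftrightarrow> q dvd x" by (simp add: mod_eq_dvd_iff)
  finally show ?thesis .
qed

lemma rho_int_True_small:
  assumes "2 * \<bar>x\<bar> < \<bar>q\<bar>"
  shows "rho_int m q True (x + q * k) = x"
proof -
  have "(x + q * k + \<bar>q\<bar> div 2) mod \<bar>q\<bar> = (x + \<bar>q\<bar> div 2) mod \<bar>q\<bar>"
    by (simp add: mod_eq_dvd_iff)
  also have "\<dots> = x + \<bar>q\<bar> div 2" by (rule mod_pos_pos_trivial) (use assms in linarith)+
  finally show ?thesis by (simp add: rho_int_def)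
qed

lemma hnn_int:
  assumes m: "m \<noteq> 0" and q: "q \<noteq> 0"
  shows "hnn (\<lambda>s. s) (rho_int m q) (theta_int m q)"
proof
  fix e x y
  have F: "rho_int m q False z = 0 \<longleftrightarrow> m dvd z" for z by (simp add: rho_int_def mod_eq_0_iff_dvd)
  note T = rho_int_True_eq_0_iff[OF q, of m]
  show "rho_int m q e 0 = 0" using T F by (cases e) auto
  show "rho_int m q e (x + y) = rho_int m q e y" if "rho_int m q e x = 0"
  proof (cases e)
    case True
    then have "(x + y + \<bar>q\<bar> div 2) mod \<bar>q\<bar> = (y + \<bar>q\<bar> div 2) mod \<bar>q\<bar>"
      using that T by (simp add: mod_eq_dvd_iff)
    then show ?thesis using True by (simp add: rho_int_def)
  next
    case False
    then show ?thesis using that F[of x] by (auto simp: rho_int_def mod_eq_dvd_iff)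
  qed
  show "rho_int m q e (x - rho_int m q e x) = 0"
  proof (cases e)
    case True
    then have e: "e = True" by simp
    have "x - rho_int m q True x = (x + \<bar>q\<bar> div 2) - (x + \<bar>q\<bar> div 2) mod \<bar>q\<bar>"
      by (simp add: rho_int_def)
    then have "\<bar>q\<bar> dvd x - rho_int m q True x" by (simp only: dvd_minus_mod)
    then show ?thesis unfolding e T by simp
  next
    case False
    then have e: "e = False" by simp
    show ?thesis unfolding e F by (simp add: rho_int_def dvd_minus_mod)
  qed
  show "theta_int m q e (x + y) = theta_int m q e x + theta_int m q e y"
    if "rho_int m q e x = 0" "rho_int m q e y = 0"
    using that T F by (cases e) (simp_all add: theta_int_def algebra_simps div_plus_div_distrib_dvd_left)
  show "rho_int m q (\<not> e) (theta_int m q e x) = 0" if "rho_int m q e x = 0"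
    using T F by (cases e) (auto simp: theta_int_def)
  show "theta_int m q (\<not> e) (theta_int m q e x) = x" if "rho_int m q e x = 0"
    using that T F m q by (cases e) (auto simp: theta_int_def)
qed simp

lemma (in group) int_pow_mult_left:
  "\<lbrakk>x \<in> carrier G; y \<in> carrier G\<rbrakk> \<Longrightarrow> x [^] (i::int) \<otimes> (x [^] (j::int) \<otimes> y) = x [^] (i + j) \<otimes> y"
  by (simp add: int_pow_mult m_assoc)

section \<open>Evaluating normal forms in groups that satisfy the relation\<close>

context group
begin

definition nf_val :: "'a \<Rightarrow> 'a \<Rightarrow> (int \<times> bool) list \<times> int \<Rightarrow> 'a" where
  "nf_val \<alpha> \<beta> \<omega> = foldr (\<lambda>c y. \<beta> [^] fst c \<otimes> ((if snd c then \<alpha> else inv \<alpha>) \<otimes> y)) (fst \<omega>) (\<beta> [^] snd \<omega>)"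

lemma nf_val_simps [simp]:
  "nf_val \<alpha> \<beta> ([], t) = \<beta> [^] t"
  "nf_val \<alpha> \<beta> (c # l, t) = \<beta> [^] fst c \<otimes> ((if snd c then \<alpha> else inv \<alpha>) \<otimes> nf_val \<alpha> \<beta> (l, t))"
  by (simp_all add: nf_val_def)

lemma nf_val_closed: "\<lbrakk>\<alpha> \<in> carrier G; \<beta> \<in> carrier G\<rbrakk> \<Longrightarrow> nf_val \<alpha> \<beta> (l, t) \<in> carrier G"
  by (induction l) auto

text \<open>Every rewriting step of a normal form is a consequence of the relation, so evaluation
  intertwines the action with left multiplication.\<close>

lemma nf_val_lact:
  assumes ab: "\<alpha> \<in> carrier G" "\<beta> \<in> carrier G" and rel: "\<alpha> \<otimes> \<beta> [^] m = \<beta> [^] q \<otimes> \<alpha>"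
    and mq: "m \<noteq> 0" "q \<noteq> 0"
  shows "nf_val \<alpha> \<beta> (hnn.lact (\<lambda>s. s) (rho_int m q) (theta_int m q) x \<omega>)
    = (if fst x then \<beta> [^] (if snd x then - 1 else 1 :: int) else if snd x then inv \<alpha> else \<alpha>) \<otimes> nf_val \<alpha> \<beta> \<omega>"
proof -
  interpret hnn "\<lambda>s. s" "rho_int m q" "theta_int m q" by (rule hnn_int[OF mq])
  let ?a = "\<lambda>e. if e then \<alpha> else inv \<alpha>"
  have a: "?a e \<in> carrier G" for e using ab by simp
  \<comment> \<open>By its residue \<open>u\<close> is a multiple of \<open>q\<close> or of
    \<open>m\<close>, so this is a power of the relation.\<close>
  have push: "\<beta> [^] u \<otimes> ?a e = ?a e \<otimes> \<beta> [^] theta_int m q e u" if u: "rho_int m q e u = 0" for u :: int and e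
  proof (cases e)
    case True
    then have "q dvd u" using u rho_int_True_eq_0_iff[OF mq(2), of m u] by simp
    then obtain k where k: "u = q * k" by (elim dvdE)
    have "(\<beta> [^] q) [^] k \<otimes> \<alpha> = \<alpha> \<otimes> (\<beta> [^] m) [^] k"
      by (rule int_pow_conj) (use ab rel in auto)
    then show ?thesis using True k mq ab by (simp add: theta_int_def int_pow_pow mult.commute)
  next
    case False
    then have "m dvd u" using u by (simp add: rho_int_def mod_eq_0_iff_dvd)
    then obtain k where k: "u = m * k" by (elim dvdE)
    have "\<beta> [^] q = \<alpha> \<otimes> (\<beta> [^] m \<otimes> inv \<alpha>)"
      using ab rel by (simp add: m_assoc[symmetric]) (simp add: m_assoc)
    then have "\<beta> [^] m \<otimes> inv \<alpha> = inv \<alpha> \<otimes> \<beta> [^] q"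
      using ab by (subst inv_solve_left) auto
    then have "(\<beta> [^] m) [^] k \<otimes> inv \<alpha> = inv \<alpha> \<otimes> (\<beta> [^] q) [^] k"
      by (intro int_pow_conj) (use ab in auto)
    then show ?thesis using False k mq ab by (simp add: theta_int_def int_pow_pow mult.commute)
  qed
  have b: "nf_val \<alpha> \<beta> (shift l y, carry l y + t) = \<beta> [^] y \<otimes> nf_val \<alpha> \<beta> (l, t)" for l y t
  proof (induction l arbitrary: y)
    case Nil
    then show ?case using ab by (simp add: int_pow_mult)
  next
    case (Cons c l)
    obtain s e where c: "c = (s, e)" by (cases c)
    define s' where "s' = rho_int m q e (y + s)"
    define W where "W = nf_val \<alpha> \<beta> (l, t)"
    have W: "W \<in> carrier G" unfolding W_def by (rule nf_val_closed[OF ab])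
    have u: "rho_int m q e (y + s - s') = 0" using rho_rep[of e "y + s"] by (simp add: s'_def)
    have "nf_val \<alpha> \<beta> (shift (c # l) y, carry (c # l) y + t)
        = \<beta> [^] s' \<otimes> (?a e \<otimes> (\<beta> [^] theta_int m q e (y + s - s') \<otimes> W))"
      using Cons.IH[of "nxt c y"] by (simp add: c nxt_def s'_def W_def)
    also have "\<dots> = \<beta> [^] s' \<otimes> (\<beta> [^] (y + s - s') \<otimes> (?a e \<otimes> W))"
      using push[OF u] ab W by (simp add: m_assoc[symmetric] del: if_split) 
    also have "\<dots> = \<beta> [^] y \<otimes> (\<beta> [^] s \<otimes> (?a e \<otimes> W))"
      using ab W a by (simp add: int_pow_mult_left)
    finally show ?case by (simp add: c W_def)
  qed
  have st: "nf_val \<alpha> \<beta> (stab e l, t) = ?a e \<otimes> nf_val \<alpha> \<beta> (l, t)" for e l t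
  proof (cases "cancels e l")
    case True
    then obtain l' where l': "l = (0, \<not> e) # l'" unfolding cancels_def by (metis list.collapse)
    show ?thesis using ab nf_val_closed[OF ab, of l' t]
      by (cases e) (simp_all add: l' stab_def m_assoc[symmetric])
  next
    case False
    then show ?thesis using ab nf_val_closed[OF ab, of l t] by (simp add: stab_def)
  qed
  show ?thesis using b[of "fst \<omega>" _ "snd \<omega>"] st[of _ "fst \<omega>" "snd \<omega>"]
    by (cases x; cases \<omega>) (auto simp: lact_def bact_def)
qed

end


text \<open>Models the map from \<open>F2\<close> to a quotient on all words, reduced or not, so
  that concatenation can replace the product of \<open>F2\<close>.\<close>

locale word_rep = group G for G (structure) +
  fixes cls :: "letter list \<Rightarrow> 'a"
  assumes cls_closed: "cls w \<in> carrier G"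
    and cls_append: "cls (u @ v) = cls u \<otimes> cls v"
    and cls_reduce: "cls (reduce w) = cls w"
begin

lemma cls_Nil: "cls [] = \<one>"
  using cls_append[of "[]" "[]"] cls_closed[of "[]"] by (simp add: r_cancel_one')

lemma cls_inv_letter: "cls [inv_letter x] = inv cls [x]"
proof (rule inv_equality[symmetric])
  have "reduce ([inv_letter x] @ [x]) = reduce []" by (simp add: reduce_def)
  then have "cls ([inv_letter x] @ [x]) = cls []" using cls_reduce by metis
  then show "cls [inv_letter x] \<otimes> cls [x] = \<one>" by (simp only: cls_append cls_Nil)
qed (auto simp: cls_closed)

lemma cls_replicate: "cls (replicate n x) = cls [x] [^] n"
proof (induction n)
  case (Suc n)
  have "cls (replicate n x @ [x]) = cls (replicate n x) \<otimes> cls [x]" by (rule cls_append)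
  then show ?case using Suc by (simp add: replicate_append_same)
qed (simp add: cls_Nil)

lemma cls_bpow: "cls (bpow k) = cls [lb] [^] k"
proof (cases k rule: int_cases2)
  case (nonneg n)
  then show ?thesis by (simp add: bpow_def cls_replicate int_pow_int)
next
  case (nonpos n)
  have "lb_inv = inv_letter lb" by (simp add: lb_def lb_inv_def inv_letter_def)
  then show ?thesis
    using nonpos cls_closed cls_inv_letter[of lb] by (cases "n = 0")
      (simp_all add: bpow_def cls_replicate cls_Nil int_pow_neg_int nat_pow_inv)
qed

text \<open>By equivariance of evaluation, the value of the fixed normal form is unchanged by left
  multiplication with \<open>cls w\<close>, and it cancels.\<close>

lemma cls_eq_one_of_fixed:
  assumes rel: "cls (bs_relator m q) = \<one>" and mq: "m \<noteq> 0" "q \<noteq> 0"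
    and fixed: "letter_action.wact (hnn.lact (\<lambda>s. s) (rho_int m q) (theta_int m q)) w \<omega> = \<omega>"
  shows "cls w = \<one>"
proof -
  interpret hnn "\<lambda>s. s" "rho_int m q" "theta_int m q" by (rule hnn_int[OF mq])
  define \<alpha> where "\<alpha> = cls [la]"
  define \<beta> where "\<beta> = cls [lb]"
  have ab: "\<alpha> \<in> carrier G" "\<beta> \<in> carrier G" by (simp_all add: \<alpha>_def \<beta>_def cls_closed)
  have lai: "la_inv = inv_letter la" by (simp add: la_def la_inv_def inv_letter_def)
  have "\<alpha> \<otimes> (\<beta> [^] m \<otimes> (inv \<alpha> \<otimes> \<beta> [^] (- q))) = \<one>"
    using rel unfolding bs_relator_def cls_reduce cls_append cls_bpow lai cls_inv_letter \<alpha>_def \<beta>_def .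
  then have "(\<alpha> \<otimes> \<beta> [^] m \<otimes> inv \<alpha>) \<otimes> inv (\<beta> [^] q) = \<one>"
    using ab by (simp add: m_assoc int_pow_neg)
  then have "\<alpha> \<otimes> \<beta> [^] m \<otimes> inv \<alpha> = \<one> \<otimes> \<beta> [^] q"
    using inv_solve_right[of \<one> "\<alpha> \<otimes> \<beta> [^] m \<otimes> inv \<alpha>" "\<beta> [^] q"]
      inv_equality[of "\<alpha> \<otimes> \<beta> [^] m \<otimes> inv \<alpha>" "inv (\<beta> [^] q)"] ab by simp
  then have r: "\<alpha> \<otimes> \<beta> [^] m = \<beta> [^] q \<otimes> \<alpha>"
    using inv_solve_right[of "\<beta> [^] q" "\<alpha> \<otimes> \<beta> [^] m" \<alpha>] ab by simp
  have val: "cls [x] = (if fst x then \<beta> [^] (if snd x then - 1 else 1 :: int)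
      else if snd x then inv \<alpha> else \<alpha>)" for x
  proof -
    obtain g i where x: "x = (g, i)" by (cases x)
    have "\<beta> [^] (- 1 :: int) = inv \<beta>" "\<beta> [^] (1 :: int) = \<beta>" using ab by (simp_all add: int_pow_neg int_pow_1)
    then show ?thesis using cls_inv_letter[of lb] cls_inv_letter[of la]
      by (cases g; cases i) (simp_all add: x \<alpha>_def \<beta>_def lb_def la_def inv_letter_def)
  qed
  have vc: "nf_val \<alpha> \<beta> \<omega> \<in> carrier G" using nf_val_closed[OF ab, of "fst \<omega>" "snd \<omega>"] by simp
  have "nf_val \<alpha> \<beta> (wact v \<omega>) = cls v \<otimes> nf_val \<alpha> \<beta> \<omega>" for v
  proof (induction v)
    case Nil
    then show ?case using vc by (simp add: cls_Nil)
  next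
    case (Cons x v)
    have "cls (x # v) = cls [x] \<otimes> cls v" using cls_append[of "[x]" v] by simp
    then show ?case
      using Cons nf_val_lact[OF ab r mq, of x "wact v \<omega>"] vc cls_closed[of v] cls_closed[of "[x]"]
      unfolding val[symmetric] by (simp add: m_assoc)
  qed
  from this[of w] show ?thesis using fixed vc cls_closed[of w] r_cancel_one' by metis
qed

end

lemma normal_word_rep:
  assumes "N \<lhd> F2"
  shows "word_rep (F2 Mod N) (\<lambda>w. N #>\<^bsub>F2\<^esub> reduce w)"
proof -
  interpret N: normal N F2 by (rule assms)
  interpret Q: group "F2 Mod N" by (rule N.factorgroup_is_group)
  show ?thesis
  proof
    show "N #>\<^bsub>F2\<^esub> reduce w \<in> carrier (F2 Mod N)" for w
      by (auto simp: carrier_FactGroup carrier_F2)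
    show "N #>\<^bsub>F2\<^esub> reduce (u @ v) = (N #>\<^bsub>F2\<^esub> reduce u) \<otimes>\<^bsub>F2 Mod N\<^esub> (N #>\<^bsub>F2\<^esub> reduce v)" for u v
      by (simp add: N.rcos_sum carrier_F2 mult_F2 reduce_reduce_append reduce_append_reduce)
    show "N #>\<^bsub>F2\<^esub> reduce (reduce w) = N #>\<^bsub>F2\<^esub> reduce w" for w
      by (simp add: reduce_reduced)
  qed
qed

text \<open>The previous argument applies to \<open>F2 Mod N\<close> for each normal
  \<open>N\<close> containing the relator, and \<open>BS_ker\<close> is the intersection of these
  \<open>N\<close>.\<close>

lemma BS_ker_of_fixed:
  assumes mq: "m \<noteq> 0" "q \<noteq> 0" and w: "w \<in> carrier F2"
    and fixed: "letter_action.wact (hnn.lact (\<lambda>s. s) (rho_int m q) (theta_int m q)) w \<omega> = \<omega>"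
  shows "w \<in> BS_ker m q"
  unfolding BS_ker_def
proof (rule InterI)
  fix N assume "N \<in> {N. N \<lhd> F2 \<and> bs_relator m q \<in> N}"
  then have N: "N \<lhd> F2" "bs_relator m q \<in> N" by auto
  interpret N: normal N F2 by (rule N)
  interpret word_rep "F2 Mod N" "\<lambda>w. N #>\<^bsub>F2\<^esub> reduce w" by (rule normal_word_rep[OF N(1)])
  have r: "reduced (bs_relator m q)" by (simp add: bs_relator_def)
  then have "N #>\<^bsub>F2\<^esub> reduce (bs_relator m q) = \<one>\<^bsub>F2 Mod N\<^esub>"
    using N.coset_eq_one_iff[of "bs_relator m q"] N(2) by (simp add: carrier_F2 reduce_reduced)
  from cls_eq_one_of_fixed[OF this mq fixed] show "w \<in> N"
    using N.coset_eq_one_iff[OF w] w by (simp add: carrier_F2 reduce_reduced)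
qed

text \<open>The kernel of the action is itself one of the normal subgroups intersected in
  \<open>BS_ker\<close>.\<close>

lemma BS_ker_fixes:
  assumes mq: "m \<noteq> 0" "q \<noteq> 0" and w: "w \<in> BS_ker m q"
    and v: "hnn.valid (\<lambda>s. s) (rho_int m q) (fst \<omega>)"
  shows "letter_action.wact (hnn.lact (\<lambda>s. s) (rho_int m q) (theta_int m q)) w \<omega> = \<omega>"
proof -
  interpret hnn "\<lambda>s. s" "rho_int m q" "theta_int m q" by (rule hnn_int[OF mq])
  have "bs_relator m q \<in> act_ker"
    by (rule relator_act_ker) (use mq in \<open>simp_all add: rho_int_def theta_int_def\<close>)
  then have "w \<in> act_ker" using w normal_act_ker unfolding BS_ker_def by blast
  moreover have "\<omega> \<in> nforms" using v by (simp add: nforms_def)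
  ultimately show ?thesis by (simp add: act_ker_def)
qed

section \<open>The limit group as an HNN extension of a free abelian group\<close>

text \<open>Integer polynomials encode the free abelian group on e_0, e_1, ... by their
  coefficients; \<open>lin c\<close> is its homomorphism to the integers with e_i going to
  \<open>c i\<close>.\<close>

definition lin :: "(nat \<Rightarrow> int) \<Rightarrow> int poly \<Rightarrow> int" where
  "lin c x = (\<Sum>i\<le>degree x. c i * coeff x i)"

lemma lin_eq: "degree x \<le> n \<Longrightarrow> lin c x = (\<Sum>i\<le>n. c i * coeff x i)"
  unfolding lin_def by (rule sum.mono_neutral_left) (auto simp: coeff_eq_0)

lemma lin_add: "lin c (x + y) = lin c x + lin c y"
  using lin_eq[of "x + y" "max (degree x) (degree y)" c] lin_eq[of x "max (degree x) (degree y)" c]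
    lin_eq[of y "max (degree x) (degree y)" c]
  by (simp add: degree_add_le_max algebra_simps sum.distrib)

lemma lin_zero [simp]: "lin c 0 = 0"
  by (simp add: lin_def)

lemma lin_const [simp]: "lin c [:s:] = c 0 * s"
  by (simp add: lin_def)

lemma lin_uminus: "lin c (- x) = - lin c x"
  by (simp add: lin_def sum_negf)

lemma lin_diff: "lin c (x - y) = lin c x - lin c y"
  using lin_add[of c x "- y"] by (simp add: lin_uminus)

lemma lin_pCons: "lin c (pCons a y) = c 0 * a + lin (\<lambda>i. c (Suc i)) y"
proof -
  have "degree (pCons a y) \<le> Suc (degree y)" by (simp add: degree_pCons_le)
  from lin_eq[OF this, of c] show ?thesis
    unfolding sum.atMost_Suc_shift by (simp add: lin_def)
qed


text \<open>The element \<open>b\<close> of the limit group is the constant polynomial \<open>1\<close>, and the monomial of degree \<open>i\<close>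
  is the limit of the elements \<open>b ^ bs_exp m q i\<close> of \<open>BS(m, q)\<close>.\<close>
primrec bs_exp :: "int \<Rightarrow> int \<Rightarrow> nat \<Rightarrow> int" where
  "bs_exp m q 0 = 1"
| "bs_exp m q (Suc i) = (if i = 0 then q else q * (bs_exp m q i div m))"

text \<open>The residue modulo \<open>m\<close> of the exponent approximating e_i. By
  \<open>bs_exp_cong\<close> it depends on \<open>q\<close> modulo the i-th power of
  \<open>m\<close> only, so the component \<open>\<xi> i\<close> determines it.\<close>

definition digit :: "int \<Rightarrow> (nat \<Rightarrow> int) \<Rightarrow> nat \<Rightarrow> int" where
  "digit m \<xi> i = (if i = 0 then 1 else bs_exp m (\<xi> i) i mod m)"

text \<open>The limits of \<open>rho_int\<close>: for growing \<open>q\<close> the centred residue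
  of an exponent settles at the coefficient of e_0, and the residue modulo \<open>m\<close> is read
  off from the digits.\<close>

definition rho_lim :: "int \<Rightarrow> (nat \<Rightarrow> int) \<Rightarrow> bool \<Rightarrow> int poly \<Rightarrow> int" where
  "rho_lim m \<xi> e x = (if e then coeff x 0 else lin (digit m \<xi>) x mod m)"

text \<open>With r_i the digits, the \<open>False\<close> direction sends m e_0 to e_1 and e_i - r_i
  e_0 to e_(i+1) for i > 0; the \<open>True\<close> direction is its inverse. The formula follows by
  writing x as l(x) e_0 plus the sum over i > 0 of x_i (e_i - r_i e_0), where l is
  \<open>lin\<close> of the digits.\<close>

definition theta_lim :: "int \<Rightarrow> (nat \<Rightarrow> int) \<Rightarrow> bool \<Rightarrow> int poly \<Rightarrow> int poly" where
  "theta_lim m \<xi> e x = (if e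
     then poly_shift 1 x + [:m * coeff x 1 - lin (digit m \<xi>) (poly_shift 1 x):]
     else pCons 0 (x + [:lin (digit m \<xi>) x div m - coeff x 0:]))"

lemma poly_shift_1_pCons: "poly_shift 1 (pCons a y) = y"
  by (rule poly_eqI) (simp add: coeff_poly_shift)

lemma poly_shift_1_add: "poly_shift 1 (x + y) = poly_shift 1 x + poly_shift 1 (y :: int poly)"
  by (rule poly_eqI) (simp add: coeff_poly_shift)

lemma pCons_poly_shift_1: "coeff x 0 = 0 \<Longrightarrow> pCons 0 (poly_shift 1 x) = x"
  by (rule poly_eqI) (simp add: coeff_poly_shift coeff_pCons split: nat.split)

lemma digit_0 [simp]: "digit m \<xi> 0 = 1"
  by (simp add: digit_def)

lemma theta_lim_True_pCons:
  "theta_lim m \<xi> True (pCons 0 y) = y + [:m * coeff y 0 - lin (digit m \<xi>) y:]"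
  by (simp add: theta_lim_def poly_shift_1_pCons[unfolded One_nat_def])

lemma hnn_lim:
  assumes m: "m \<noteq> 0"
  shows "hnn (\<lambda>s. [:s:]) (rho_lim m \<xi>) (theta_lim m \<xi>)"
proof
  let ?l = "lin (digit m \<xi>)"
  fix e and x y :: "int poly"
  have F: "rho_lim m \<xi> False z = 0 \<longleftrightarrow> m dvd ?l z" for z by (simp add: rho_lim_def mod_eq_0_iff_dvd)
  have T: "rho_lim m \<xi> True z = coeff z 0" for z by (simp add: rho_lim_def)
  show "rho_lim m \<xi> e 0 = 0" by (simp add: rho_lim_def)
  show "rho_lim m \<xi> e (x + y) = rho_lim m \<xi> e y" if "rho_lim m \<xi> e x = 0"
    using that by (cases e) (auto simp: rho_lim_def lin_add mod_eq_0_iff_dvd)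
  show "rho_lim m \<xi> e (x - [:rho_lim m \<xi> e x:]) = 0"
  proof (cases e)
    case False
    then have e: "e = False" by simp
    show ?thesis unfolding e F by (simp add: rho_lim_def lin_diff dvd_minus_mod)
  qed (simp add: rho_lim_def)
  show "theta_lim m \<xi> e (x + y) = theta_lim m \<xi> e x + theta_lim m \<xi> e y"
    if "rho_lim m \<xi> e x = 0" "rho_lim m \<xi> e y = 0"
  proof (cases e)
    case True
    then show ?thesis
      by (simp add: theta_lim_def poly_shift_1_add[unfolded One_nat_def] lin_add algebra_simps)
  next
    case False
    then have "m dvd ?l x" using that F by simp
    then have "(?l x + ?l y) div m = ?l x div m + ?l y div m" by (rule div_plus_div_distrib_dvd_left)
    then show ?thesis using False by (simp add: theta_lim_def lin_add algebra_simps)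
  qed
  show "rho_lim m \<xi> (\<not> e) (theta_lim m \<xi> e x) = 0" if "rho_lim m \<xi> e x = 0"
  proof (cases e)
    case True
    then show ?thesis by (simp add: rho_lim_def theta_lim_def lin_add)
  qed (simp add: rho_lim_def theta_lim_def)
  show "theta_lim m \<xi> (\<not> e) (theta_lim m \<xi> e x) = x" if r: "rho_lim m \<xi> e x = 0"
  proof (cases e)
    case True
    then have "coeff x 0 = 0" using r by (simp add: rho_lim_def)
    then obtain z where z: "x = pCons 0 z" using pCons_poly_shift_1 by metis
    let ?u = "z + [:m * coeff z 0 - ?l z:]"
    have u: "?l ?u = m * coeff z 0" "coeff ?u 0 = coeff z 0 + (m * coeff z 0 - ?l z)"
      by (simp_all add: lin_add)
    have "theta_lim m \<xi> False ?u = pCons 0 (?u + [:?l ?u div m - coeff ?u 0:])"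
      by (simp only: theta_lim_def if_False)
    also have "\<dots> = x" unfolding u z using m by simp
    finally show ?thesis using True by (simp add: z theta_lim_True_pCons)
  next
    case False
    then have d: "m dvd ?l x" using r F by simp
    let ?y = "x + [:?l x div m - coeff x 0:]"
    have "theta_lim m \<xi> True (pCons 0 ?y) = ?y + [:m * coeff ?y 0 - ?l ?y:]"
      by (rule theta_lim_True_pCons)
    also have "\<dots> = x" using d by (simp add: lin_add)
    finally show ?thesis using False by (simp add: theta_lim_def[of m \<xi> False])
  qed
qed simp

text \<open>Each division by \<open>m\<close> costs one power of \<open>m\<close> of
  precision.\<close>

lemma bs_exp_cong:
  assumes m: "m \<noteq> 0"
  shows "m ^ (k + i) dvd q - q' \<Longrightarrow> m ^ k dvd bs_exp m q (Suc i) - bs_exp m q' (Suc i)"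
proof (induction i arbitrary: k)
  case 0
  then show ?case by simp
next
  case (Suc i)
  let ?a = "bs_exp m q (Suc i)" and ?b = "bs_exp m q' (Suc i)"
  have "m ^ Suc k dvd ?a - ?b" using Suc.IH[of "Suc k"] Suc.prems by simp
  then obtain c where c: "?a - ?b = m ^ Suc k * c" by (elim dvdE)
  then have "?a = ?b + m * (m ^ k * c)" by (simp add: algebra_simps)
  then have A: "?a div m - ?b div m = m ^ k * c" using m by simp
  obtain d where d: "q - q' = m ^ k * d"
    using Suc.prems by (metis dvd_def dvd_trans le_add1 le_imp_power_dvd)
  have alg: "q * u - q' * v = q * (u - v) + (q - q') * v" for u v by (simp add: algebra_simps)
  have "m ^ k dvd q * (?a div m) - q' * (?b div m)"
    unfolding alg A d by (intro dvd_add) (simp_all only: dvd_triv_left dvd_mult dvd_mult2)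
  then show ?case by simp
qed

text \<open>The homomorphism from the base of the limit group to the base of \<open>BS(m, q)\<close>; it respects the HNN
  data on polynomials of bounded degree when \<open>q\<close> is large and close to \<open>\<xi>\<close>.\<close>
definition ev :: "int \<Rightarrow> int \<Rightarrow> int poly \<Rightarrow> int" where
  "ev m q = lin (bs_exp m q)"

text \<open>Both sides are reduced because \<open>digit m \<xi> 0\<close> is 1, which is not its own
  residue when \<open>m\<close> is negative.\<close>

definition agree :: "int \<Rightarrow> (nat \<Rightarrow> int) \<Rightarrow> int \<Rightarrow> nat \<Rightarrow> bool" where
  "agree m \<xi> q n \<longleftrightarrow> (\<forall>i\<le>n. bs_exp m q i mod m = digit m \<xi> i mod m)"

lemma agreeD: "agree m \<xi> q n \<Longrightarrow> 1 \<le> i \<Longrightarrow> i \<le> n \<Longrightarrow> bs_exp m q i mod m = digit m \<xi> i"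
  by (auto simp: agree_def digit_def)

lemma ev_add: "ev m q (x + y) = ev m q x + ev m q y"
  and ev_diff: "ev m q (x - y) = ev m q x - ev m q y"
  and ev_const [simp]: "ev m q [:s:] = s"
  and ev_zero [simp]: "ev m q 0 = 0"
  by (simp_all add: ev_def lin_add lin_diff)

lemma ev_mod_m:
  assumes "agree m \<xi> q (degree x)"
  shows "ev m q x mod m = lin (digit m \<xi>) x mod m"
proof -
  have "ev m q x mod m = (\<Sum>i\<le>degree x. (bs_exp m q i * coeff x i) mod m) mod m"
    unfolding ev_def lin_def by (rule mod_sum_eq[symmetric])
  also have "\<dots> = (\<Sum>i\<le>degree x. (digit m \<xi> i * coeff x i) mod m) mod m"
  proof -
    have "(bs_exp m q i * coeff x i) mod m = (digit m \<xi> i * coeff x i) mod m" if "i \<le> degree x" for i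
      by (rule mod_mult_cong) (use assms that in \<open>auto simp: agree_def\<close>)
    then show ?thesis by simp
  qed
  also have "\<dots> = lin (digit m \<xi>) x mod m" unfolding lin_def by (rule mod_sum_eq)
  finally show ?thesis .
qed

lemma dvd_bs_exp: "q dvd bs_exp m q (Suc i)"
  by simp

lemma ev_mod_q: "\<exists>k. ev m q x = coeff x 0 + q * k"
proof -
  obtain a y where x: "x = pCons a y" by (cases x)
  have "q dvd lin (\<lambda>i. bs_exp m q (Suc i)) y"
    unfolding lin_def using dvd_bs_exp by (intro dvd_sum dvd_mult2) blast
  then obtain k where "lin (\<lambda>i. bs_exp m q (Suc i)) y = q * k" by (elim dvdE)
  then show ?thesis by (simp add: x ev_def lin_pCons)
qed

text \<open>Multiplication by \<open>m\<close> removes the floor division from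
  \<open>bs_exp\<close>: \<open>m\<close> times the exponent of e_(i+1) is \<open>q\<close> times
  the exponent of e_i minus its digit. At i = 0 the extra \<open>m\<close> compensates for the
  exceptional value \<open>q\<close>.\<close>

lemma m_mult_ev_pCons:
  assumes ag: "agree m \<xi> q (degree y)"
  shows "m * ev m q (pCons 0 y) = q * (m * coeff y 0 + ev m q y - lin (digit m \<xi>) y)"
proof -
  have t: "m * bs_exp m q (Suc i) = q * ((if i = 0 then m else 0) + bs_exp m q i - digit m \<xi> i)"
    if "i \<le> degree y" for i
  proof (cases "i = 0")
    case False
    then have "digit m \<xi> i = bs_exp m q i mod m" using agreeD[OF ag, of i] that by simp
    then show ?thesis using False minus_mod_eq_mult_div[of "bs_exp m q i" m] by (simp add: mult.left_commute)
  qed simp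
  have "m * ev m q (pCons 0 y) = (\<Sum>i\<le>degree y. m * bs_exp m q (Suc i) * coeff y i)"
    by (simp only: ev_def lin_pCons) (simp add: lin_def sum_distrib_left mult.assoc)
  also have "\<dots> = (\<Sum>i\<le>degree y. q * ((if i = 0 then m * coeff y 0 else 0)
      + bs_exp m q i * coeff y i - digit m \<xi> i * coeff y i))"
  proof (intro sum.cong refl)
    fix i assume "i \<in> {..degree y}"
    then have "m * bs_exp m q (Suc i) * coeff y i
        = q * ((if i = 0 then m else 0) + bs_exp m q i - digit m \<xi> i) * coeff y i" by (simp only: t atMost_iff)
    also have "\<dots> = q * ((if i = 0 then m * coeff y 0 else 0) + bs_exp m q i * coeff y i - digit m \<xi> i * coeff y i)"
      by (cases "i = 0") (simp_all add: algebra_simps)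
    finally show "m * bs_exp m q (Suc i) * coeff y i = q * ((if i = 0 then m * coeff y 0 else 0)
      + bs_exp m q i * coeff y i - digit m \<xi> i * coeff y i)" .
  qed
  also have "\<dots> = q * (m * coeff y 0 + ev m q y - lin (digit m \<xi>) y)"
    by (simp add: ev_def lin_def sum.distrib sum_subtractf sum.delta flip: sum_distrib_left)
  finally show ?thesis .
qed

lemma ev_theta_True:
  assumes ag: "agree m \<xi> q (degree x)" and q: "q \<noteq> 0" and x: "coeff x 0 = 0"
  shows "ev m q (theta_lim m \<xi> True x) = theta_int m q True (ev m q x)"
proof -
  obtain y where y: "x = pCons 0 y" using pCons_poly_shift_1[OF x] by metis
  have "degree y \<le> degree x" by (simp add: y degree_pCons_eq_if)
  then have ag': "agree m \<xi> q (degree y)" using ag by (auto simp: agree_def)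
  obtain k where k: "ev m q x = q * k" using ev_mod_q[of m q x] x by auto
  have "q * (m * k) = q * (m * coeff y 0 + ev m q y - lin (digit m \<xi>) y)"
    using m_mult_ev_pCons[OF ag'] k by (simp add: y mult.left_commute)
  then have "m * k = m * coeff y 0 + ev m q y - lin (digit m \<xi>) y" using q by simp
  then show ?thesis using q by (simp add: y theta_lim_True_pCons ev_add theta_int_def k[unfolded y] mult.commute)
qed

lemma ev_theta_False:
  assumes ag: "agree m \<xi> q (degree x)" and m: "m \<noteq> 0" and x: "m dvd lin (digit m \<xi>) x"
  shows "ev m q (theta_lim m \<xi> False x) = theta_int m q False (ev m q x)"
proof -
  let ?l = "lin (digit m \<xi>)"
  let ?y = "x + [:?l x div m - coeff x 0:]"
  have "degree ?y \<le> degree x" by (rule degree_add_le) auto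
  then have ag': "agree m \<xi> q (degree ?y)" using ag by (auto simp: agree_def)
  have "m * ev m q (pCons 0 ?y) = q * (m * (?l x div m) + ev m q x - ?l x)"
    unfolding m_mult_ev_pCons[OF ag'] by (simp add: ev_add lin_add)
  also have "\<dots> = q * ev m q x" using x by simp
  finally have *: "m * ev m q (pCons 0 ?y) = q * ev m q x" .
  have "m dvd ev m q x" using ev_mod_m[OF ag] x by (metis dvd_imp_mod_0 mod_0_imp_dvd)
  then obtain k where k: "ev m q x = m * k" by (elim dvdE)
  then have "ev m q (pCons 0 ?y) = q * k" using * m by (simp add: mult.left_commute)
  then show ?thesis using m by (simp add: theta_lim_def theta_int_def k mult.commute)
qed

section \<open>Convergence of Baumslag-Solitar groups\<close>

locale bs_limit =
  fixes m :: int and \<xi> :: "nat \<Rightarrow> int"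
  assumes m: "\<bar>m\<bar> > 1" and \<xi>: "\<xi> \<in> madic m"
begin

lemma m0: "m \<noteq> 0" using m by auto

sublocale hnn "\<lambda>s. [:s:]" "rho_lim m \<xi>" "theta_lim m \<xi>"
  by (rule hnn_lim[OF m0])

definition approximates :: "(nat \<Rightarrow> int) \<Rightarrow> bool" where
  "approximates xs \<longleftrightarrow> filterlim (\<lambda>n. \<bar>xs n\<bar>) at_top sequentially \<and> madic_converges m xs \<xi>"

abbreviation "int_wact q \<equiv> letter_action.wact (hnn.lact (\<lambda>s. s) (rho_int m q) (theta_int m q))"

definition evf :: "int \<Rightarrow> (int \<times> bool) list \<times> int poly \<Rightarrow> (int \<times> bool) list \<times> int" where
  "evf q \<omega> = (fst \<omega>, ev m q (snd \<omega>))"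

lemma madic_mod: "k \<le> n \<Longrightarrow> \<xi> n mod \<bar>m\<bar> ^ k = \<xi> k"
proof (induction n rule: dec_induct)
  case base
  then show ?case using \<xi> by (simp add: madic_def)
next
  case (step n)
  have "\<xi> (Suc n) mod \<bar>m\<bar> ^ k = \<xi> (Suc n) mod \<bar>m\<bar> ^ n mod \<bar>m\<bar> ^ k"
    using step.hyps by (simp add: mod_mod_cancel le_imp_power_dvd)
  then show ?case using \<xi> step.IH by (simp add: madic_def)
qed

lemma approximates_exists: "\<exists>xs. approximates xs"
proof
  \<comment> \<open>The added power does not affect the lower residues and forces divergence even
    when the residues \<open>\<xi> n\<close> stay bounded.\<close>
  let ?xs = "\<lambda>n. \<xi> n + \<bar>m\<bar> ^ n"
  have "eventually (\<lambda>n. ?xs n mod \<bar>m\<bar> ^ k = \<xi> k) sequentially" for k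
    using eventually_ge_at_top[of k]
  proof eventually_elim
    case (elim n)
    then have "\<bar>m\<bar> ^ k dvd \<bar>m\<bar> ^ n" by (rule le_imp_power_dvd)
    then have "?xs n mod \<bar>m\<bar> ^ k = \<xi> n mod \<bar>m\<bar> ^ k" by (simp add: mod_eq_dvd_iff)
    then show ?case using madic_mod[OF elim] by simp
  qed
  moreover have "filterlim (\<lambda>n. \<bar>?xs n\<bar>) at_top sequentially"
  proof (rule filterlim_at_top_mono[OF filterlim_int_sequentially], rule always_eventually, rule allI)
    fix n
    have "int n < 2 ^ n" using of_nat_less_two_power by auto
    also have "(2::int) ^ n \<le> \<bar>m\<bar> ^ n" using m by (intro power_mono) auto
    also have "\<dots> \<le> \<bar>?xs n\<bar>" using \<xi> by (simp add: madic_def)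
    finally show "int n \<le> \<bar>?xs n\<bar>" by simp
  qed
  ultimately show "approximates ?xs" by (simp add: approximates_def madic_converges_def)
qed

text \<open>Supplies the termination measure wherever a nonzero base element is pushed past letters
  with sign \<open>True\<close>.\<close>

lemma theta_True_decreases:
  assumes "coeff x 0 = 0" "x \<noteq> 0"
  shows "degree (theta_lim m \<xi> True x) < degree x" "theta_lim m \<xi> True x \<noteq> 0"
proof -
  obtain z where z: "x = pCons 0 z" using pCons_poly_shift_1[OF assms(1)] by metis
  have "degree (theta_lim m \<xi> True x) \<le> degree z"
    unfolding z theta_lim_True_pCons by (rule degree_add_le) auto
  moreover have "degree z < degree x" using assms(2) z by (auto simp: degree_pCons_eq_if)
  ultimately show "degree (theta_lim m \<xi> True x) < degree x" by simp
  have "rho_lim m \<xi> True x = 0" using assms(1) by (simp add: rho_lim_def)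
  from theta_theta[OF this] show "theta_lim m \<xi> True x \<noteq> 0" using assms(2) theta_zero by auto
qed

section \<open>Eventual agreement of the two actions along an approximating sequence\<close>

context
  fixes xs assumes xs: "approximates xs"
begin

lemma eventually_large: "\<forall>\<^sub>F n in sequentially. C < \<bar>xs n\<bar>"
proof -
  have "\<forall>\<^sub>F n in sequentially. C + 1 \<le> \<bar>xs n\<bar>"
    using xs by (auto simp: approximates_def filterlim_at_top)
  then show ?thesis by eventually_elim simp
qed

lemma eventually_nonzero: "\<forall>\<^sub>F n in sequentially. xs n \<noteq> 0"
  using eventually_large[of 0] by eventually_elim auto

lemma eventually_agree: "\<forall>\<^sub>F n in sequentially. agree m \<xi> (xs n) N"
proof -
  have *: "\<forall>\<^sub>F n in sequentially. bs_exp m (xs n) i mod m = digit m \<xi> i mod m" for i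
  proof (cases i)
    case (Suc j)
    have "\<forall>\<^sub>F n in sequentially. xs n mod \<bar>m\<bar> ^ i = \<xi> i"
      using xs by (auto simp: approximates_def madic_converges_def)
    then show ?thesis
    proof eventually_elim
      case (elim n)
      have "\<bar>m\<bar> ^ i dvd xs n - \<xi> i" using dvd_minus_mod[of "\<bar>m\<bar> ^ i" "xs n"] elim by simp
      then have "m ^ (1 + j) dvd xs n - \<xi> i" by (simp add: Suc flip: power_abs power_Suc)
      from bs_exp_cong[OF m0 this] have "m dvd bs_exp m (xs n) i - bs_exp m (\<xi> i) i"
        unfolding Suc by (simp only: power_one_right)
      then have "bs_exp m (xs n) i mod m = bs_exp m (\<xi> i) i mod m" by (simp add: mod_eq_dvd_iff)
      then show ?case by (simp add: digit_def Suc)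
    qed
  qed simp
  have "\<forall>\<^sub>F n in sequentially. \<forall>i\<in>{..N}. bs_exp m (xs n) i mod m = digit m \<xi> i mod m"
    by (rule eventually_ball_finite) (use * in auto)
  then show ?thesis by (simp add: agree_def Ball_def)
qed

lemma eventually_rho: "\<forall>\<^sub>F n in sequentially. rho_int m (xs n) e (ev m (xs n) x) = rho_lim m \<xi> e x"
proof (cases e)
  case True
  show ?thesis using eventually_large[of "2 * \<bar>coeff x 0\<bar>"]
  proof eventually_elim
    case (elim n)
    obtain k where "ev m (xs n) x = coeff x 0 + xs n * k" using ev_mod_q by blast
    then show ?case using rho_int_True_small[OF elim] True by (simp add: rho_lim_def)
  qed
next
  case False
  show ?thesis using eventually_agree[of "degree x"]
    by eventually_elim (use False in \<open>simp add: rho_int_def rho_lim_def ev_mod_m\<close>)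
qed

lemma eventually_theta:
  assumes "rho_lim m \<xi> e x = 0"
  shows "\<forall>\<^sub>F n in sequentially. theta_int m (xs n) e (ev m (xs n) x) = ev m (xs n) (theta_lim m \<xi> e x)"
proof (cases e)
  case True
  then have x: "coeff x 0 = 0" using assms by (simp add: rho_lim_def)
  show ?thesis using eventually_agree[of "degree x"] eventually_nonzero
    by eventually_elim (use True ev_theta_True[OF _ _ x] in simp)
next
  case False
  then have x: "m dvd lin (digit m \<xi>) x" using assms by (simp add: rho_lim_def mod_eq_0_iff_dvd)
  show ?thesis using eventually_agree[of "degree x"]
    by eventually_elim (use False ev_theta_False[OF _ m0 x] in simp)
qed

lemma eventually_nxt:
  "\<forall>\<^sub>F n in sequentially. hnn.nxt (\<lambda>s. s) (rho_int m (xs n)) (theta_int m (xs n)) c (ev m (xs n) x)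
    = ev m (xs n) (nxt c x)"
proof -
  let ?z = "x + [:fst c:]"
  let ?r = "rho_lim m \<xi> (snd c) ?z"
  show ?thesis
    using eventually_nonzero eventually_rho[of "snd c" ?z]
      eventually_theta[of "snd c" "?z - [:?r:]", OF rho_rep[of "snd c" ?z]]
  proof eventually_elim
    case (elim n)
    interpret I: hnn "\<lambda>s. s" "rho_int m (xs n)" "theta_int m (xs n)" by (rule hnn_int[OF m0 elim(1)])
    show ?case using elim(2,3) by (simp add: I.nxt_def nxt_def ev_add ev_diff)
  qed
qed

lemma eventually_shift_carry:
  "\<forall>\<^sub>F n in sequentially.
    hnn.shift (\<lambda>s. s) (rho_int m (xs n)) (theta_int m (xs n)) l (ev m (xs n) x) = shift l x \<and>
    hnn.carry (\<lambda>s. s) (rho_int m (xs n)) (theta_int m (xs n)) l (ev m (xs n) x) = ev m (xs n) (carry l x)"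
proof (induction l arbitrary: x)
  case Nil
  show ?case using eventually_nonzero
  proof eventually_elim
    case (elim n)
    interpret I: hnn "\<lambda>s. s" "rho_int m (xs n)" "theta_int m (xs n)" by (rule hnn_int[OF m0 elim])
    show ?case by simp
  qed
next
  case (Cons c l)
  show ?case using eventually_nonzero eventually_nxt[of c x] eventually_rho[of "snd c" "x + [:fst c:]"]
      Cons.IH[of "nxt c x"]
  proof eventually_elim
    case (elim n)
    interpret I: hnn "\<lambda>s. s" "rho_int m (xs n)" "theta_int m (xs n)" by (rule hnn_int[OF m0 elim(1)])
    show ?case using elim(2-) by (simp add: ev_add)
  qed
qed

lemma eventually_valid:
  assumes "valid l"
  shows "\<forall>\<^sub>F n in sequentially. hnn.valid (\<lambda>s. s) (rho_int m (xs n)) l"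
  using assms
proof (induction l)
  case Nil
  show ?case using eventually_nonzero
  proof eventually_elim
    case (elim n)
    interpret I: hnn "\<lambda>s. s" "rho_int m (xs n)" "theta_int m (xs n)" by (rule hnn_int[OF m0 elim])
    show ?case by simp
  qed
next
  case (Cons c l)
  then have "\<forall>\<^sub>F n in sequentially. hnn.valid (\<lambda>s. s) (rho_int m (xs n)) l" by simp
  then show ?case using eventually_nonzero eventually_rho[of "snd c" "[:fst c:]"]
  proof eventually_elim
    case (elim n)
    interpret I: hnn "\<lambda>s. s" "rho_int m (xs n)" "theta_int m (xs n)" by (rule hnn_int[OF m0 elim(2)])
    show ?case using elim(1,3) Cons.prems by simp
  qed
qed

lemma eventually_lact:
  "\<forall>\<^sub>F n in sequentially. hnn.lact (\<lambda>s. s) (rho_int m (xs n)) (theta_int m (xs n)) g (evf (xs n) \<omega>)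
    = evf (xs n) (lact g \<omega>)"
  using eventually_nonzero eventually_shift_carry[of "fst \<omega>" "[:if snd g then - 1 else 1:]"]
proof eventually_elim
  case (elim n)
  interpret I: hnn "\<lambda>s. s" "rho_int m (xs n)" "theta_int m (xs n)" by (rule hnn_int[OF m0 elim(1)])
  show ?case using elim(2) unfolding ev_const
    by (simp add: I.lact_def lact_def I.bact_def bact_def evf_def ev_add)
qed

lemma eventually_wact: "\<forall>\<^sub>F n in sequentially. int_wact (xs n) w (evf (xs n) \<omega>) = evf (xs n) (wact w \<omega>)"
proof (induction w)
  case Nil
  show ?case using eventually_nonzero
  proof eventually_elim
    case (elim n)
    interpret I: hnn "\<lambda>s. s" "rho_int m (xs n)" "theta_int m (xs n)" by (rule hnn_int[OF m0 elim])
    show ?case by simp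
  qed
next
  case (Cons g w)
  then show ?case using eventually_nonzero eventually_lact[of g "wact w \<omega>"]
  proof eventually_elim
    case (elim n)
    interpret I: hnn "\<lambda>s. s" "rho_int m (xs n)" "theta_int m (xs n)" by (rule hnn_int[OF m0 elim(2)])
    show ?case using elim(1,3) by simp
  qed
qed

text \<open>Independence of the e_i in the limit. A nonzero coefficient of e_0 survives modulo a
  large \<open>q\<close>; if it vanishes, \<open>\<theta>\<close> lowers the degree, and a nonzero
  image under \<open>theta_int\<close> comes from a nonzero integer.\<close>

lemma eventually_ev_nonzero: "x \<noteq> 0 \<Longrightarrow> \<forall>\<^sub>F n in sequentially. ev m (xs n) x \<noteq> 0"
proof (induction "degree x" arbitrary: x rule: less_induct)
  case less
  show ?case
  proof (cases "coeff x 0 = 0")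
    case False
    show ?thesis using eventually_large[of "\<bar>coeff x 0\<bar>"]
    proof eventually_elim
      case (elim n)
      obtain k where k: "ev m (xs n) x = coeff x 0 + xs n * k" using ev_mod_q by blast
      show ?case
      proof
        assume "ev m (xs n) x = 0"
        then have "coeff x 0 = xs n * (- k)" using k by simp
        then have "xs n dvd coeff x 0" by (rule dvdI)
        then show False using dvd_imp_le_int[OF False, of "xs n"] elim by linarith
      qed
    qed
  next
    case True
    have r: "rho_lim m \<xi> True x = 0" using True by (simp add: rho_lim_def)
    have "\<forall>\<^sub>F n in sequentially. ev m (xs n) (theta_lim m \<xi> True x) \<noteq> 0"
      using less.hyps theta_True_decreases[OF True less.prems] by blast
    then show ?thesis using eventually_theta[OF r]
      by eventually_elim (auto simp: theta_int_def)
  qed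
qed

lemma eventually_evf_neq:
  assumes "\<omega> \<noteq> \<omega>'"
  shows "\<forall>\<^sub>F n in sequentially. evf (xs n) \<omega> \<noteq> evf (xs n) \<omega>'"
proof (cases "fst \<omega> = fst \<omega>'")
  case True
  then have "snd \<omega> - snd \<omega>' \<noteq> 0" using assms by (auto simp: prod_eq_iff)
  from eventually_ev_nonzero[OF this] show ?thesis
    by eventually_elim (auto simp: evf_def ev_diff)
qed (simp add: evf_def)

lemma eventually_BS_ker_of_fixed:
  assumes "w \<in> carrier F2" "wact w \<omega> = \<omega>"
  shows "\<forall>\<^sub>F n in sequentially. w \<in> BS_ker m (xs n)"
  using eventually_nonzero eventually_wact[of w \<omega>]
  by eventually_elim (use assms BS_ker_of_fixed[OF m0] in simp)

lemma eventually_not_BS_ker_of_moved: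
  assumes "\<omega> \<in> nforms" "wact w \<omega> \<noteq> \<omega>"
  shows "\<forall>\<^sub>F n in sequentially. w \<notin> BS_ker m (xs n)"
proof -
  have "valid (fst \<omega>)" using assms(1) by (simp add: nforms_def)
  from eventually_valid[OF this] show ?thesis
    using eventually_nonzero eventually_wact[of w \<omega>] eventually_evf_neq[OF assms(2)]
  proof eventually_elim
    case (elim n)
    then show ?case using BS_ker_fixes[OF m0 elim(2), of w "evf (xs n) \<omega>"] by (auto simp: evf_def)
  qed
qed

lemma eventually_BS_ker_iff:
  assumes "w \<in> carrier F2"
  shows "\<forall>\<^sub>F n in sequentially. w \<in> BS_ker m (xs n) \<longleftrightarrow> w \<in> act_ker"
proof (cases "w \<in> act_ker")
  case True
  have "([], 0) \<in> nforms" by (simp add: nforms_def)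
  then have "wact w ([], 0) = ([], 0)" using True unfolding act_ker_def by blast
  from eventually_BS_ker_of_fixed[OF assms this] show ?thesis
    by eventually_elim (use True in simp)
next
  case False
  then obtain \<omega> where "\<omega> \<in> nforms" "wact w \<omega> \<noteq> \<omega>" using assms by (auto simp: act_ker_def)
  from eventually_not_BS_ker_of_moved[OF this] show ?thesis
    by eventually_elim (use False in simp)
qed

end

text \<open>Freeness is imported from the approximating groups: a word fixing one normal form lies
  in \<open>BS_ker\<close> for all large indices, and this eventually means membership in
  \<open>act_ker\<close>.\<close>

lemma act_free:
  assumes "w \<in> carrier F2" "wact w \<omega> = \<omega>"
  shows "w \<in> act_ker"
proof -
  obtain xs where xs: "approximates xs" using approximates_exists by blast
  have "\<forall>\<^sub>F n in sequentially. w \<in> act_ker"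
    using eventually_BS_ker_of_fixed[OF xs assms] eventually_BS_ker_iff[OF xs assms(1)]
    by eventually_elim simp
  then show ?thesis by simp
qed

end

section \<open>Convergence in the space of marked groups\<close>

lemma BS_ker_subset: "BS_ker p q \<subseteq> carrier F2"
proof -
  have "carrier F2 \<lhd> F2"
    using F2.normal_inv_iff F2.subgroup_self by simp
  moreover have "bs_relator p q \<in> carrier F2" by (simp add: bs_relator_def carrier_F2)
  ultimately show ?thesis unfolding BS_ker_def by blast
qed

lemma dG2_less_iff:
  "dG2 N1 N2 < exp (- real l) \<longleftrightarrow> (\<forall>w. length w \<le> l \<longrightarrow> (w \<in> N1 \<longleftrightarrow> w \<in> N2))"
proof (cases "N1 = N2")
  case True
  then show ?thesis by (simp add: dG2_def)
next
  case False
  let ?P = "\<lambda>l. \<exists>w \<in> (N1 - N2) \<union> (N2 - N1). length w = l"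
  have ex: "\<exists>k. ?P k" using False by blast
  have "dG2 N1 N2 < exp (- real l) \<longleftrightarrow> l < (LEAST k. ?P k)" using False by (simp add: dG2_def)
  also have "\<dots> \<longleftrightarrow> (\<forall>k\<le>l. \<not> ?P k)"
    using LeastI_ex[OF ex] Least_le[of ?P] not_less_Least[of _ ?P]
    by (metis (no_types, lifting) leD le_less_linear order_trans)
  also have "\<dots> \<longleftrightarrow> (\<forall>w. length w \<le> l \<longrightarrow> (w \<in> N1 \<longleftrightarrow> w \<in> N2))" by blast
  finally show ?thesis .
qed

text \<open>There are finitely many words of bounded length, so agreement on each word is eventually
  agreement on a whole ball.\<close>

lemma G2_converges_iff:
  assumes "N \<lhd> F2" "\<And>n. Ns n \<subseteq> carrier F2"
  shows "G2_converges Ns N \<longleftrightarrow> (\<forall>w\<in>carrier F2. \<forall>\<^sub>F n in sequentially. w \<in> Ns n \<longleftrightarrow> w \<in> N)"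
proof
  assume "G2_converges Ns N"
  then have lim: "(\<lambda>n. dG2 (Ns n) N) \<longlonglongrightarrow> 0" by (simp add: G2_converges_def)
  show "\<forall>w\<in>carrier F2. \<forall>\<^sub>F n in sequentially. w \<in> Ns n \<longleftrightarrow> w \<in> N"
  proof
    fix w :: "letter list"
    have "\<forall>\<^sub>F n in sequentially. dG2 (Ns n) N < exp (- real (length w))"
      using order_tendstoD(2)[OF lim] by simp
    then show "\<forall>\<^sub>F n in sequentially. w \<in> Ns n \<longleftrightarrow> w \<in> N"
      by eventually_elim (use dG2_less_iff in blast)
  qed
next
  assume ev: "\<forall>w\<in>carrier F2. \<forall>\<^sub>F n in sequentially. w \<in> Ns n \<longleftrightarrow> w \<in> N"
  have NF: "N \<subseteq> carrier F2" using assms(1) normal_imp_subgroup subgroup.subset by blast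
  have ev': "\<forall>\<^sub>F n in sequentially. w \<in> Ns n \<longleftrightarrow> w \<in> N" for w
  proof (cases "w \<in> carrier F2")
    case False
    then have "w \<notin> N" "\<And>n. w \<notin> Ns n" using assms(2) NF by blast+
    then show ?thesis by simp
  qed (use ev in blast)
  have "\<forall>\<^sub>F n in sequentially. dG2 (Ns n) N < exp (- real l)" for l
  proof -
    have "finite {w :: letter list. set w \<subseteq> UNIV \<and> length w \<le> l}"
      by (rule finite_lists_length_le) simp
    then have "\<forall>\<^sub>F n in sequentially. \<forall>w\<in>{w. set w \<subseteq> UNIV \<and> length w \<le> l}. w \<in> Ns n \<longleftrightarrow> w \<in> N"
      by (rule eventually_ball_finite) (use ev' in blast)
    then show ?thesis by eventually_elim (use dG2_less_iff in auto)
  qed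
  note small = this
  have "(\<lambda>n. dG2 (Ns n) N) \<longlonglongrightarrow> 0"
  proof (rule order_tendstoI)
    fix a :: real assume "a < 0"
    then show "\<forall>\<^sub>F n in sequentially. a < dG2 (Ns n) N"
      by (intro always_eventually) (auto simp: dG2_def intro: less_trans)
  next
    fix a :: real assume "0 < a"
    obtain l :: nat where "- ln a < real l" using reals_Archimedean2 by blast
    then have "exp (- real l) < a" using \<open>0 < a\<close> by (metis exp_less_mono exp_ln minus_less_iff)
    then show "\<forall>\<^sub>F n in sequentially. dG2 (Ns n) N < a"
      using small[of l] by (auto elim: eventually_mono)
  qed
  then show "G2_converges Ns N" using assms(1) by (simp add: G2_converges_def)
qed

lemma (in bs_limit) BSbar_eq: "BSbar m \<xi> = act_ker"
  unfolding BSbar_def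
proof (rule the_equality)
  note iff = G2_converges_iff[OF _ BS_ker_subset]
  show "\<forall>xs. filterlim (\<lambda>n. \<bar>xs n\<bar>) at_top sequentially \<and> madic_converges m xs \<xi>
      \<longrightarrow> G2_converges (\<lambda>n. BS_ker m (xs n)) act_ker"
    unfolding iff[OF normal_act_ker] using eventually_BS_ker_iff unfolding approximates_def by blast
  fix N assume N: "\<forall>xs. filterlim (\<lambda>n. \<bar>xs n\<bar>) at_top sequentially \<and> madic_converges m xs \<xi>
      \<longrightarrow> G2_converges (\<lambda>n. BS_ker m (xs n)) N"
  obtain xs where xs: "approximates xs" using approximates_exists by blast
  then have c: "G2_converges (\<lambda>n. BS_ker m (xs n)) N" using N by (simp add: approximates_def)
  then have nN: "N \<lhd> F2" by (simp add: G2_converges_def)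
  have "w \<in> N \<longleftrightarrow> w \<in> act_ker" if w: "w \<in> carrier F2" for w
  proof -
    have "\<forall>\<^sub>F n in sequentially. w \<in> BS_ker m (xs n) \<longleftrightarrow> w \<in> N" 
      using c w unfolding iff[OF nN] by blast
    then have "\<forall>\<^sub>F n in sequentially. w \<in> N \<longleftrightarrow> w \<in> act_ker"
      using eventually_BS_ker_iff[OF xs w] by eventually_elim simp
    then show ?thesis by simp
  qed
  moreover have "N \<subseteq> carrier F2" "act_ker \<subseteq> carrier F2"
    using nN normal_act_ker normal_imp_subgroup subgroup.subset by blast+
  ultimately show "N = act_ker" by blast
qed

section \<open>The action on cylinders of normal forms\<close>

context hnn
begin

definition cyl :: "(int \<times> bool) list \<Rightarrow> ((int \<times> bool) list \<times> 'e) set" where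
  "cyl p = {\<omega> \<in> nforms. \<exists>l. fst \<omega> = p @ l}"

lemma Pair_in_cyl: "valid p \<Longrightarrow> (p, t) \<in> cyl p"
  by (simp add: cyl_def nforms_def)

lemma cyl_append: "cyl (p @ r) \<subseteq> cyl p"
  by (auto simp: cyl_def)

lemma cyl_meet:
  assumes "\<omega> \<in> cyl p" "\<omega> \<in> cyl q"
  shows "(\<exists>r. p = q @ r) \<or> (\<exists>r. q = p @ r)"
  using assms by (auto simp: cyl_def append_eq_append_conv2)

lemma stab_append: "q \<noteq> [] \<Longrightarrow> stab e (q @ l) = stab e q @ l"
  by (cases q) (auto simp: stab_def)

text \<open>A word shorter than \<open>p\<close> acts on the part of a normal form behind the prefix \<open>p\<close> only through
  an element of the base.\<close>
lemma wact_long_prefix: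
  assumes "length w < length p"
  shows "\<exists>q x. length p - length w \<le> length q \<and>
    (\<forall>l t. valid (p @ l) \<longrightarrow> wact w (p @ l, t) = (q @ shift l x, carry l x + t))"
  using assms
proof (induction w)
  case Nil
  have "wact [] (p @ l, t) = (p @ shift l 0, carry l 0 + t)" if "valid (p @ l)" for l t
    using valid_appendD[OF that] by (simp add: shift_zero carry_zero)
  then show ?case by (intro exI[of _ p] exI[of _ 0]) auto
next
  case (Cons g w)
  then obtain q x where q: "length p - length w \<le> length q"
    "\<And>l t. valid (p @ l) \<Longrightarrow> wact w (p @ l, t) = (q @ shift l x, carry l x + t)" by auto
  show ?case
  proof (cases "fst g")
    case True
    define y where "y = \<iota> (if snd g then - 1 else 1)"
    have "wact (g # w) (p @ l, t) = (shift q y @ shift l (carry q y + x), carry l (carry q y + x) + t)"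
      if "valid (p @ l)" for l t
      using True q(2)[OF that]
      by (simp add: lact_def bact_def y_def shift_append carry_append shift_add carry_add add.assoc)
    then show ?thesis using q(1) by (intro exI[of _ "shift q y"] exI[of _ "carry q y + x"]) auto
  next
    case False
    have "q \<noteq> []" using q(1) Cons.prems by auto
    then have "wact (g # w) (p @ l, t) = (stab (\<not> snd g) q @ shift l x, carry l x + t)"
      if "valid (p @ l)" for l t
      using False q(2)[OF that] by (simp add: lact_def stab_append)
    moreover have "length q - 1 \<le> length (stab (\<not> snd g) q)" by (cases q) (auto simp: stab_def)
    ultimately show ?thesis using q(1) by (intro exI[of _ "stab (\<not> snd g) q"] exI[of _ x]) auto
  qed
qed

abbreviation letter_word :: "int \<times> bool \<Rightarrow> letter list" where
  "letter_word c \<equiv> bpow (fst c) @ [(False, \<not> snd c)]"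

abbreviation letter_word_inv :: "int \<times> bool \<Rightarrow> letter list" where
  "letter_word_inv c \<equiv> [(False, snd c)] @ bpow (- fst c)"

lemma wact_letter_word:
  assumes "\<rho> (snd c) (\<iota> (fst c)) = fst c" "\<not> cancels (snd c) l" "valid l"
  shows "wact (letter_word c) (l, t) = (c # l, t)"
proof -
  have "((0, snd c) # l, t) \<in> nforms" using assms by (simp add: nforms_def rho_zero iota_zero)
  then show ?thesis using assms
    by (simp add: wact_bpow lact_a stab_def) (simp add: bact_def nxt_def iota_zero shift_zero carry_zero)
qed

lemma wact_letter_word_inv_Cons:
  assumes "valid (c # l)"
  shows "wact (letter_word_inv c) (c # l, t) = (l, t)"
proof -
  have i: "\<iota> (- fst c) + \<iota> (fst c) = 0" using iota_add[of "- fst c" "fst c"] by (simp add: iota_zero)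
  have "(c # l, t) \<in> nforms" using assms by (simp add: nforms_def)
  then show ?thesis using assms
    by (simp add: wact_bpow lact_a stab_def bact_def i nxt_def rho_zero iota_zero shift_zero carry_zero)
qed

text \<open>Cancellation would require the leading letter to have the sign of \<open>c\<close> and
  an exponent in the same coset; both being representatives, it would equal
  \<open>c\<close>.\<close>

lemma wact_letter_word_inv_other:
  assumes l: "valid l" "\<nexists>l'. l = c # l'" and c: "\<rho> (snd c) (\<iota> (fst c)) = fst c"
  shows "\<exists>l'. fst (wact (letter_word_inv c) (l, t)) = (0, \<not> snd c) # l'"
proof -
  have w: "(l, t) \<in> nforms" using l by (simp add: nforms_def)
  have "\<not> cancels (\<not> snd c) (shift l (\<iota> (- fst c)))"
  proof (cases l)
    case (Cons d l')
    show ?thesis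
    proof
      assume "cancels (\<not> snd c) (shift l (\<iota> (- fst c)))"
      then have d: "snd d = snd c" and r: "\<rho> (snd c) (\<iota> (- fst c) + \<iota> (fst d)) = 0"
        by (auto simp: Cons)
      have "\<iota> (- fst c) + \<iota> (fst d) + \<iota> (fst c) = \<iota> (fst d)" by (simp flip: iota_add)
      then have "\<rho> (snd c) (\<iota> (fst d)) = \<rho> (snd c) (\<iota> (fst c))" 
        using rho_add[OF r, of "\<iota> (fst c)"] by (simp only:)
      then have "fst d = fst c" using l(1) c d by (simp add: Cons)
      then show False using d l(2) by (simp add: Cons prod_eq_iff)
    qed
  qed simp
  then show ?thesis using w by (simp add: wact_bpow lact_a stab_def bact_def)
qed

text \<open>Conjugate by the word that prepends the first letter \<open>c\<close>. Removing
  \<open>c\<close> takes the complement of \<open>cyl (c # p)\<close> outside \<open>cyl p\<close>: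
  either \<open>c\<close> is stripped, or the result starts with the letter cancelling against
  \<open>c\<close>, which \<open>p\<close> does not start with.\<close>

lemma compress_cyl:
  assumes b: "\<And>e. \<rho> e (\<iota> 1) \<noteq> 0" and p: "valid p" "p \<noteq> []"
  shows "\<exists>u. \<forall>\<omega>\<in>nforms - cyl p. wact u \<omega> \<in> cyl p"
  using p
proof (induction p)
  case (Cons c p)
  have c: "\<rho> (snd c) (\<iota> (fst c)) = fst c" "\<not> cancels (snd c) p" "valid p" using Cons.prems by auto
  have into: "wact (letter_word c) \<omega> \<in> cyl (c # p)" if "\<omega> \<in> cyl p" "\<not> cancels (snd c) (fst \<omega>)" for \<omega>
  proof -
    obtain l t where w: "\<omega> = (p @ l, t)" "valid (p @ l)" using \<open>\<omega> \<in> cyl p\<close> by (cases \<omega>) (auto simp: cyl_def nforms_def)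
    have "wact (letter_word c) \<omega> = (c # p @ l, t)"
      unfolding w by (rule wact_letter_word) (use c w that in auto)
    moreover have "wact (letter_word c) \<omega> \<in> nforms" using that by (intro wact_closed) (simp add: cyl_def)
    ultimately show ?thesis by (auto simp: cyl_def)
  qed
  show ?case
  proof (cases "p = []")
    case True
    \<comment> \<open>For one letter, b does the work: it lies in neither associated subgroup, so it
      turns the leading exponent 0 into a nonzero one, after which \<open>c\<close> can be prepended
      without cancellation.\<close>
    have "wact (letter_word c @ [lb] @ letter_word_inv c) \<omega> \<in> cyl [c]" if w: "\<omega> \<in> nforms - cyl [c]" for \<omega>
    proof -
      define v where "v = wact (letter_word_inv c) \<omega>"
      have v: "v \<in> nforms" unfolding v_def using w by (intro wact_closed) simp
      have "\<nexists>l'. fst \<omega> = c # l'" using w by (auto simp: cyl_def)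
      then obtain l' where l': "fst v = (0, \<not> snd c) # l'"
        using wact_letter_word_inv_other[of "fst \<omega>" c "snd \<omega>"] w c by (auto simp: nforms_def v_def)
      have "fst (lact lb \<omega>') = shift (fst \<omega>') (\<iota> 1)" for \<omega>' by (simp add: lb_def lact_b bact_def)
      then have "fst (wact [lb] v) = shift ((0, \<not> snd c) # l') (\<iota> 1)" by (simp only: wact_simps l')
      then have "\<not> cancels (snd c) (fst (wact [lb] v))" using b by (simp add: iota_zero)
      moreover have "wact [lb] v \<in> nforms" using v by (rule wact_closed)
      ultimately have "wact (letter_word c) (wact [lb] v) \<in> cyl (c # p)"
        by (intro into) (auto simp: True cyl_def)
      then show ?thesis by (simp add: True v_def)
    qed
    then show ?thesis unfolding True by blast
  next
    case False
    then obtain u where u: "\<And>\<omega>. \<omega> \<in> nforms - cyl p \<Longrightarrow> wact u \<omega> \<in> cyl p" using Cons.IH c by blast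
    have "wact (letter_word c @ u @ letter_word_inv c) \<omega> \<in> cyl (c # p)" if w: "\<omega> \<in> nforms - cyl (c # p)" for \<omega>
    proof -
      let ?v = "wact (letter_word_inv c) \<omega>"
      have v: "?v \<in> nforms" using w by (intro wact_closed) simp
      have "?v \<notin> cyl p"
      proof (cases "\<exists>l'. fst \<omega> = c # l'")
        case True
        then obtain l' where l': "\<omega> = (c # l', snd \<omega>)" by (metis prod.collapse)
        then have "valid (c # l')" using w by (metis DiffD1 fst_conv mem_Collect_eq nforms_def)
        then have "?v = (l', snd \<omega>)" using wact_letter_word_inv_Cons l' by metis
        moreover have "\<nexists>l. l' = p @ l"
          using w l' by (metis (mono_tags, lifting) DiffD1 DiffD2 append_Cons cyl_def fst_conv mem_Collect_eq)
        ultimately show ?thesis by (simp add: cyl_def)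
      next
        case False
        then obtain l' where l': "fst ?v = (0, \<not> snd c) # l'"
          using wact_letter_word_inv_other[of "fst \<omega>" c "snd \<omega>"] w c by (auto simp: nforms_def)
        show ?thesis
        proof
          assume "?v \<in> cyl p"
          then obtain l where "fst ?v = p @ l" by (auto simp: cyl_def)
          then show False using c(2) l' \<open>p \<noteq> []\<close> by (cases p) auto
        qed
      qed
      then have uv: "wact u ?v \<in> cyl p" using u v by blast
      then obtain l where "fst (wact u ?v) = p @ l" by (auto simp: cyl_def)
      then have "\<not> cancels (snd c) (fst (wact u ?v))" using c(2) False by (cases p) auto
      then show ?thesis using into[OF uv] by simp
    qed
    then show ?thesis by blast
  qed
qed simp

end

section \<open>Displacement and compression for the limit group\<close>

context bs_limit
begin

text \<open>If the coefficient of e_0 is nonzero, the first exponent changes. Otherwise the letter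
  stays and \<open>x\<close> is replaced by a nonzero element of smaller degree. Exponent 1 is
  nonzero, so such letters may follow any prefix.\<close>

lemma shift_moves:
  "x \<noteq> 0 \<Longrightarrow> \<exists>k. shift (replicate k (1, True)) x \<noteq> replicate k (1, True)"
proof (induction "degree x" arbitrary: x rule: less_induct)
  case less
  show ?case
  proof (cases "coeff x 0 = 0")
    case False
    then show ?thesis by (intro exI[of _ 1]) (simp add: rho_lim_def)
  next
    case True
    then obtain k where k: "shift (replicate k (1, True)) (theta_lim m \<xi> True x) \<noteq> replicate k (1, True)"
      using less.hyps theta_True_decreases[OF True less.prems] by blast
    have "nxt (1, True) x = theta_lim m \<xi> True x" using True by (simp add: nxt_def rho_lim_def)
    then show ?thesis using k by (intro exI[of _ "Suc k"]) simp
  qed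
qed

lemma valid_append_b: "valid p \<Longrightarrow> s \<noteq> 0 \<Longrightarrow> valid (p @ [(s, True)])"
  by (intro valid_append_Cons) (simp_all add: rho_lim_def)

lemma valid_append_replicate: "valid p \<Longrightarrow> valid (p @ replicate k (1, True))"
proof (induction k)
  case (Suc k)
  then show ?case using valid_append_b[of "p @ replicate k (1, True)" 1]
    by (simp add: replicate_append_same)
qed simp

text \<open>Past a prefix \<open>p\<close> longer than \<open>w\<close>, the word replaces
  \<open>p\<close> by some \<open>q\<close> and shifts the rest by some \<open>x\<close>. A further
  extension of \<open>p\<close> makes source and image incompatible: if \<open>q = p\<close> it
  exposes \<open>x\<close>, which is nonzero by freeness; if one prefix properly extends the other,
  a single letter avoiding a given one is enough.\<close>

lemma displace_cyl:
  assumes w: "w \<in> carrier F2" "w \<notin> act_ker" and p0: "valid p0"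
  shows "\<exists>r. valid (p0 @ r) \<and> wact w ` cyl (p0 @ r) \<inter> cyl (p0 @ r) = {}"
proof -
  define p where "p = p0 @ replicate (Suc (length w)) (1, True)"
  have p: "valid p" "length w < length p"
    unfolding p_def by (rule valid_append_replicate[OF p0]) simp
  obtain q x where q: "\<And>l t. valid (p @ l) \<Longrightarrow> wact w (p @ l, t) = (q @ shift l x, carry l x + t)"
    using wact_long_prefix[OF p(2)] by blast
  have "\<exists>r. valid (p @ r) \<and> (\<forall>l l'. valid (p @ r @ l) \<longrightarrow> q @ shift (r @ l) x \<noteq> p @ r @ l')"
  proof (cases "q = p")
    case True
    have "x \<noteq> 0"
    proof
      assume "x = 0"
      then have "wact w (p, 0) = (p, 0)" using q[of "[]" 0] p True by simp
      then show False using act_free w by blast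
    qed
    then obtain k where k: "shift (replicate k (1, True)) x \<noteq> replicate k (1, True)" using shift_moves by blast
    have "q @ shift (replicate k (1, True) @ l) x \<noteq> p @ replicate k (1, True) @ l'" for l l'
      using k by (simp add: True shift_append append_eq_append_conv)
    then show ?thesis using valid_append_replicate[OF p(1), of k] by blast
  next
    case False
    \<comment> \<open>Only one value of \<open>s\<close> can be excluded, so two candidates suffice;
      both are nonzero, which keeps the extended prefix valid.\<close>
    have two: "\<exists>s\<in>{1, 2 :: int}. (s + i, True) \<noteq> d" for i and d :: "int \<times> bool"
      by (cases d) auto
    consider r where "p = q @ r" "r \<noteq> []" | r where "q = p @ r" "r \<noteq> []"
      | "\<nexists>r. p = q @ r" "\<nexists>r. q = p @ r" using False by auto
    then show ?thesis
    proof cases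
      case 1
      obtain s where s: "s \<in> {1, 2 :: int}" "(s + coeff x 0, True) \<noteq> hd r" using two by blast
      have "q @ shift ([(s, True)] @ l) x \<noteq> p @ [(s, True)] @ l'" for l l'
        using s(2) 1 by (cases r) (auto simp: rho_lim_def add.commute)
      moreover have "valid (p @ [(s, True)])" using s(1) by (intro valid_append_b p) auto
      ultimately show ?thesis by blast
    next
      case 2
      obtain s where s: "s \<in> {1, 2 :: int}" "(s + 0, True) \<noteq> hd r" using two by blast
      have "q @ shift ([(s, True)] @ l) x \<noteq> p @ [(s, True)] @ l'" for l l'
        using s(2) 2 by (cases r) auto
      moreover have "valid (p @ [(s, True)])" using s(1) by (intro valid_append_b p) auto
      ultimately show ?thesis by blast
    next
      case 3
      have "q @ l \<noteq> p @ l'" for l l'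
        using 3 by (auto simp: append_eq_append_conv2)
      then show ?thesis using p(1) by (intro exI[of _ "[]"]) simp
    qed
  qed
  then obtain r where r: "valid (p @ r)"
    "\<And>l l'. valid (p @ r @ l) \<Longrightarrow> q @ shift (r @ l) x \<noteq> p @ r @ l'" by blast
  have "wact w \<omega> \<notin> cyl (p @ r)" if "\<omega> \<in> cyl (p @ r)" for \<omega>
  proof -
    obtain l t where l: "\<omega> = (p @ r @ l, t)" "valid (p @ r @ l)"
      using \<open>\<omega> \<in> cyl (p @ r)\<close> by (cases \<omega>) (auto simp: cyl_def nforms_def)
    show ?thesis using r(2)[OF l(2)] q[OF l(2)] by (auto simp: l(1) cyl_def)
  qed
  then have "valid (p @ r) \<and> wact w ` cyl (p @ r) \<inter> cyl (p @ r) = {}" using r(1) by blast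
  then show ?thesis unfolding p_def append_assoc by blast
qed

lemma proximal_action_limit:
  "proximal_action (F2 Mod act_ker) nforms quot_act {cyl p |p. valid p}"
proof -
  interpret K: normal act_ker F2 by (rule normal_act_ker)
  interpret Q: group "F2 Mod act_ker" by (rule K.factorgroup_is_group)
  have rep: "\<exists>w\<in>carrier F2. g = act_ker #>\<^bsub>F2\<^esub> w" if "g \<in> carrier (F2 Mod act_ker)" for g
    using that by (auto simp: carrier_FactGroup)
  show ?thesis
  proof
    fix g \<omega> assume "g \<in> carrier (F2 Mod act_ker)" "\<omega> \<in> nforms"
    then show "quot_act g \<omega> \<in> nforms" using rep[of g] by (auto simp: quot_act_coset wact_closed)
  next
    fix \<omega> assume "\<omega> \<in> nforms"
    then have "quot_act (act_ker #>\<^bsub>F2\<^esub> \<one>\<^bsub>F2\<^esub>) \<omega> = \<omega>" by (simp add: quot_act_coset) (simp add: one_F2)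
    then show "quot_act \<one>\<^bsub>F2 Mod act_ker\<^esub> \<omega> = \<omega>" using K.subset by simp
  next
    fix g h \<omega>
    assume g: "g \<in> carrier (F2 Mod act_ker)" and h: "h \<in> carrier (F2 Mod act_ker)" and o: "\<omega> \<in> nforms"
    obtain u v where uv: "u \<in> carrier F2" "v \<in> carrier F2"
      "g = act_ker #>\<^bsub>F2\<^esub> u" "h = act_ker #>\<^bsub>F2\<^esub> v" using rep g h by meson
    then have "g \<otimes>\<^bsub>F2 Mod act_ker\<^esub> h = act_ker #>\<^bsub>F2\<^esub> (u \<otimes>\<^bsub>F2\<^esub> v)" by (simp add: K.rcos_sum)
    then show "quot_act (g \<otimes>\<^bsub>F2 Mod act_ker\<^esub> h) \<omega> = quot_act g (quot_act h \<omega>)"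
      using uv o by (simp add: quot_act_coset wact_mult wact_closed)
  next
    fix X assume "X \<in> {cyl p |p. valid p}"
    then obtain p where "X = cyl p" "valid p" by blast
    then show "X \<subseteq> nforms" "X \<noteq> {}" using Pair_in_cyl[of p 0] by (auto simp: cyl_def)
  next
    fix X Y assume "X \<in> {cyl p |p. valid p}" "Y \<in> {cyl p |p. valid p}"
    then obtain p q where pq: "X = cyl p" "Y = cyl q" "valid p" "valid q" by blast
    show "X \<inter> Y = {} \<or> (\<exists>Z\<in>{cyl p |p. valid p}. Z \<subseteq> X \<inter> Y)"
    proof (cases "X \<inter> Y = {}")
      case False
      then have "(\<exists>r. p = q @ r) \<or> (\<exists>r. q = p @ r)" using cyl_meet pq by blast
      then have "X \<subseteq> Y \<or> Y \<subseteq> X" using cyl_append pq by blast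
      then show ?thesis using pq by blast
    qed simp
  next
    fix g X assume g: "g \<in> carrier (F2 Mod act_ker)" "g \<noteq> \<one>\<^bsub>F2 Mod act_ker\<^esub>"
      and X: "X \<in> {cyl p |p. valid p}"
    obtain p where p: "X = cyl p" "valid p" using X by blast
    obtain w where w: "w \<in> carrier F2" "g = act_ker #>\<^bsub>F2\<^esub> w" using rep g(1) by blast
    have "w \<notin> act_ker" using g(2) w K.coset_eq_one_iff[OF w(1)] by simp
    then obtain r where r: "valid (p @ r)" "wact w ` cyl (p @ r) \<inter> cyl (p @ r) = {}"
      using displace_cyl[OF w(1) _ p(2)] by blast
    have "quot_act g ` cyl (p @ r) = wact w ` cyl (p @ r)"
      by (rule image_cong) (use w in \<open>auto simp: quot_act_coset cyl_def\<close>)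
    then have "cyl (p @ r) \<subseteq> X \<and> quot_act g ` cyl (p @ r) \<inter> cyl (p @ r) = {}"
      using r(2) cyl_append p(1) by simp
    then show "\<exists>Y\<in>{cyl p |p. valid p}. Y \<subseteq> X \<and> quot_act g ` Y \<inter> Y = {}"
      using r(1) by blast
  next
    \<comment> \<open>The subgroup for sign \<open>True\<close> has infinite index, so every integer
      is a representative, and distinct first letters give disjoint cylinders.\<close>
    let ?V = "\<lambda>i::nat. cyl [(int i, True)]"
    have "range ?V \<subseteq> {cyl p |p. valid p}" by (auto simp: rho_lim_def intro!: exI)
    moreover have "disjoint_family ?V" by (auto simp: disjoint_family_on_def cyl_def)
    ultimately show "\<exists>V :: nat \<Rightarrow> _. range V \<subseteq> {cyl p |p. valid p} \<and> disjoint_family V" by blast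
  next
    fix X assume "X \<in> {cyl p |p. valid p}"
    then obtain p where p: "X = cyl p" "valid p" by blast
    \<comment> \<open>Here |m| > 1 puts b outside the subgroup of index |m|; outside the span of
      e_1, e_2, ... it lies anyway.\<close>
    have b: "rho_lim m \<xi> e [:1:] \<noteq> 0" for e
    proof -
      have "\<not> m dvd 1" using m by auto
      then show ?thesis by (cases e) (auto simp: rho_lim_def mod_eq_0_iff_dvd)
    qed
    have "\<exists>u. \<forall>\<omega>\<in>nforms - cyl p. wact u \<omega> \<in> cyl p"
    proof (cases "p = []")
      case True
      then show ?thesis by (simp add: cyl_def)
    qed (use compress_cyl[OF b p(2)] in blast)
    then obtain u where u: "\<And>\<omega>. \<omega> \<in> nforms - cyl p \<Longrightarrow> wact u \<omega> \<in> cyl p" by blast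
    have ru: "reduce u \<in> carrier F2" by (simp add: carrier_F2)
    have "quot_act (act_ker #>\<^bsub>F2\<^esub> reduce u) ` (nforms - X) \<subseteq> X"
      using u by (auto simp: p(1) quot_act_coset[OF ru] wact_reduce)
    moreover have "act_ker #>\<^bsub>F2\<^esub> reduce u \<in> carrier (F2 Mod act_ker)" using ru by (auto simp: carrier_FactGroup)
    ultimately show "\<exists>g\<in>carrier (F2 Mod act_ker). quot_act g ` (nforms - X) \<subseteq> X" by blast
  qed
qed

end

theorem theorem4p1:
  fixes m :: int and \<xi> :: "nat \<Rightarrow> int"
  assumes "\<bar>m\<bar> > 1" and "\<xi> \<in> madic m"
  shows "strongly_powers (F2 Mod BSbar m \<xi>) \<and> cstar_simple (F2 Mod BSbar m \<xi>)"
proof -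
  interpret bs_limit m \<xi> by unfold_locales (fact assms)+
  interpret P: proximal_action "F2 Mod act_ker" nforms quot_act "{cyl p |p. valid p}"
    by (rule proximal_action_limit)
  show ?thesis
    unfolding BSbar_eq
    using P.strongly_powers P.powers_imp_cstar_simple[OF P.powers_group P.infinite_carrier] by blast
qed

end
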